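(* There exist a universal constant $C>0$ and an algorithm which, given a positive integer $L$, an $N$-element pseudometric space $(\mathcal M,\rho)$, a set-valued mapping $F:\mathcal M\to\mathcal{PG}_L(\mathbb R^2)$, and a constant $\lambda>0$, produces one of the following two outcomes. Outcome 1 ("No-Go"): the algorithm guarantees that there does not exist a Lipschitz mapping $f:\mathcal M\to\mathbb R^2$ with Lipschitz constant at most $\lambda$ such that $f(x)\in F(x)$ for all $x\in\mathcal M$. Outcome 2 ("Success"): the algorithm returns a Lipschitz mapping $f:\mathcal M\to\mathbb R^2$ with Lipschitz constant at most $3\lambda$ such that $f(x)\in F(x)$ for all $x\in\mathcal M$. This algorithm requires at most $CL^2N^2$ computer operations and at most $CL^2N^2$ units of computer memory.
   Context: $\mathcal{PG}_L(\mathbb R^2)$ is the family of all convex polygons in $\mathbb R^2$ (not necessarily bounded), each of which is defined by at most $L$ linear constraints, i.e. is the intersection of at most $L$ closed half-planes; each $F(x)$ is given to the algorithm as a list of such half-planes $\{u:\langle \mathbf h,u\rangle+\alpha\le0\}$, $\mathbf h\in\mathbb R^2\setminus\{0\}$, $\alpha\in\mathbb R$. A pseudometric on $\mathcal M$ is a function $\rho:\mathcal M\times\mathcal M\to[0,+\infty]$ with $\rho(x,x)=0$, $\rho(x,y)=\rho(y,x)$ and $\rho(x,y)\le\rho(x,z)+\rho(z,y)$ (zero distance between distinct points and the value $+\infty$ are allowed); it is given by its $N\times N$ table of values. $f:\mathcal M\to\mathbb R^2$ has Lipschitz constant at most $\lambda$ if $\|f(x)-f(y)\|\le\lambda\rho(x,y)$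 for all $x,y\in\mathcal M$, where $\|u\|=\max\{|u_1|,|u_2|\}$ (no constraint when $\rho(x,y)=+\infty$). Computational model: an idealized von Neumann computer handling exact real numbers; an operation is an arithmetic operation (addition, subtraction, multiplication, division, comparison of two real numbers) or an access to a value in RAM. *)

theory Defs
  imports "HOL-Analysis.Analysis"
begin

subsection \<open>Pseudometrics, Lipschitz maps, polygons\<close>

definition pseudometric_on :: "'a set \<Rightarrow> ('a \<Rightarrow> 'a \<Rightarrow> ennreal) \<Rightarrow> bool" where
  "pseudometric_on M \<rho> \<longleftrightarrow>
     (\<forall>x\<in>M. \<rho> x x = 0) \<and>
     (\<forall>x\<in>M. \<forall>y\<in>M. \<rho> x y = \<rho> y x) \<and>
     (\<forall>x\<in>M. \<forall>y\<in>M. \<forall>z\<in>M. \<rho> x y \<le> \<rho> x z + \<rho> z y)"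

text \<open>The maximum norm on the plane; the type-class norm on pairs is the Euclidean one.\<close>

definition max_norm :: "real \<times> real \<Rightarrow> real" where
  "max_norm u = max \<bar>fst u\<bar> \<bar>snd u\<bar>"

text \<open>For \<open>K > 0\<close> the bound is \<open>\<infinity>\<close>, i.e. no constraint, whenever \<open>\<rho> x y = \<infinity>\<close>.\<close>

definition lipschitz_le ::
  "'a set \<Rightarrow> ('a \<Rightarrow> 'a \<Rightarrow> ennreal) \<Rightarrow> real \<Rightarrow> ('a \<Rightarrow> real \<times> real) \<Rightarrow> bool" where
  "lipschitz_le M \<rho> K f \<longleftrightarrow>
     (\<forall>x\<in>M. \<forall>y\<in>M. ennreal (max_norm (f x - f y)) \<le> ennreal K * \<rho> x y)"

text \<open>The pair \<open>(h, \<alpha>)\<close> is the linear constraint \<open>h \<bullet> u + \<alpha> \<le> 0\<close>.\<close>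

type_synonym linear_constraint = "(real \<times> real) \<times> real"

definition half_plane :: "linear_constraint \<Rightarrow> (real \<times> real) set" where
  "half_plane c = {u. fst c \<bullet> u + snd c \<le> 0}"

definition presents :: "nat \<Rightarrow> linear_constraint list \<Rightarrow> (real \<times> real) set \<Rightarrow> bool" where
  "presents L cs P \<longleftrightarrow>
     length cs \<le> L \<and> (\<forall>c\<in>set cs. fst c \<noteq> 0) \<and> P = (\<Inter>c\<in>set cs. half_plane c)"

text \<open>The whole plane (no constraint) and the empty set (inconsistent constraints) are
  not excluded.\<close>

definition PG :: "nat \<Rightarrow> (real \<times> real) set set" where
  "PG L = {P. \<exists>cs. presents L cs P}"


subsection \<open>A random access machine with exact real arithmetic\<close>

text \<open>The machine has a single memory, consisting of finitely many cells, each holding one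
  real number; the cell addresses are the natural numbers below the size of the memory.
  Addresses are computed by the same arithmetic as data. The only literals are natural
  numbers, so that no information can be hidden in a real constant of a program.\<close>

type_synonym memory = "real list"

datatype arith = Plus | Minus | Times | Divide

datatype expr = Lit nat | Fetch expr | Arith arith expr expr

datatype compare = Less | Leq

datatype prog =
    Skip
  | Store expr expr
  | Seq prog prog
  | Cond compare expr expr prog prog
  | Loop compare expr expr prog

text \<open>An address must be a natural number below the size of the memory. There is no
  rounding, hence no hidden floor operation.\<close>

definition valid_address :: "memory \<Rightarrow> real \<Rightarrow> bool" where
  "valid_address m v \<longleftrightarrow> v \<in> \<nat> \<and> v < real (length m)"

fun apply_arith :: "arith \<Rightarrow> real \<Rightarrow> real \<Rightarrow> real option" where
  "apply_arith Plus v w = Some (v + w)"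
| "apply_arith Minus v w = Some (v - w)"
| "apply_arith Times v w = Some (v * w)"
| "apply_arith Divide v w = (if w = 0 then None else Some (v / w))"

fun apply_compare :: "compare \<Rightarrow> real \<Rightarrow> real \<Rightarrow> bool" where
  "apply_compare Less v w \<longleftrightarrow> v < w"
| "apply_compare Leq v w \<longleftrightarrow> v \<le> w"

text \<open>\<open>None\<close> is a run-time error: division by zero or access to an invalid address.\<close>

fun eval :: "memory \<Rightarrow> expr \<Rightarrow> real option" where
  "eval m (Lit n) = Some (real n)"
| "eval m (Fetch a) = (case eval m a of None \<Rightarrow> None
     | Some v \<Rightarrow> if valid_address m v then Some (m ! nat \<lfloor>v\<rfloor>) else None)"
| "eval m (Arith f a b) = (case (eval m a, eval m b) of
       (Some v, Some w) \<Rightarrow> apply_arith f v w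
     | _ \<Rightarrow> None)"

text \<open>The number of operations performed when evaluating an expression. Besides arithmetic
  operations and memory accesses, literals are charged too.\<close>

fun ops :: "expr \<Rightarrow> nat" where
  "ops (Lit n) = 1"
| "ops (Fetch a) = ops a + 1"
| "ops (Arith f a b) = ops a + ops b + 1"

text \<open>\<open>exec p m t m'\<close>: started on memory \<open>m\<close>, the program \<open>p\<close> halts without run-time error
  after exactly \<open>t\<close> operations, leaving the memory \<open>m'\<close>.\<close>

inductive exec :: "prog \<Rightarrow> memory \<Rightarrow> nat \<Rightarrow> memory \<Rightarrow> bool" where
  Skip: "exec Skip m 0 m"
| Store: "eval m a = Some v \<Longrightarrow> valid_address m v \<Longrightarrow> eval m e = Some w \<Longrightarrow>
    exec (Store a e) m (ops a + ops e + 1) (m[nat \<lfloor>v\<rfloor> := w])"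
| Seq: "exec p m t m' \<Longrightarrow> exec q m' t' m'' \<Longrightarrow> exec (Seq p q) m (t + t') m''"
| Cond_True: "eval m a = Some v \<Longrightarrow> eval m b = Some w \<Longrightarrow> apply_compare r v w \<Longrightarrow> exec p m t m' \<Longrightarrow>
    exec (Cond r a b p q) m (ops a + ops b + 1 + t) m'"
| Cond_False: "eval m a = Some v \<Longrightarrow> eval m b = Some w \<Longrightarrow> \<not> apply_compare r v w \<Longrightarrow> exec q m t m' \<Longrightarrow>
    exec (Cond r a b p q) m (ops a + ops b + 1 + t) m'"
| Loop_False: "eval m a = Some v \<Longrightarrow> eval m b = Some w \<Longrightarrow> \<not> apply_compare r v w \<Longrightarrow>
    exec (Loop r a b p) m (ops a + ops b + 1) m"
| Loop_True: "eval m a = Some v \<Longrightarrow> eval m b = Some w \<Longrightarrow> apply_compare r v w \<Longrightarrow>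
    exec p m t m' \<Longrightarrow> exec (Loop r a b p) m' t' m'' \<Longrightarrow>
    exec (Loop r a b p) m (ops a + ops b + 1 + t + t') m''"

text \<open>The machine is deterministic: result and running time are functions of program and
  initial memory.\<close>

lemma exec_deterministic:
  "exec p m t m' \<Longrightarrow> exec p m s m'' \<Longrightarrow> t = s \<and> m' = m''"
proof (induction arbitrary: s m'' rule: exec.induct)
  case Skip
  from Skip.prems show ?case by cases auto
next
  case Store
  from Store.prems Store.hyps show ?case by cases auto
next
  case (Seq p m t m' q t' m2)
  from Seq.prems obtain r1 r2 n where
    "exec p m r1 n" "exec q n r2 m''" "s = r1 + r2" by cases auto
  with Seq.IH(1)[of r1 n] Seq.IH(2)[of r2 m''] show ?case by simp
next
  case (Cond_True m a v b w r p t m' q)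
  from Cond_True.prems Cond_True.hyps obtain u where
    "exec p m u m''" "s = ops a + ops b + 1 + u" by cases auto
  with Cond_True.IH[of u m''] show ?case by simp
next
  case (Cond_False m a v b w r q t m' p)
  from Cond_False.prems Cond_False.hyps obtain u where
    "exec q m u m''" "s = ops a + ops b + 1 + u" by cases auto
  with Cond_False.IH[of u m''] show ?case by simp
next
  case Loop_False
  from Loop_False.prems Loop_False.hyps show ?case by cases auto
next
  case (Loop_True m a v b w r p t m' t' m2)
  from Loop_True.prems Loop_True.hyps(1-3) obtain r1 r2 n where
    "exec p m r1 n" "exec (Loop r a b p) n r2 m''" "s = ops a + ops b + 1 + r1 + r2"
    by cases auto
  with Loop_True.IH(1)[of r1 n] Loop_True.IH(2)[of r2 m''] show ?case by simp
qed


subsection \<open>Input and output\<close>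

text \<open>The points of the pseudometric space are named by their indices \<open>0, \<dots>, N - 1\<close>. A
  distance \<open>\<infinity>\<close> is stored as \<open>-1\<close>. A list of at most \<open>L\<close> constraints is stored as its length
  followed by its constraints, three numbers each, padded with zeros to \<open>L\<close> constraints.\<close>

definition encode_dist :: "ennreal \<Rightarrow> real" where
  "encode_dist d = (if d = \<infinity> then - 1 else enn2real d)"

definition encode_constraints :: "nat \<Rightarrow> linear_constraint list \<Rightarrow> real list" where
  "encode_constraints L cs =
     real (length cs) # concat (map (\<lambda>((h1, h2), \<alpha>). [h1, h2, \<alpha>]) cs)
       @ replicate (3 * (L - length cs)) 0"

definition encode_input ::
  "nat \<Rightarrow> nat \<Rightarrow> (nat \<Rightarrow> nat \<Rightarrow> ennreal) \<Rightarrow> (nat \<Rightarrow> linear_constraint list) \<Rightarrow> real \<Rightarrow> real list" where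
  "encode_input L N \<rho> H lam =
     [real L, real N, lam]
       @ concat (map (\<lambda>x. map (\<lambda>y. encode_dist (\<rho> x y)) [0..<N]) [0..<N])
       @ concat (map (\<lambda>x. encode_constraints L (H x)) [0..<N])"

text \<open>The initial memory of a machine with \<open>S\<close> cells. The input starts at address \<open>b\<close>, a
  constant belonging to the program; the cells below \<open>b\<close> serve as its global variables.\<close>

definition initial_memory :: "nat \<Rightarrow> nat \<Rightarrow> real list \<Rightarrow> memory" where
  "initial_memory b S inp = replicate b 0 @ inp @ replicate (S - b - length inp) 0"

text \<open>The output also starts at address \<open>b\<close>: a verdict (\<open>0\<close> for No-Go, \<open>1\<close> for Success),
  followed in the second case by the coordinates of \<open>f 0, \<dots>, f (N - 1)\<close>.\<close>

definition no_go :: "nat \<Rightarrow> memory \<Rightarrow> bool" where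
  "no_go b m \<longleftrightarrow> m ! b = 0"

definition success :: "nat \<Rightarrow> memory \<Rightarrow> bool" where
  "success b m \<longleftrightarrow> m ! b = 1"

definition output_map :: "nat \<Rightarrow> memory \<Rightarrow> nat \<Rightarrow> real \<times> real" where
  "output_map b m x = (m ! (b + 1 + 2 * x), m ! (b + 2 + 2 * x))"

end

theory Submission imports Defs begin

text \<open>The constraints of \<open>F z\<close>, normalised to \<open>p u\<^sub>1 + q u\<^sub>2 \<le> \<gamma>\<close> with \<open>\<bar>p\<bar> + \<bar>q\<bar> = 1\<close> and relaxed by
  \<open>\<lambda> \<rho> x z\<close>, hold at \<open>x\<close> for every \<open>\<lambda>\<close>-Lipschitz selection. Eliminating a coordinate from two of
  them bounds the other coordinate at \<open>x\<close>. Extending these bounds to \<open>\<lambda>\<close>-Lipschitz functions as McShane does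
  either exhibits a contradiction or gives a \<open>\<lambda>\<close>-Lipschitz map \<open>g\<close> that obeys all bounds obtained from pairs.
  If \<open>d\<close> is the largest violation of a relaxed constraint at \<open>g x\<close>, attained with the normal
  \<open>(p, q)\<close>, then the corner \<open>f x = g x - d (sgn p, sgn q)\<close> of the square of radius \<open>d\<close> around \<open>g x\<close> obeys all
  relaxed constraints, and \<open>f\<close> is \<open>3\<lambda>\<close>-Lipschitz; both facts use only the bounds from pairs.

  All pairs at all points would cost too much. The constraints with \<open>p < 0\<close> are therefore sorted
  by slope once; at each \<open>x\<close> a monotone stack turns them into an upper envelope of lines, and
  each constraint with \<open>p \<ge> 0\<close> is tested against the envelope at the current bound only. The
  bound and the active line move in one direction, so the work at \<open>x\<close> is linear.\<close>

subsection \<open>A while language with variables and arrays\<close>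

text \<open>The factor 3 is 1 + 2. Between points at distance r, \<open>g\<close> moves by at most
  \<lambda>r and \<open>d\<close> changes by at most 2\<lambda>r, which gives 3\<lambda>r where the
  two shifts have equal signs. Where the signs are opposite the violations add up, but the bounds
  from pairs keep their sum below 2\<lambda>r. The obstacle is the cost. There are n \<le> N L
  constraints in all, so n^2 steps are affordable once, but not at every point. The sorts and the
  comparison of opposite constraints are therefore kept out of the work per point, and the latter is
  linear in n only by amortisation: pops of the stack and moves of the active line are paid from
  potentials. Bounds stay homogeneous fractions while a point is processed, so that the absence of a
  bound needs no case distinction. Infinite distances are negative numbers;
  \<open>0 \<le> \<rho> x y\<close> means "finite" throughout. Programs are verified at one credit
  per assignment or test, and a factor fixed by the program text converts credits into machine
  operations.\<close>

datatype loc = Var nat | Inp nat | Arr nat nat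

datatype aexp = Num nat | V nat | I aexp | A nat aexp | Bin arith aexp aexp

abbreviation aplus (infixl "\<oplus>" 65) where "a \<oplus> b \<equiv> Bin Plus a b"
abbreviation aminus (infixl "\<ominus>" 65) where "a \<ominus> b \<equiv> Bin Minus a b"
abbreviation atimes (infixl "\<otimes>" 70) where "a \<otimes> b \<equiv> Bin Times a b"
abbreviation adivide (infixl "\<oslash>" 70) where "a \<oslash> b \<equiv> Bin Divide a b"

datatype com = CSkip | SetV nat aexp | SetI aexp aexp | SetA nat aexp aexp
  | CSeq com com (infixr ";;" 60)
  | CIf compare aexp aexp com com | CWhile compare aexp aexp com

type_synonym state = "loc \<Rightarrow> real"

definition idx :: "real \<Rightarrow> nat" where "idx v = nat \<lfloor>v\<rfloor>"

lemma idx_of_nat [simp]: "idx (real n) = n" by (simp add: idx_def)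

fun arith_val :: "arith \<Rightarrow> real \<Rightarrow> real \<Rightarrow> real" where
  "arith_val Plus v w = v + w"
| "arith_val Minus v w = v - w"
| "arith_val Times v w = v * w"
| "arith_val Divide v w = v / w"

fun aval :: "state \<Rightarrow> aexp \<Rightarrow> real" where
  "aval s (Num n) = real n"
| "aval s (V v) = s (Var v)"
| "aval s (I e) = s (Inp (idx (aval s e)))"
| "aval s (A k e) = s (Arr k (idx (aval s e)))"
| "aval s (Bin f a b) = arith_val f (aval s a) (aval s b)"

definition is_index :: "nat \<Rightarrow> real \<Rightarrow> bool" where "is_index n v \<longleftrightarrow> (\<exists>i<n. v = real i)"

lemma is_index_of_nat [simp]: "is_index n (real i) \<longleftrightarrow> i < n"
  by (auto simp: is_index_def)

lemma is_index_const [simp]: "is_index n 0 \<longleftrightarrow> 0 < n" "is_index n 1 \<longleftrightarrow> 1 < n"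
    "is_index n (numeral k) \<longleftrightarrow> numeral k < n"
  using is_index_of_nat[of n 0] is_index_of_nat[of n 1] is_index_of_nat[of n "numeral k"]
  by (simp_all del: is_index_of_nat)

lemma idx_const [simp]: "idx 0 = 0" "idx 1 = 1" "idx (numeral k) = numeral k"
  by (simp_all add: idx_def)

text \<open>Cell \<open>0\<close> holds the address at which the arrays start; the variables are the cells
  \<open>1, \<dots>, 63\<close>, the input starts at \<open>64\<close>, and the arrays are interleaved with stride \<open>32\<close>, so
  that distinct locations have distinct addresses whatever the sizes are.\<close>

fun compile_exp :: "aexp \<Rightarrow> expr" where
  "compile_exp (Num n) = Lit n"
| "compile_exp (V v) = Fetch (Lit v)"
| "compile_exp (I e) = Fetch (Arith Plus (Lit 64) (compile_exp e))"
| "compile_exp (A k e) =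
     Fetch (Arith Plus (Arith Plus (Fetch (Lit 0)) (Arith Times (Lit 32) (compile_exp e))) (Lit k))"
| "compile_exp (Bin f a b) = Arith f (compile_exp a) (compile_exp b)"

fun compile :: "com \<Rightarrow> prog" where
  "compile CSkip = Skip"
| "compile (SetV v e) = Store (Lit v) (compile_exp e)"
| "compile (SetI i e) = Store (Arith Plus (Lit 64) (compile_exp i)) (compile_exp e)"
| "compile (SetA k i e) =
     Store (Arith Plus (Arith Plus (Fetch (Lit 0)) (Arith Times (Lit 32) (compile_exp i))) (Lit k))
       (compile_exp e)"
| "compile (CSeq c d) = Seq (compile c) (compile d)"
| "compile (CIf r a b c d) = Cond r (compile_exp a) (compile_exp b) (compile c) (compile d)"
| "compile (CWhile r a b c) = Loop r (compile_exp a) (compile_exp b) (compile c)"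

text \<open>The factor between steps of \<open>runs\<close> and machine operations. A step evaluates
  the expressions of one assignment or test, so the total size of all expressions in the command
  suffices, however often a loop repeats.\<close>

fun width :: "com \<Rightarrow> nat" where
  "width CSkip = 0"
| "width (SetV v e) = ops (compile_exp e) + 2"
| "width (SetI i e) = ops (compile_exp i) + ops (compile_exp e) + 3"
| "width (SetA k i e) = ops (compile_exp i) + ops (compile_exp e) + 8"
| "width (CSeq c d) = width c + width d"
| "width (CIf r a b c d) = ops (compile_exp a) + ops (compile_exp b) + 1 + width c + width d"
| "width (CWhile r a b c) = ops (compile_exp a) + ops (compile_exp b) + 1 + width c"

text \<open>Indices are computed at run time; hence a write to one cell counts as touching the whole
  array or the whole input.\<close>

fun touches :: "com \<Rightarrow> loc \<Rightarrow> bool" where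
  "touches CSkip l = False"
| "touches (SetV v e) l = (l = Var v)"
| "touches (SetI i e) l = (\<exists>j. l = Inp j)"
| "touches (SetA k i e) l = (\<exists>j. l = Arr k j)"
| "touches (CSeq c d) l = (touches c l \<or> touches d l)"
| "touches (CIf r a b c d) l = (touches c l \<or> touches d l)"
| "touches (CWhile r a b c) l = touches c l"

section \<open>Semantics of the language and correctness of the compiler\<close>

locale machine =
  fixes il cp :: nat  \<comment> \<open>length of the input and capacity of each array\<close>
begin

fun safe :: "state \<Rightarrow> aexp \<Rightarrow> bool" where
  "safe s (Num n) = True"
| "safe s (V v) = (1 \<le> v \<and> v < 64)"
| "safe s (I e) = (safe s e \<and> is_index il (aval s e))"
| "safe s (A k e) = (k < 32 \<and> safe s e \<and> is_index cp (aval s e))"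
| "safe s (Bin f a b) = (safe s a \<and> safe s b \<and> (f = Divide \<longrightarrow> aval s b \<noteq> 0))"

inductive runs :: "com \<Rightarrow> state \<Rightarrow> nat \<Rightarrow> state \<Rightarrow> bool" where
  Skip: "runs CSkip s 0 s"
| SetV: "1 \<le> v \<Longrightarrow> v < 64 \<Longrightarrow> safe s e \<Longrightarrow> runs (SetV v e) s 1 (s(Var v := aval s e))"
| SetI: "safe s i \<Longrightarrow> is_index il (aval s i) \<Longrightarrow> safe s e \<Longrightarrow>
    runs (SetI i e) s 1 (s(Inp (idx (aval s i)) := aval s e))"
| SetA: "k < 32 \<Longrightarrow> safe s i \<Longrightarrow> is_index cp (aval s i) \<Longrightarrow> safe s e \<Longrightarrow>
    runs (SetA k i e) s 1 (s(Arr k (idx (aval s i)) := aval s e))"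
| Seq: "runs c s k s' \<Longrightarrow> runs d s' k' s'' \<Longrightarrow> runs (CSeq c d) s (k + k') s''"
| If_True: "safe s a \<Longrightarrow> safe s b \<Longrightarrow> apply_compare r (aval s a) (aval s b) \<Longrightarrow> runs c s k s' \<Longrightarrow>
    runs (CIf r a b c d) s (1 + k) s'"
| If_False: "safe s a \<Longrightarrow> safe s b \<Longrightarrow> \<not> apply_compare r (aval s a) (aval s b) \<Longrightarrow> runs d s k s' \<Longrightarrow>
    runs (CIf r a b c d) s (1 + k) s'"
| While_False: "safe s a \<Longrightarrow> safe s b \<Longrightarrow> \<not> apply_compare r (aval s a) (aval s b) \<Longrightarrow>
    runs (CWhile r a b c) s 1 s"
| While_True: "safe s a \<Longrightarrow> safe s b \<Longrightarrow> apply_compare r (aval s a) (aval s b) \<Longrightarrow>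
    runs c s k s' \<Longrightarrow> runs (CWhile r a b c) s' k' s'' \<Longrightarrow>
    runs (CWhile r a b c) s (1 + k + k') s''"

text \<open>The address map read backwards. Locations without an address, such as
  \<open>Var 0\<close> or \<open>Arr 32 0\<close>, are invisible in \<open>mem\<close>;
  \<open>safe\<close> and the side conditions of \<open>runs\<close> keep programs away from
  them.\<close>

definition cell :: "state \<Rightarrow> nat \<Rightarrow> real" where
  "cell s a = (if a = 0 then real (64 + il) else if a < 64 then s (Var a)
     else if a < 64 + il then s (Inp (a - 64))
     else s (Arr ((a - (64 + il)) mod 32) ((a - (64 + il)) div 32)))"

definition mem :: "state \<Rightarrow> memory" where
  "mem s = map (cell s) [0..<64 + il + 32 * cp]"

lemma length_mem [simp]: "length (mem s) = 64 + il + 32 * cp"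
  by (simp add: mem_def)

lemma nth_mem: "a < 64 + il + 32 * cp \<Longrightarrow> mem s ! a = cell s a"
  by (simp add: mem_def)

lemma valid_address_of_nat [simp]: "valid_address m (real a) \<longleftrightarrow> a < length m"
  by (simp add: valid_address_def)

lemma valid_address_const [simp]: "valid_address m 0 \<longleftrightarrow> 0 < length m"
  using valid_address_of_nat[of m 0] by (simp del: valid_address_of_nat)

lemma array_address: "real (64 + il) + real 32 * real i + real k = real (64 + il + 32 * i + k)"
  by simp

lemma input_address: "real 64 + real i = real (64 + i)"
  by simp

lemma array_bound: "i < cp \<Longrightarrow> k < 32 \<Longrightarrow> 64 + il + 32 * i + k < 64 + il + 32 * cp"
  by linarith

lemma cell_Arr: "k < 32 \<Longrightarrow> cell s (64 + il + 32 * i + k) = s (Arr k i)"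
  by (simp add: cell_def)

lemma cell_Inp: "i < il \<Longrightarrow> cell s (64 + i) = s (Inp i)"
  by (simp add: cell_def)

lemma eval_compile_exp: "safe s e \<Longrightarrow> eval (mem s) (compile_exp e) = Some (aval s e)"
proof (induction e)
  case (I e)
  then obtain i where i: "i < il" "aval s e = real i" by (auto simp: is_index_def)
  then show ?case using I by (simp add: input_address nth_mem cell_Inp del: of_nat_numeral of_nat_add)
next
  case (A k e)
  then obtain i where i: "i < cp" "aval s e = real i" by (auto simp: is_index_def)
  have "eval (mem s) (compile_exp (A k e)) = Some (cell s (64 + il + 32 * i + k))"
    using A i array_bound[OF i(1), of k]
    by (simp add: array_address nth_mem[of 0] nth_mem[of "64 + il + 32 * i + k"]
        cell_def[of s 0] del: of_nat_numeral of_nat_add)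
  then show ?case using A i cell_Arr by simp
next
  case (Bin f a b)
  then show ?case by (cases f) auto
qed (auto simp: nth_mem cell_def)

lemma mem_upd_Var: "1 \<le> v \<Longrightarrow> v < 64 \<Longrightarrow> (mem s)[v := w] = mem (s(Var v := w))"
  by (intro nth_equalityI) (auto simp: nth_list_update nth_mem cell_def)

lemma mem_upd_Inp: "i < il \<Longrightarrow> (mem s)[64 + i := w] = mem (s(Inp i := w))"
  by (intro nth_equalityI) (auto simp: nth_list_update nth_mem cell_def)

lemma array_address_unique:
  fixes a b i k :: nat
  assumes "b \<le> a" "(a - b) mod 32 = k" "(a - b) div 32 = i"
  shows "b + 32 * i + k = a"
  using assms div_mult_mod_eq[of "a - b" 32] by linarith

lemma mem_upd_Arr:
  assumes "k < 32"
  shows "(mem s)[64 + il + 32 * i + k := w] = mem (s(Arr k i := w))"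
proof (intro nth_equalityI)
  fix a assume a: "a < length ((mem s)[64 + il + 32 * i + k := w])"
  show "(mem s)[64 + il + 32 * i + k := w] ! a = mem (s(Arr k i := w)) ! a"
  proof (cases "a = 64 + il + 32 * i + k")
    case True
    then show ?thesis using a assms by (simp add: nth_mem cell_Arr)
  next
    case False
    then have "\<not> (64 + il \<le> a \<and> (a - (64 + il)) mod 32 = k \<and> (a - (64 + il)) div 32 = i)"
      using array_address_unique[of "64 + il" a k i] by auto
    then show ?thesis using a False by (auto simp: nth_mem cell_def)
  qed
qed simp

lemma nat_floor_real: "nat \<lfloor>real n\<rfloor> = n" by simp

text \<open>Induction on the run. The width of a compound command dominates the widths of its parts,
  so the bounds for the parts of a run add up to one for the whole.\<close>

lemma runs_exec:
  "runs c s k s' \<Longrightarrow> \<exists>t. exec (compile c) (mem s) t (mem s') \<and> t \<le> width c * k"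
proof (induction rule: runs.induct)
  case (Skip s)
  show ?case by (auto intro: exec.Skip)
next
  case (SetV v s e)
  have "exec (compile (SetV v e)) (mem s) (ops (Lit v) + ops (compile_exp e) + 1)
      ((mem s)[nat \<lfloor>real v\<rfloor> := aval s e])"
    unfolding compile.simps
    by (rule exec.Store) (use SetV in \<open>auto simp: eval_compile_exp\<close>)
  then have "exec (compile (SetV v e)) (mem s) (ops (Lit v) + ops (compile_exp e) + 1)
      (mem (s(Var v := aval s e)))"
    using SetV by (simp only: nat_floor_real mem_upd_Var)
  then show ?case by (intro exI conjI) (assumption, simp)
next
  case (SetI s i e)
  then obtain j where j: "j < il" "aval s i = real j" by (auto simp: is_index_def)
  have "exec (compile (SetI i e)) (mem s)
      (ops (Arith Plus (Lit 64) (compile_exp i)) + ops (compile_exp e) + 1)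
      ((mem s)[nat \<lfloor>real (64 + j)\<rfloor> := aval s e])"
    unfolding compile.simps
    by (rule exec.Store) (use SetI j in \<open>auto simp: eval_compile_exp input_address simp del: of_nat_numeral of_nat_add\<close>)
  then have "exec (compile (SetI i e)) (mem s)
      (ops (Arith Plus (Lit 64) (compile_exp i)) + ops (compile_exp e) + 1)
      (mem (s(Inp (idx (aval s i)) := aval s e)))"
    using j by (simp only: nat_floor_real mem_upd_Inp idx_of_nat)
  then show ?case by (intro exI conjI) (assumption, simp)
next
  case (SetA k s i e)
  then obtain j where j: "j < cp" "aval s i = real j" by (auto simp: is_index_def)
  have "exec (compile (SetA k i e)) (mem s)
      (ops (Arith Plus (Arith Plus (Fetch (Lit 0)) (Arith Times (Lit 32) (compile_exp i))) (Lit k))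
        + ops (compile_exp e) + 1)
      ((mem s)[nat \<lfloor>real (64 + il + 32 * j + k)\<rfloor> := aval s e])"
    unfolding compile.simps
    by (rule exec.Store)
      (use SetA j array_bound[OF j(1), of k] in \<open>auto simp: eval_compile_exp array_address
        nth_mem[of 0] cell_def[of s 0] simp del: of_nat_numeral of_nat_add\<close>)
  then have "exec (compile (SetA k i e)) (mem s)
      (ops (Arith Plus (Arith Plus (Fetch (Lit 0)) (Arith Times (Lit 32) (compile_exp i))) (Lit k))
        + ops (compile_exp e) + 1) (mem (s(Arr k (idx (aval s i)) := aval s e)))"
    using j SetA by (simp only: nat_floor_real mem_upd_Arr idx_of_nat)
  then show ?case by (intro exI conjI) (assumption, simp)
next
  case (Seq c s k s' d k' s'')
  then obtain t t' where "exec (compile c) (mem s) t (mem s')" "t \<le> width c * k"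
      "exec (compile d) (mem s') t' (mem s'')" "t' \<le> width d * k'" by auto
  moreover from this have "t + t' \<le> width (CSeq c d) * (k + k')"
    by (simp add: algebra_simps)
  ultimately show ?case unfolding compile.simps by (blast intro: exec.Seq)
next
  case (If_True s a b r c k s' d)
  then obtain t where t: "exec (compile c) (mem s) t (mem s')" "t \<le> width c * k" by auto
  have "exec (compile (CIf r a b c d)) (mem s) (ops (compile_exp a) + ops (compile_exp b) + 1 + t) (mem s')"
    unfolding compile.simps
    by (rule exec.Cond_True) (use If_True t in \<open>auto simp: eval_compile_exp\<close>)
  moreover have "ops (compile_exp a) + ops (compile_exp b) + 1 + t \<le> width (CIf r a b c d) * (1 + k)"
    using t by (simp add: algebra_simps)
  ultimately show ?case by blast
next
  case (If_False s a b r d k s' c)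
  then obtain t where t: "exec (compile d) (mem s) t (mem s')" "t \<le> width d * k" by auto
  have "exec (compile (CIf r a b c d)) (mem s) (ops (compile_exp a) + ops (compile_exp b) + 1 + t) (mem s')"
    unfolding compile.simps
    by (rule exec.Cond_False) (use If_False t in \<open>auto simp: eval_compile_exp\<close>)
  moreover have "ops (compile_exp a) + ops (compile_exp b) + 1 + t \<le> width (CIf r a b c d) * (1 + k)"
    using t by (simp add: algebra_simps)
  ultimately show ?case by blast
next
  case (While_False s a b r c)
  have "exec (compile (CWhile r a b c)) (mem s) (ops (compile_exp a) + ops (compile_exp b) + 1) (mem s)"
    unfolding compile.simps
    by (rule exec.Loop_False) (use While_False in \<open>auto simp: eval_compile_exp\<close>)
  then show ?case by fastforce
next
  case (While_True s a b r c k s' k' s'')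
  then obtain t t' where t: "exec (compile c) (mem s) t (mem s')" "t \<le> width c * k"
      "exec (compile (CWhile r a b c)) (mem s') t' (mem s'')" "t' \<le> width (CWhile r a b c) * k'"
    by auto
  have "exec (compile (CWhile r a b c)) (mem s)
      (ops (compile_exp a) + ops (compile_exp b) + 1 + t + t') (mem s'')"
    unfolding compile.simps
    by (rule exec.Loop_True) (use While_True t in \<open>auto simp: eval_compile_exp\<close>)
  moreover have "ops (compile_exp a) + ops (compile_exp b) + 1 + t + t'
      \<le> width (CWhile r a b c) * (1 + k + k')"
    using t by (simp add: algebra_simps)
  ultimately show ?case by blast
qed

lemma runs_frame: "runs c s k s' \<Longrightarrow> \<not> touches c l \<Longrightarrow> s' l = s l"
  by (induction rule: runs.induct) auto

subsection \<open>Weakest preconditions with time credits\<close>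

text \<open>The last argument is the number of credits left. Credits may be negative: if they are
  known to be bounded below afterwards, the difference bounds the running time.\<close>

definition wp :: "com \<Rightarrow> (state \<Rightarrow> real \<Rightarrow> bool) \<Rightarrow> state \<Rightarrow> real \<Rightarrow> bool" where
  "wp c Q s t \<longleftrightarrow> (\<exists>k s'. runs c s k s' \<and> Q s' (t - real k))"

lemma wp_Skip [simp]: "Q s t \<Longrightarrow> wp CSkip Q s t"
  unfolding wp_def using runs.Skip by fastforce

lemma wp_SetV: "1 \<le> v \<Longrightarrow> v < 64 \<Longrightarrow> safe s e \<Longrightarrow> Q (s(Var v := aval s e)) (t - 1) \<Longrightarrow>
    wp (SetV v e) Q s t"
  unfolding wp_def by (intro exI conjI, rule runs.SetV) simp_all

lemma wp_SetI: "safe s i \<Longrightarrow> is_index il (aval s i) \<Longrightarrow> safe s e \<Longrightarrow>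
    Q (s(Inp (idx (aval s i)) := aval s e)) (t - 1) \<Longrightarrow> wp (SetI i e) Q s t"
  unfolding wp_def by (intro exI conjI, rule runs.SetI) simp_all

lemma wp_SetA: "k < 32 \<Longrightarrow> safe s i \<Longrightarrow> is_index cp (aval s i) \<Longrightarrow> safe s e \<Longrightarrow>
    Q (s(Arr k (idx (aval s i)) := aval s e)) (t - 1) \<Longrightarrow> wp (SetA k i e) Q s t"
  unfolding wp_def by (intro exI conjI, rule runs.SetA) simp_all

lemma wp_Seq: "wp c (wp d Q) s t \<Longrightarrow> wp (CSeq c d) Q s t"
  unfolding wp_def
proof clarify
  fix k s' k' s''
  assume "runs c s k s'" "runs d s' k' s''" "Q s'' (t - real k - real k')"
  then show "\<exists>k s'. runs (c ;; d) s k s' \<and> Q s' (t - real k)"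
    by (intro exI[of _ "k + k'"] exI[of _ s'']) (simp add: runs.Seq diff_diff_eq)
qed

lemma wp_If: "safe s a \<Longrightarrow> safe s b \<Longrightarrow>
    (apply_compare r (aval s a) (aval s b) \<Longrightarrow> wp c Q s (t - 1)) \<Longrightarrow>
    (\<not> apply_compare r (aval s a) (aval s b) \<Longrightarrow> wp d Q s (t - 1)) \<Longrightarrow> wp (CIf r a b c d) Q s t"
  unfolding wp_def
proof (cases "apply_compare r (aval s a) (aval s b)")
  case True
  assume "safe s a" "safe s b"
    and "apply_compare r (aval s a) (aval s b) \<Longrightarrow> \<exists>k s'. runs c s k s' \<and> Q s' (t - 1 - real k)"
  with True obtain k s' where "runs c s k s'" "Q s' (t - 1 - real k)" by blast
  then show "\<exists>k s'. runs (CIf r a b c d) s k s' \<and> Q s' (t - real k)"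
    using True \<open>safe s a\<close> \<open>safe s b\<close>
    by (intro exI[of _ "1 + k"] exI[of _ s']) (auto intro: runs.If_True[simplified] simp: algebra_simps)
next
  case False
  assume "safe s a" "safe s b"
    and "\<not> apply_compare r (aval s a) (aval s b) \<Longrightarrow> \<exists>k s'. runs d s k s' \<and> Q s' (t - 1 - real k)"
  with False obtain k s' where "runs d s k s'" "Q s' (t - 1 - real k)" by blast
  then show "\<exists>k s'. runs (CIf r a b c d) s k s' \<and> Q s' (t - real k)"
    using False \<open>safe s a\<close> \<open>safe s b\<close>
    by (intro exI[of _ "1 + k"] exI[of _ s']) (auto intro: runs.If_False[simplified] simp: algebra_simps)
qed

lemma wp_conseq: "wp c Q s t \<Longrightarrow> (\<And>s' t'. Q s' t' \<Longrightarrow> R s' t') \<Longrightarrow> wp c R s t"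
  unfolding wp_def by blast

lemma wp_frame: "wp c Q s t \<Longrightarrow> wp c (\<lambda>s' t'. Q s' t' \<and> (\<forall>l. \<not> touches c l \<longrightarrow> s' l = s l)) s t"
  unfolding wp_def using runs_frame by blast

lemma wp_conseq_frame:
  assumes "wp c Q s t"
    and "\<And>s' t'. Q s' t' \<Longrightarrow> (\<And>l. \<not> touches c l \<Longrightarrow> s' l = s l) \<Longrightarrow> R s' t'"
  shows "wp c R s t"
  using wp_conseq[OF wp_frame[OF assms(1)]] assms(2) by blast

text \<open>Every test costs a credit, so a lower bound on the credits proves termination.\<close>

lemma wp_While:
  assumes inv: "J s t"
    and bound: "\<And>s t. J s t \<Longrightarrow> e \<le> t"
    and safe: "\<And>s t. J s t \<Longrightarrow> safe s a \<and> safe s b"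
    and step: "\<And>s t. J s t \<Longrightarrow> apply_compare r (aval s a) (aval s b) \<Longrightarrow> wp c J s (t - 1)"
    and exit: "\<And>s t. J s t \<Longrightarrow> \<not> apply_compare r (aval s a) (aval s b) \<Longrightarrow> Q s (t - 1)"
  shows "wp (CWhile r a b c) Q s t"
proof -
  obtain n :: nat where "t - e < real n" using reals_Archimedean2 by blast
  then show ?thesis using inv
  proof (induction n arbitrary: s t)
    case 0
    then show ?case using bound[of s t] by simp
  next
    case (Suc n)
    show ?case
    proof (cases "apply_compare r (aval s a) (aval s b)")
      case True
      from step[OF Suc.prems(2) True] obtain k s' where k: "runs c s k s'" "J s' (t - 1 - real k)"
        unfolding wp_def by blast
      have "wp (CWhile r a b c) Q s' (t - 1 - real k)"
        by (rule Suc.IH) (use Suc.prems k in auto)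
      then obtain k' s'' where k': "runs (CWhile r a b c) s' k' s''" "Q s'' (t - 1 - real k - real k')"
        unfolding wp_def by blast
      have "runs (CWhile r a b c) s (1 + k + k') s''"
        using runs.While_True[OF _ _ True k(1) k'(1)] safe[OF Suc.prems(2)] by blast
      moreover have "t - real (1 + k + k') = t - 1 - real k - real k'" by simp
      ultimately show ?thesis using k'(2) unfolding wp_def by metis
    next
      case False
      then have "runs (CWhile r a b c) s 1 s" using runs.While_False safe[OF Suc.prems(2)] by blast
      then show ?thesis using exit[OF Suc.prems(2) False] unfolding wp_def
        by (metis of_nat_1)
    qed
  qed
qed

end

definition CFor :: "nat \<Rightarrow> aexp \<Rightarrow> com \<Rightarrow> com" where
  "CFor v e c = (SetV v (Num 0) ;; CWhile Less (V v) e (c ;; SetV v (V v \<oplus> Num 1)))"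

lemma touches_CFor [simp]: "touches (CFor v e c) l \<longleftrightarrow> l = Var v \<or> touches c l"
  by (auto simp: CFor_def)

context machine
begin

text \<open>Amortised cost: a round may exceed \<open>B\<close> by as much as it raises the
  potential \<open>\<phi>\<close>. The 2 added to \<open>B\<close> pays for the test and the
  increment, the final 2 for the initial assignment and the failing test. \<open>J\<close> and
  \<open>\<phi>\<close> must ignore the counter because the increment takes place after the body.
  The frame hypothesis lets the body recover everything that no earlier round has written.\<close>

lemma wp_For:
  assumes v: "1 \<le> v" "v < 64"
    and init: "J 0 s0"
    and ins: "\<And>i s w. J i (s(Var v := w)) = J i s"
    and insp: "\<And>s w. \<phi> (s(Var v := w)) = (\<phi> s :: real)"
    and bnd: "\<And>i s. J i s \<Longrightarrow> i \<le> m \<Longrightarrow> (\<And>l. l \<noteq> Var v \<Longrightarrow> \<not> touches c l \<Longrightarrow> s l = s0 l) \<Longrightarrow>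
        safe s e \<and> aval s e = real m"
    and step: "\<And>i s t. i < m \<Longrightarrow> J i s \<Longrightarrow> s (Var v) = real i \<Longrightarrow>
        (\<And>l. l \<noteq> Var v \<Longrightarrow> \<not> touches c l \<Longrightarrow> s l = s0 l) \<Longrightarrow>
        wp c (\<lambda>s' t'. s' (Var v) = real i \<and> J (Suc i) s' \<and> t' + \<phi> s' \<ge> t + \<phi> s - B) s t"
  shows "wp (CFor v e c) (\<lambda>s' t'. J m s' \<and> s' (Var v) = real m \<and>
      t' + \<phi> s' \<ge> t + \<phi> s0 - (real m * (B + 2) + 2)) s0 t"
proof -
  define Q where "Q = (\<lambda>s' t'. J m s' \<and> s' (Var v) = real m \<and>
      t' + \<phi> s' \<ge> t + \<phi> s0 - (real m * (B + 2) + 2))"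
  have main: "wp (CWhile Less (V v) e (c ;; SetV v (V v \<oplus> Num 1))) Q s t'"
    if "s (Var v) = real i" "i \<le> m" "J i s"
      "\<forall>l. l \<noteq> Var v \<longrightarrow> \<not> touches c l \<longrightarrow> s l = s0 l"
      "t' + \<phi> s \<ge> t + \<phi> s0 - 1 - real i * (B + 2)" for i s t'
    using that
  proof (induction "m - i" arbitrary: i s t')
    case 0
    then have [simp]: "i = m" by simp
    have b: "safe s e \<and> aval s e = real m" using bnd[of i s] 0 by auto
    have "runs (CWhile Less (V v) e (c ;; SetV v (V v \<oplus> Num 1))) s 1 s"
      by (rule runs.While_False) (use b 0 v in auto)
    moreover have "Q s (t' - 1)" using 0 unfolding Q_def by simp
    ultimately show ?case unfolding wp_def by (metis of_nat_1)
  next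
    case (Suc d)
    then have lt: "i < m" by simp
    have b: "safe s e \<and> aval s e = real m" using bnd[of i s] Suc by auto
    from step[OF lt Suc.prems(3,1), of "t' - 1"] Suc.prems(4)
    obtain k s1 where k: "runs c s k s1" "s1 (Var v) = real i" "J (Suc i) s1"
      "t' - 1 - real k + \<phi> s1 \<ge> t' - 1 + \<phi> s - B" unfolding wp_def by blast
    define s2 where "s2 = s1(Var v := real (Suc i))"
    have r2: "runs (SetV v (V v \<oplus> Num 1)) s1 1 s2"
      using runs.SetV[OF v, of s1 "V v \<oplus> Num 1"] v k(2) by (simp add: s2_def add.commute)
    have r: "runs (c ;; SetV v (V v \<oplus> Num 1)) s (k + 1) s2" by (rule runs.Seq[OF k(1) r2])
    have "wp (CWhile Less (V v) e (c ;; SetV v (V v \<oplus> Num 1))) Q s2 (t' - 2 - real k)"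
    proof (rule Suc.hyps(1)[of "Suc i"])
      show "\<forall>l. l \<noteq> Var v \<longrightarrow> \<not> touches c l \<longrightarrow> s2 l = s0 l"
        using runs_frame[OF k(1)] Suc.prems(4) by (auto simp: s2_def)
      have "\<phi> s2 = \<phi> s1" unfolding s2_def by (rule insp)
      then show "t' - 2 - real k + \<phi> s2 \<ge> t + \<phi> s0 - 1 - real (Suc i) * (B + 2)"
        using k(4) Suc.prems(5) by (simp add: algebra_simps)
    qed (use Suc lt k in \<open>auto simp: s2_def ins\<close>)
    then obtain k' s3 where k': "runs (CWhile Less (V v) e (c ;; SetV v (V v \<oplus> Num 1))) s2 k' s3"
      "Q s3 (t' - 2 - real k - real k')" unfolding wp_def by blast
    have "runs (CWhile Less (V v) e (c ;; SetV v (V v \<oplus> Num 1))) s (1 + (k + 1) + k') s3"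
      by (rule runs.While_True[OF _ _ _ r k'(1)]) (use b Suc.prems lt v in auto)
    moreover have "t' - real (1 + (k + 1) + k') = t' - 2 - real k - real k'" by simp
    ultimately show ?case using k'(2) unfolding wp_def by metis
  qed
  have "wp (CFor v e c) Q s0 t" unfolding CFor_def
    by (intro wp_Seq wp_SetV v main[of _ 0]) (use v init insp in \<open>auto simp: ins\<close>)
  then show ?thesis unfolding Q_def .
qed

end

subsection \<open>The geometric selection\<close>

text \<open>Unlike \<open>sgn\<close> never 0, so that a shift by \<open>d * sg v\<close> has length
  exactly \<open>d\<close>. At the constraint that attains a violation the argument is nonzero by
  \<open>box_nonzero\<close>.\<close>

definition sg :: "real \<Rightarrow> real" where "sg v = (if 0 < v then 1 else - 1)"

lemma abs_sg [simp]: "\<bar>sg v\<bar> = 1" by (simp add: sg_def)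

text \<open>A negative value of \<open>\<rho>\<close> stands for infinite distance;
  \<open>tri\<close> therefore also says that being at finite distance is transitive. The
  normalisation in \<open>norm\<close> is dual to the maximum norm: moving a point by at most r in
  each coordinate changes the left-hand side of a constraint by at most r.\<close>

locale shifted_constraints =
  fixes N n :: nat and \<rho> :: "nat \<Rightarrow> nat \<Rightarrow> real" and lam :: real
    and p q \<gamma> :: "nat \<Rightarrow> real" and z :: "nat \<Rightarrow> nat"
  assumes refl: "x < N \<Longrightarrow> \<rho> x x = 0"
    and sym: "x < N \<Longrightarrow> y < N \<Longrightarrow> \<rho> x y = \<rho> y x"
    and tri: "x < N \<Longrightarrow> y < N \<Longrightarrow> w < N \<Longrightarrow> 0 \<le> \<rho> x y \<Longrightarrow> 0 \<le> \<rho> y w \<Longrightarrow>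
        0 \<le> \<rho> x w \<and> \<rho> x w \<le> \<rho> x y + \<rho> y w"
    and lam: "0 < lam"
    and norm: "i < n \<Longrightarrow> \<bar>p i\<bar> + \<bar>q i\<bar> = 1"
    and z: "i < n \<Longrightarrow> z i < N"
begin

definition act :: "nat \<Rightarrow> nat set" where "act x = {i. i < n \<and> 0 \<le> \<rho> x (z i)}"

definition sh :: "nat \<Rightarrow> nat \<Rightarrow> real" where "sh i x = \<gamma> i + lam * \<rho> x (z i)"

text \<open>The bounds on the second coordinate of a feasible point that follow from two constraints
  by eliminating the first coordinate.\<close>

definition box :: "nat \<Rightarrow> real \<Rightarrow> bool" where
  "box x g \<longleftrightarrow> (\<forall>i\<in>act x. \<forall>j\<in>act x. p i * p j < 0 \<longrightarrow>
     (\<bar>p i\<bar> * q j + \<bar>p j\<bar> * q i) * g \<le> \<bar>p i\<bar> * sh j x + \<bar>p j\<bar> * sh i x) \<and>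
   (\<forall>i\<in>act x. p i = 0 \<longrightarrow> q i * g \<le> sh i x)"

section \<open>Lipschitz estimates for the violation and for the corner\<close>

lemma sh_shift:
  assumes "i \<in> act x" "x < N" "y < N" "0 \<le> \<rho> x y"
  shows "i \<in> act y" "sh i y \<le> sh i x + lam * \<rho> x y"
proof -
  have i: "i < n" "z i < N" "0 \<le> \<rho> x (z i)" using assms z by (auto simp: act_def)
  have "0 \<le> \<rho> y (z i) \<and> \<rho> y (z i) \<le> \<rho> y x + \<rho> x (z i)"
    using tri[of y x "z i"] assms i sym[of x y] by simp
  then have r: "0 \<le> \<rho> y (z i)" "\<rho> y (z i) \<le> \<rho> x y + \<rho> x (z i)" using assms sym by auto
  then show "i \<in> act y" using i by (simp add: act_def)
  show "sh i y \<le> sh i x + lam * \<rho> x y"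
    using mult_left_mono[OF r(2), of lam] lam by (simp add: sh_def algebra_simps)
qed

text \<open>Weighted by \<bar>p j\<bar> and \<bar>p i\<bar>, the first coordinate cancels between
  the constraints i and j at y, because \<open>p i\<close> and \<open>p j\<close> have opposite
  signs; what remains is bounded by the box at y. Transporting constraint i from y to x costs r on
  the right-hand side and, by normalisation, another r on the left-hand side.\<close>

lemma elimination:
  assumes r: "0 \<le> r" and opp: "p i * p j < 0"
    and n: "\<bar>p i\<bar> + \<bar>q i\<bar> = 1"
    and box: "(\<bar>p i\<bar> * q j + \<bar>p j\<bar> * q i) * g2y \<le> \<bar>p i\<bar> * gj + \<bar>p j\<bar> * giy"
    and giy: "giy \<le> gix + r"
    and dx: "dx = p i * g1x + q i * g2x - gix" and dy: "dy = p j * g1y + q j * g2y - gj"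
    and g1: "\<bar>g1x - g1y\<bar> \<le> r" and g2: "\<bar>g2x - g2y\<bar> \<le> r"
  shows "\<bar>p i\<bar> * dy + \<bar>p j\<bar> * dx \<le> 2 * \<bar>p j\<bar> * r"
proof -
  have e: "p i * \<bar>p j\<bar> = - (p j * \<bar>p i\<bar>)" using opp by (auto simp: abs_if mult_less_0_iff)
  have "\<bar>p j\<bar> * giy \<le> \<bar>p j\<bar> * (gix + r)" using giy by (intro mult_left_mono) auto
  then have "\<bar>p i\<bar> * dy + \<bar>p j\<bar> * dx \<le> \<bar>p j\<bar> * p i * (g1x - g1y) + \<bar>p j\<bar> * (q i * (g2x - g2y)) + \<bar>p j\<bar> * r"
    using box unfolding dx dy by (simp add: algebra_simps e)
  also have "\<dots> = \<bar>p j\<bar> * (p i * (g1x - g1y) + q i * (g2x - g2y) + r)" by (simp add: algebra_simps)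
  also have "\<dots> \<le> \<bar>p j\<bar> * (\<bar>p i\<bar> * r + \<bar>q i\<bar> * r + r)"
  proof (intro mult_left_mono add_mono)
    show "p i * (g1x - g1y) \<le> \<bar>p i\<bar> * r"
      using mult_left_mono[OF g1, of "\<bar>p i\<bar>"] abs_ge_self[of "p i * (g1x - g1y)"] by (simp add: abs_mult)
    show "q i * (g2x - g2y) \<le> \<bar>q i\<bar> * r"
      using mult_left_mono[OF g2, of "\<bar>q i\<bar>"] abs_ge_self[of "q i * (g2x - g2y)"] by (simp add: abs_mult)
  qed auto
  also have "\<dots> = \<bar>p j\<bar> * ((\<bar>p i\<bar> + \<bar>q i\<bar>) * r + r)" by (simp add: algebra_simps)
  also have "\<dots> = 2 * \<bar>p j\<bar> * r" unfolding n by simp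
  finally show ?thesis .
qed

text \<open>Elimination at y and at x bounds the same weighted sum of violations by 2 \<bar>p
  j\<bar> r and by 2 \<bar>p i\<bar> r. Taking the smaller of the two weights on the right, the
  weights on the left can be lowered to it, and it cancels.\<close>

lemma opposite_violations:
  assumes xy: "x < N" "y < N" "0 \<le> \<rho> x y"
    and ij: "i \<in> act x" "j \<in> act y" "p i * p j < 0"
    and box: "box x (g2 x)" "box y (g2 y)"
    and g: "\<bar>g1 x - g1 y\<bar> \<le> lam * \<rho> x y" "\<bar>g2 x - g2 y\<bar> \<le> lam * \<rho> x y"
    and dx: "dx = p i * g1 x + q i * g2 x - sh i x" "0 \<le> dx"
    and dy: "dy = p j * g1 y + q j * g2 y - sh j y" "0 \<le> dy"
  shows "dx + dy \<le> 2 * (lam * \<rho> x y)"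
proof -
  have yx: "\<rho> y x = \<rho> x y" using sym xy by simp
  have iy: "i \<in> act y" "sh i y \<le> sh i x + lam * \<rho> x y" using sh_shift[OF ij(1) xy] by auto
  have jx: "j \<in> act x" "sh j x \<le> sh j y + lam * \<rho> x y"
    using sh_shift[OF ij(2) xy(2,1)] xy yx by auto
  have nz: "0 < \<bar>p i\<bar>" "0 < \<bar>p j\<bar>" using ij(3) by auto
  have n: "\<bar>p i\<bar> + \<bar>q i\<bar> = 1" "\<bar>p j\<bar> + \<bar>q j\<bar> = 1" using norm ij by (auto simp: act_def)
  have r: "0 \<le> lam * \<rho> x y" using lam xy by simp
  have ji: "p j * p i < 0" using ij(3) by (simp add: mult.commute)
  have 1: "\<bar>p i\<bar> * dy + \<bar>p j\<bar> * dx \<le> 2 * \<bar>p j\<bar> * (lam * \<rho> x y)"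
    using elimination[OF r ij(3) n(1) _ iy(2) dx(1) dy(1) g] box(2) iy(1) ij
    unfolding box_def by blast
  have g': "\<bar>g1 y - g1 x\<bar> \<le> lam * \<rho> x y" "\<bar>g2 y - g2 x\<bar> \<le> lam * \<rho> x y" using g by auto
  have 2: "\<bar>p j\<bar> * dx + \<bar>p i\<bar> * dy \<le> 2 * \<bar>p i\<bar> * (lam * \<rho> x y)"
    using elimination[OF r ji n(2) _ jx(2) dy(1) dx(1) g'] box(1) jx(1) ij ji
    unfolding box_def by blast
  show ?thesis
  proof (cases "\<bar>p i\<bar> \<le> \<bar>p j\<bar>")
    case True
    then have "\<bar>p i\<bar> * dx \<le> \<bar>p j\<bar> * dx" using dx by (intro mult_right_mono)
    then have "\<bar>p i\<bar> * (dx + dy) \<le> \<bar>p i\<bar> * (2 * (lam * \<rho> x y))" using 2 by (simp add: algebra_simps)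
    then show ?thesis using nz by simp
  next
    case False
    then have "\<bar>p j\<bar> * dy \<le> \<bar>p i\<bar> * dy" using dy by (intro mult_right_mono) auto
    then have "\<bar>p j\<bar> * (dx + dy) \<le> \<bar>p j\<bar> * (2 * (lam * \<rho> x y))" using 1 by (simp add: algebra_simps)
    then show ?thesis using nz by simp
  qed
qed

text \<open>A constraint with \<open>p i = 0\<close> is itself one of the bounds in
  \<open>box\<close>, so it cannot be violated.\<close>

lemma box_nonzero:
  assumes "box x g2" "i \<in> act x" "0 < p i * g1 + q i * g2 - sh i x"
  shows "p i \<noteq> 0"
proof
  assume "p i = 0"
  moreover from this have "q i * g2 \<le> sh i x" using assms unfolding box_def by blast
  ultimately show False using assms(3) by simp
qed

text \<open>A relation rather than a function, since several constraints may attain the largest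
  violation; any of them may choose the corner.\<close>

definition proj :: "nat \<Rightarrow> real \<Rightarrow> real \<Rightarrow> real \<Rightarrow> real \<Rightarrow> real \<Rightarrow> bool" where
  "proj x g1 g2 d f1 f2 \<longleftrightarrow> 0 \<le> d \<and> (\<forall>i\<in>act x. p i * g1 + q i * g2 - sh i x \<le> d) \<and>
     (d = 0 \<and> f1 = g1 \<and> f2 = g2 \<or>
      (\<exists>i\<in>act x. 0 < d \<and> d = p i * g1 + q i * g2 - sh i x \<and>
         f1 = g1 - d * sg (p i) \<and> f2 = g2 - d * sg (q i)))"

text \<open>The constraint attaining the violation at x is also active at y. Its left-hand side
  changes by at most lam * \<rho> x y, and so does its relaxed right-hand side; hence the factor
  2.\<close>

lemma violation_lipschitz:
  assumes xy: "x < N" "y < N" "0 \<le> \<rho> x y"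
    and g: "\<bar>g1 x - g1 y\<bar> \<le> lam * \<rho> x y" "\<bar>g2 x - g2 y\<bar> \<le> lam * \<rho> x y"
    and P: "proj x (g1 x) (g2 x) dx f1x f2x" "proj y (g1 y) (g2 y) dy f1y f2y"
  shows "dx \<le> dy + 2 * (lam * \<rho> x y)"
proof (cases "dx = 0")
  case True
  then show ?thesis using P(2) lam xy by (simp add: proj_def)
next
  case False
  then obtain i where i: "i \<in> act x" "dx = p i * g1 x + q i * g2 x - sh i x"
    using P(1) by (auto simp: proj_def)
  have n: "\<bar>p i\<bar> + \<bar>q i\<bar> = 1" using norm i by (auto simp: act_def)
  have iy: "i \<in> act y" using sh_shift[OF i(1) xy] by auto
  have s: "sh i y \<le> sh i x + lam * \<rho> x y" using sh_shift[OF i(1) xy] by auto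
  have "p i * (g1 x - g1 y) \<le> \<bar>p i\<bar> * (lam * \<rho> x y)"
    using mult_left_mono[OF g(1), of "\<bar>p i\<bar>"] abs_ge_self[of "p i * (g1 x - g1 y)"] by (simp add: abs_mult)
  moreover have "q i * (g2 x - g2 y) \<le> \<bar>q i\<bar> * (lam * \<rho> x y)"
    using mult_left_mono[OF g(2), of "\<bar>q i\<bar>"] abs_ge_self[of "q i * (g2 x - g2 y)"] by (simp add: abs_mult)
  moreover have "\<bar>p i\<bar> * (lam * \<rho> x y) + \<bar>q i\<bar> * (lam * \<rho> x y) = lam * \<rho> x y"
    using n by (metis distrib_right mult_1)
  moreover have "p i * g1 y + q i * g2 y - sh i y \<le> dy" using P(2) iy by (auto simp: proj_def)
  ultimately show ?thesis using i(2) s by (simp add: algebra_simps)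
qed

text \<open>Only the first coordinate is treated; the second one is this lemma for the problem with
  the coordinates swapped.\<close>

lemma proj_lipschitz:
  assumes xy: "x < N" "y < N" "0 \<le> \<rho> x y"
    and g: "\<bar>g1 x - g1 y\<bar> \<le> lam * \<rho> x y" "\<bar>g2 x - g2 y\<bar> \<le> lam * \<rho> x y"
    and box: "box x (g2 x)" "box y (g2 y)"
    and P: "proj x (g1 x) (g2 x) dx f1x f2x" "proj y (g1 y) (g2 y) dy f1y f2y"
  shows "\<bar>f1x - f1y\<bar> \<le> 3 * (lam * \<rho> x y)"
proof -
  have yx: "\<rho> y x = \<rho> x y" using sym xy by simp
  have dxy: "dx \<le> dy + 2 * (lam * \<rho> x y)" by (rule violation_lipschitz[OF xy g P])
  have g': "\<bar>g1 y - g1 x\<bar> \<le> lam * \<rho> y x" "\<bar>g2 y - g2 x\<bar> \<le> lam * \<rho> y x" using g yx by auto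
  have dyx: "dy \<le> dx + 2 * (lam * \<rho> x y)"
    using violation_lipschitz[OF xy(2,1) _ g' P(2,1)] xy yx by simp
  have d: "0 \<le> dx" "0 \<le> dy" using P by (auto simp: proj_def)
  have fx: "\<bar>f1x - g1 x\<bar> \<le> dx" using P(1) by (auto simp: proj_def abs_mult)
  have fy: "\<bar>f1y - g1 y\<bar> \<le> dy" using P(2) by (auto simp: proj_def abs_mult)
  show ?thesis
  proof (cases "dx = 0 \<or> dy = 0")
    \<comment> \<open>One of the points is not shifted, and the shift of the other is its violation,
      at most twice lam * \<rho> x y.\<close>
    case True
    then show ?thesis using dxy dyx d fx fy g by linarith
  next
    case False
    then obtain i j where i: "i \<in> act x" "dx = p i * g1 x + q i * g2 x - sh i x" "f1x = g1 x - dx * sg (p i)"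
      and j: "j \<in> act y" "dy = p j * g1 y + q j * g2 y - sh j y" "f1y = g1 y - dy * sg (p j)"
      and pos: "0 < dx" "0 < dy"
      using P by (auto simp: proj_def)
    have nz: "p i \<noteq> 0" "p j \<noteq> 0"
      using box_nonzero[OF box(1) i(1), of "g1 x"] box_nonzero[OF box(2) j(1), of "g1 y"] pos i(2) j(2)
      by auto
    show ?thesis
    proof (cases "p i * p j < 0")
      case True
      have "dx + dy \<le> 2 * (lam * \<rho> x y)"
        by (rule opposite_violations[where ?g1.0 = g1 and ?g2.0 = g2, OF xy i(1) j(1) True box g i(2) d(1) j(2) d(2)])
      then show ?thesis using fx fy g by linarith
    next
      case False
      then have "sg (p i) = sg (p j)" using nz by (auto simp: sg_def not_less zero_le_mult_iff mult_less_0_iff)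
      then have "f1x - f1y = g1 x - g1 y - (dx - dy) * sg (p j)" using i j by (simp add: algebra_simps)
      then have "\<bar>f1x - f1y\<bar> \<le> \<bar>g1 x - g1 y\<bar> + \<bar>(dx - dy) * sg (p j)\<bar>" by linarith
      also have "\<bar>(dx - dy) * sg (p j)\<bar> = \<bar>dx - dy\<bar>" by (simp add: abs_mult)
      finally show ?thesis using dxy dyx g by linarith
    qed
  qed
qed

text \<open>The hypothesis \<open>neg\<close> says that the shift prescribed by i moves the first
  coordinate in the bad direction for j. Then i and j form a pair, and inserting the violation d of
  i into its bound leaves j with slack at least \<bar>p j\<bar> d / \<bar>p i\<bar>.\<close>

lemma proj_excess:
  assumes box: "box x g2"
    and i: "i \<in> act x" "0 < d" "d = p i * g1 + q i * g2 - sh i x" and j: "j \<in> act x"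
    and neg: "sg (p i) * p j < 0"
  shows "\<bar>p i\<bar> * (p j * g1 + q j * g2) + \<bar>p j\<bar> * d \<le> \<bar>p i\<bar> * sh j x"
proof -
  have nz: "p i \<noteq> 0"
    using box_nonzero[OF box i(1), of g1] i by auto
  have opp: "p i * p j < 0" using neg nz by (auto simp: sg_def mult_less_0_iff split: if_splits)
  have e: "p i * \<bar>p j\<bar> = - (p j * \<bar>p i\<bar>)" using opp by (auto simp: abs_if mult_less_0_iff)
  have "(\<bar>p i\<bar> * q j + \<bar>p j\<bar> * q i) * g2 \<le> \<bar>p i\<bar> * sh j x + \<bar>p j\<bar> * sh i x"
    using box i j opp unfolding box_def by blast
  then show ?thesis unfolding i(3) by (simp add: algebra_simps e)
qed

end

lemma (in shifted_constraints) swapped: "shifted_constraints N n \<rho> lam q p z"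
proof
  show "\<bar>q i\<bar> + \<bar>p i\<bar> = 1" if "i < n" for i using norm[OF that] by simp
qed (fact refl sym tri lam z)+

context shifted_constraints
begin

text \<open>With \<open>P'\<close> and \<open>Q'\<close> the coefficients of j seen along the shift,
  the left-hand side changes by -d (P' + Q'). If both are nonnegative, they sum to 1 and the
  decrease d covers any violation. If one is negative, \<open>proj_excess\<close> provides slack for
  the increase it causes, since \<bar>p i\<bar> and \<bar>q i\<bar> are at most 1. If both are
  negative, the increase is d; as both normals have norm 1, \<bar>p i\<bar> \<le> \<bar>p j\<bar> or
  \<bar>q i\<bar> \<le> \<bar>q j\<bar>, and the corresponding slack is at least d.\<close>

lemma proj_feasible:
  assumes box2: "box x g2" and box1: "shifted_constraints.box n \<rho> lam q p \<gamma> z x g1"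
    and P: "proj x g1 g2 d f1 f2" and j: "j \<in> act x"
  shows "p j * f1 + q j * f2 \<le> sh j x"
proof (cases "d = 0")
  case True
  then show ?thesis using P j by (auto simp: proj_def)
next
  case False
  interpret S: shifted_constraints N n \<rho> lam q p \<gamma> z by (rule swapped)
  from False obtain i where i: "i \<in> act x" "0 < d" "d = p i * g1 + q i * g2 - sh i x"
    "f1 = g1 - d * sg (p i)" "f2 = g2 - d * sg (q i)" using P by (auto simp: proj_def)
  have nz: "0 < \<bar>p i\<bar>" "0 < \<bar>q i\<bar>"
    using box_nonzero[OF box2 i(1), of g1] S.box_nonzero[OF box1 i(1), of g2] i(2,3)
    by (simp_all add: add.commute)
  have n: "\<bar>p i\<bar> + \<bar>q i\<bar> = 1" "\<bar>p j\<bar> + \<bar>q j\<bar> = 1" using norm i j by (auto simp: act_def)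
  define P' where "P' = sg (p i) * p j"
  define Q' where "Q' = sg (q i) * q j"
  have abs: "\<bar>P'\<bar> = \<bar>p j\<bar>" "\<bar>Q'\<bar> = \<bar>q j\<bar>" by (simp_all add: P'_def Q'_def abs_mult)
  have f: "p j * f1 + q j * f2 = p j * g1 + q j * g2 - d * P' - d * Q'"
    unfolding i(4,5) P'_def Q'_def by (simp add: algebra_simps)
  have dj: "p j * g1 + q j * g2 - sh j x \<le> d" using P j by (auto simp: proj_def)
  define w where "w = p j * g1 + q j * g2 - sh j x"
  have ex1: "\<bar>p i\<bar> * w + \<bar>p j\<bar> * d \<le> 0" if "P' < 0"
    using proj_excess[OF box2 i(1-3) j] that by (simp add: P'_def w_def algebra_simps)
  have i3: "d = q i * g2 + p i * g1 - sh i x" using i(3) by simp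
  have ex2: "\<bar>q i\<bar> * w + \<bar>q j\<bar> * d \<le> 0" if "Q' < 0"
    using S.proj_excess[OF box1 i(1,2) i3 j] that
    by (simp add: Q'_def w_def algebra_simps)
  have le1: "w + \<bar>p j\<bar> * d \<le> 0" if "P' < 0"
  proof -
    have "\<bar>p i\<bar> * (\<bar>p j\<bar> * d) \<le> 1 * (\<bar>p j\<bar> * d)" using n i by (intro mult_right_mono) auto
    then have "\<bar>p i\<bar> * (w + \<bar>p j\<bar> * d) \<le> 0" using ex1[OF that] by (simp add: algebra_simps)
    then show ?thesis using nz by (simp add: mult_le_0_iff)
  qed
  have le2: "w + \<bar>q j\<bar> * d \<le> 0" if "Q' < 0"
  proof -
    have "\<bar>q i\<bar> * (\<bar>q j\<bar> * d) \<le> 1 * (\<bar>q j\<bar> * d)" using n i by (intro mult_right_mono) auto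
    then have "\<bar>q i\<bar> * (w + \<bar>q j\<bar> * d) \<le> 0" using ex2[OF that] by (simp add: algebra_simps)
    then show ?thesis using nz by (simp add: mult_le_0_iff)
  qed
  have "w - d * P' - d * Q' \<le> 0"
  proof (cases "P' < 0")
    case P: True
    show ?thesis
    proof (cases "Q' < 0")
      case True
      have "w + d \<le> 0"
      proof (cases "\<bar>p i\<bar> \<le> \<bar>p j\<bar>")
        case True
        then have "\<bar>p i\<bar> * d \<le> \<bar>p j\<bar> * d" using i by (intro mult_right_mono) auto
        then have "\<bar>p i\<bar> * (w + d) \<le> 0" using ex1[OF P] by (simp add: algebra_simps)
        then show ?thesis using nz by (simp add: mult_le_0_iff)
      next
        case False
        then have "\<bar>q i\<bar> * d \<le> \<bar>q j\<bar> * d" using i n by (intro mult_right_mono) auto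
        then have "\<bar>q i\<bar> * (w + d) \<le> 0" using ex2[OF True] by (simp add: algebra_simps)
        then show ?thesis using nz by (simp add: mult_le_0_iff)
      qed
      moreover have Q: "Q' = - 1 - P'" using P True n abs by simp
      have "- d * P' - d * Q' = d" unfolding Q by (simp add: algebra_simps)
      ultimately show ?thesis by simp
    next
      case False
      have "P' = - \<bar>p j\<bar>" using P abs by simp
      then have "- d * P' = \<bar>p j\<bar> * d" by simp
      moreover have "0 \<le> d * Q'" using False i by simp
      ultimately show ?thesis using le1[OF P] by simp
    qed
  next
    case P: False
    show ?thesis
    proof (cases "Q' < 0")
      case True
      have "Q' = - \<bar>q j\<bar>" using True abs by simp
      then have "- d * Q' = \<bar>q j\<bar> * d" by simp
      moreover have "0 \<le> d * P'" using P i by simp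
      ultimately show ?thesis using le2[OF True] by simp
    next
      case False
      then have Q: "Q' = 1 - P'" using P n abs by simp
      have "d * P' + d * Q' = d" unfolding Q by (simp add: algebra_simps)
      then show ?thesis using dj by (simp add: w_def)
    qed
  qed
  then show ?thesis using f by (simp add: w_def)
qed

end

definition arr :: "state \<Rightarrow> nat \<Rightarrow> nat \<Rightarrow> real" where "arr s k = (\<lambda>i. s (Arr k i))"

lemma arr_upd [simp]:
  "arr (s(Var v := w)) k = arr s k"
  "arr (s(Inp v := w)) k = arr s k"
  "arr (s(Arr k' i := w)) k = (if k = k' then (arr s k)(i := w) else arr s k)"
  by (auto simp: arr_def fun_eq_iff)

lemma arr_upd_expanded [simp]: "arr (\<lambda>l. if l = Var v then w else s l) k = arr s k"
  by (simp add: arr_def)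

lemma Arr_arr: "s (Arr k i) = arr s k i"
  by (simp add: arr_def)

lemma arr_frame: "(\<And>i. s' (Arr k i) = s (Arr k i)) \<Longrightarrow> arr s' k = arr s k"
  by (simp add: arr_def)

text \<open>The row-major distance table starts behind the three cells for L, N and \<lambda>; cell
  1 holds the row length N.\<close>

abbreviation dist_exp :: "aexp \<Rightarrow> aexp \<Rightarrow> aexp" where
  "dist_exp x y \<equiv> I (Num 3 \<oplus> x \<otimes> I (Num 1) \<oplus> y)"

subsection \<open>Sorting the constraints by slope\<close>

text \<open>The variables that survive a loop are \<open>1\<close> (current point), \<open>3\<close> (number of constraints),
  \<open>6\<close> (set to \<open>1\<close> once no selection exists), \<open>10\<close> (number of sorted constraints), \<open>13\<close>
  (height of the stack), \<open>20\<close> (active line of the envelope), \<open>21\<close> and \<open>22\<close> (numerator and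
  denominator of the current bound), \<open>26\<close> and \<open>27\<close> (extended bound and its flag), \<open>29\<close>, \<open>30\<close>,
  \<open>31\<close> (largest violation and its direction). The arrays are \<open>0\<close>, \<open>1\<close>, \<open>2\<close>, \<open>3\<close> (\<open>p\<close>, \<open>q\<close>, \<open>- q\<close>,
  \<open>- p\<close>), \<open>4\<close> (\<open>\<gamma>\<close>), \<open>5\<close> (the point that owns the constraint), \<open>6\<close> (sorted indices), \<open>7\<close>
  (slopes), \<open>8\<close> and \<open>9\<close> (stack of lines), \<open>10\<close> and \<open>11\<close> (bound at a point; flag \<open>0\<close> if
  infinite), \<open>12\<close> to \<open>19\<close> (the four extended bounds, each followed by its flags), \<open>20\<close> and
  \<open>21\<close> (\<open>g\<close>), \<open>22\<close> and \<open>23\<close> (\<open>f\<close>).\<close>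

definition sort_pass :: com where
  "sort_pass = CFor 2 (V 10) (CIf Less (A 7 (V 11)) (A 7 (A 6 (V 2)))
     (SetV 12 (A 6 (V 2)) ;; SetA 6 (V 2) (V 11) ;; SetV 11 (V 12)) CSkip)"

text \<open>An insertion sort: quadratic time is affordable, because it runs once per direction and
  not once per point.\<close>

definition sort_prog :: "nat \<Rightarrow> nat \<Rightarrow> com" where
  "sort_prog a b = (SetV 10 (Num 0) ;; CFor 4 (V 3) (CIf Less (A a (V 4)) (Num 0)
     (SetA 7 (V 4) (A b (V 4) \<oslash> (Num 0 \<ominus> A a (V 4))) ;; SetV 11 (V 4) ;; sort_pass ;;
      SetA 6 (V 10) (V 11) ;; SetV 10 (V 10 \<oplus> Num 1)) CSkip))"

text \<open>The elimination of the first coordinate bounds the second one from above. The other three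
  bounds are the same computation for \<open>(p, - q)\<close>, \<open>(q, p)\<close> and \<open>(q, - p)\<close>, hence the neutral
  names \<open>al\<close>, \<open>be\<close> for the coefficients, kept in the arrays \<open>a\<close> and \<open>b\<close>.\<close>

locale direction = machine il cp + shifted_constraints N n \<rho> lam al be \<gamma> z
  for il cp N n :: nat and \<rho> :: "nat \<Rightarrow> nat \<Rightarrow> real" and lam :: real
    and al be \<gamma> :: "nat \<Rightarrow> real" and z :: "nat \<Rightarrow> nat" +
  fixes a b :: nat
  assumes ab: "a < 4" "b < 4" and cp: "n \<le> cp" "N \<le> cp" "0 < cp" and il: "3 + N * N \<le> il"
begin

definition inputs :: "state \<Rightarrow> bool" where
  "inputs s \<longleftrightarrow> s (Inp 1) = real N \<and> s (Inp 2) = lam \<and> s (Var 3) = real n \<and>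
     (\<forall>x<N. \<forall>y<N. s (Inp (3 + x * N + y)) = \<rho> x y) \<and>
     (\<forall>i<n. arr s a i = al i \<and> arr s b i = be i \<and> arr s 4 i = \<gamma> i \<and> arr s 5 i = real (z i))"

lemma inputs_frame:
  "inputs s \<Longrightarrow> (\<And>i. s' (Inp i) = s (Inp i)) \<Longrightarrow> s' (Var 3) = s (Var 3) \<Longrightarrow>
    (\<And>k i. k < 6 \<Longrightarrow> s' (Arr k i) = s (Arr k i)) \<Longrightarrow> inputs s'"
  using ab by (auto simp: inputs_def arr_def)

lemma inputs_upd [simp]:
  "v \<noteq> 3 \<Longrightarrow> inputs (s(Var v := w)) = inputs s"
  "6 \<le> k \<Longrightarrow> inputs (s(Arr k i := w)) = inputs s"
  using ab by (auto simp: inputs_def arr_def)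

lemma dist_index: "x < N \<Longrightarrow> y < N \<Longrightarrow> 3 + x * N + y < il"
proof -
  assume "x < N" "y < N"
  then have "Suc x * N \<le> N * N" by (intro mult_right_mono) auto
  then show ?thesis using il \<open>y < N\<close> by simp
qed

lemma dist_val:
  assumes "inputs s" "aval s e = real x" "aval s e' = real y" "safe s e" "safe s e'" "x < N" "y < N"
  shows "aval s (dist_exp e e') = \<rho> x y" "safe s (dist_exp e e')"
proof -
  have e: "3 + real x * real N + real y = real (3 + x * N + y)" by simp
  have "1 < il" using il assms by (cases N) auto
  then show "aval s (dist_exp e e') = \<rho> x y" "safe s (dist_exp e e')"
    using assms dist_index[of x y] unfolding inputs_def
    by (simp_all add: e del: of_nat_add of_nat_mult)
qed

text \<open>For \<open>al i < 0\<close> the relaxed constraint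
  \<open>al i * u + be i * t \<le> sh i x\<close> bounds u from below by a line in t. The slope of
  this line does not depend on x, only its intercept does; this is why one sort serves all
  points.\<close>

definition slope :: "nat \<Rightarrow> real" where "slope i = be i / (0 - al i)"

definition sorted_by :: "(nat \<Rightarrow> real) \<Rightarrow> nat \<Rightarrow> bool" where
  "sorted_by f m \<longleftrightarrow> (\<forall>k l. k < l \<longrightarrow> l < m \<longrightarrow> slope (idx (f k)) \<le> slope (idx (f l)))"

lemma sorted_by_swap:
  assumes "sorted_by f m" "k < m" "\<forall>j<k. slope (idx (f j)) \<le> slope (idx c)"
    "slope (idx c) < slope (idx (f k))"
  shows "sorted_by (f(k := c)) m"
  unfolding sorted_by_def
proof (intro allI impI)
  fix i l assume il: "i < l" "l < m"
  then have "slope (idx (f i)) \<le> slope (idx (f l))" using assms(1) unfolding sorted_by_def by blast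
  then show "slope (idx ((f(k := c)) i)) \<le> slope (idx ((f(k := c)) l))"
    using assms(3,4) il by (cases "i = k"; cases "l = k") auto
qed

lemma image_swap:
  assumes "k < (m::nat)"
  shows "insert (f k) ((f(k := c)) ` {..<m}) = insert c (f ` {..<m})"
  using assms by (auto simp: image_iff)

text \<open>The carried index and the array only exchange elements, so together they keep the set
  \<open>X\<close>, and the entries already passed are not steeper than the carried one. After the
  pass the carried index is a steepest one and can be appended.\<close>

lemma sort_pass_spec:
  assumes m: "s0 (Var 10) = real m" "m \<le> cp"
    and X: "insert (s0 (Var 11)) (arr s0 6 ` {..<m}) = X" "X \<subseteq> real ` {i. i < n \<and> arr s0 7 i = slope i}"
    and srt: "sorted_by (arr s0 6) m"
  shows "wp sort_pass (\<lambda>s t'. insert (s (Var 11)) (arr s 6 ` {..<m}) = X \<and> sorted_by (arr s 6) m \<and>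
    (\<forall>k<m. slope (idx (arr s 6 k)) \<le> slope (idx (s (Var 11)))) \<and> t' \<ge> t - (6 * real m + 2)) s0 t"
proof -
  define J where "J = (\<lambda>k s. insert (s (Var 11)) (arr s 6 ` {..<m}) = X \<and> sorted_by (arr s 6) m \<and>
    (\<forall>j<k. slope (idx (arr s 6 j)) \<le> slope (idx (s (Var 11)))))"
  have "wp sort_pass (\<lambda>s' t'. J m s' \<and> s' (Var 2) = real m \<and> t' + 0 \<ge> t + 0 - (real m * (4 + 2) + 2)) s0 t"
    unfolding sort_pass_def
  proof (rule wp_For[where \<phi> = "\<lambda>_. 0"])
    fix k s t assume k: "k < m" and J: "J k s" and v: "s (Var 2) = real k"
      and fr: "\<And>l. l \<noteq> Var 2 \<Longrightarrow> \<not> touches (CIf Less (A 7 (V 11)) (A 7 (A 6 (V 2)))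
         (SetV 12 (A 6 (V 2)) ;; SetA 6 (V 2) (V 11) ;; SetV 11 (V 12)) CSkip) l \<Longrightarrow> s l = s0 l"
    have M: "arr s 7 = arr s0 7" by (rule arr_frame, rule fr) auto
    have "s (Var 11) \<in> X" "arr s 6 k \<in> X" using J k unfolding J_def by auto
    then have "s (Var 11) \<in> real ` {i. i < n \<and> arr s0 7 i = slope i}"
      "arr s 6 k \<in> real ` {i. i < n \<and> arr s0 7 i = slope i}" using X(2) by auto
    then obtain c d where c: "s (Var 11) = real c" "c < n" "arr s 7 c = slope c"
      and d: "arr s 6 k = real d" "d < n" "arr s 7 d = slope d" unfolding M by blast
    have b: "c < cp" "d < cp" "k < cp" using c d k m cp by auto
    show "wp (CIf Less (A 7 (V 11)) (A 7 (A 6 (V 2)))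
       (SetV 12 (A 6 (V 2)) ;; SetA 6 (V 2) (V 11) ;; SetV 11 (V 12)) CSkip)
       (\<lambda>s' t'. s' (Var 2) = real k \<and> J (Suc k) s' \<and> t' + 0 \<ge> t + 0 - 4) s t"
    proof (rule wp_If)
      assume "apply_compare Less (aval s (A 7 (V 11))) (aval s (A 7 (A 6 (V 2))))"
      then have lt: "slope c < slope d" using c d v by (simp add: Arr_arr)
      have J': "J (Suc k) (s(Var 12 := real d, Arr 6 k := real c, Var 11 := real d))"
        unfolding J_def
      proof (intro conjI)
        show "insert ((s(Var 12 := real d, Arr 6 k := real c, Var 11 := real d)) (Var 11))
          (arr (s(Var 12 := real d, Arr 6 k := real c, Var 11 := real d)) 6 ` {..<m}) = X"
          using J image_swap[OF k, of "arr s 6" "real c"] c d unfolding J_def by simp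
        show "sorted_by (arr (s(Var 12 := real d, Arr 6 k := real c, Var 11 := real d)) 6) m"
          using sorted_by_swap[OF _ k, of "arr s 6" "real c"] J c d lt unfolding J_def by simp
        show "\<forall>j<Suc k. slope (idx (arr (s(Var 12 := real d, Arr 6 k := real c, Var 11 := real d)) 6 j))
          \<le> slope (idx ((s(Var 12 := real d, Arr 6 k := real c, Var 11 := real d)) (Var 11)))"
          using J c d lt unfolding J_def by (auto simp: less_Suc_eq intro: order.trans less_imp_le)
      qed
      show "wp (SetV 12 (A 6 (V 2)) ;; SetA 6 (V 2) (V 11) ;; SetV 11 (V 12))
        (\<lambda>s' t'. s' (Var 2) = real k \<and> J (Suc k) s' \<and> t' + 0 \<ge> t + 0 - 4) s (t - 1)"
        by (intro wp_Seq wp_SetV wp_SetA) (use J' c d v b in \<open>simp_all add: Arr_arr\<close>)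
    next
      assume "\<not> apply_compare Less (aval s (A 7 (V 11))) (aval s (A 7 (A 6 (V 2))))"
      then have "slope d \<le> slope c" using c d v by (simp add: Arr_arr)
      then have "J (Suc k) s" using J c d unfolding J_def by (auto simp: less_Suc_eq)
      then show "wp CSkip (\<lambda>s' t'. s' (Var 2) = real k \<and> J (Suc k) s' \<and> t' + 0 \<ge> t + 0 - 4) s (t - 1)"
        using v by simp
    qed (use c d v b in \<open>simp_all add: Arr_arr\<close>)
  qed (use m X srt in \<open>simp_all add: J_def\<close>)
  then show ?thesis by (rule wp_conseq) (simp add: J_def)
qed

lemma sort_prog_spec:
  assumes inp: "inputs s0"
  shows "wp (sort_prog a b) (\<lambda>s t'. (\<exists>m\<le>n. s (Var 10) = real m \<and>
      arr s 6 ` {..<m} = real ` {i. i < n \<and> al i < 0} \<and> sorted_by (arr s 6) m) \<and>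
    (\<forall>i<n. al i < 0 \<longrightarrow> arr s 7 i = slope i) \<and>
    t' \<ge> t - (real n * (6 * real n + 9) + 3)) s0 t"
proof -
  define J where "J = (\<lambda>k s. (\<exists>m\<le>k. s (Var 10) = real m \<and>
      arr s 6 ` {..<m} = real ` {i. i < k \<and> al i < 0} \<and> sorted_by (arr s 6) m) \<and>
    (\<forall>i<k. al i < 0 \<longrightarrow> arr s 7 i = slope i))"
  define body where "body = CIf Less (A a (V 4)) (Num 0)
     (SetA 7 (V 4) (A b (V 4) \<oslash> (Num 0 \<ominus> A a (V 4))) ;; SetV 11 (V 4) ;; sort_pass ;;
      SetA 6 (V 10) (V 11) ;; SetV 10 (V 10 \<oplus> Num 1)) CSkip"
  have t_body: "touches body l \<longleftrightarrow> l \<in> {Var 2, Var 10, Var 11, Var 12} \<or> (\<exists>j. l = Arr 6 j \<or> l = Arr 7 j)" for l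
    by (auto simp: body_def sort_pass_def)
  define s1 where "s1 = s0(Var 10 := 0)"
  have "wp (CFor 4 (V 3) body) (\<lambda>s' t'. J n s' \<and> s' (Var 4) = real n \<and>
      t' + 0 \<ge> (t - 1) + 0 - (real n * ((6 * real n + 7) + 2) + 2)) s1 (t - 1)"
  proof (rule wp_For[where \<phi> = "\<lambda>_. 0"])
    show "J 0 s1" by (auto simp: J_def s1_def sorted_by_def)
  next
    fix k s
    assume "\<And>l. l \<noteq> Var 4 \<Longrightarrow> \<not> touches body l \<Longrightarrow> s l = s1 l"
    from this[of "Var 3"] show "safe s (V 3) \<and> aval s (V 3) = real n"
      using inp by (simp add: t_body s1_def inputs_def)
  next
    fix k s t assume k: "k < n" and J: "J k s" and v: "s (Var 4) = real k"
      and fr: "\<And>l. l \<noteq> Var 4 \<Longrightarrow> \<not> touches body l \<Longrightarrow> s l = s1 l"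
    have is1: "inputs s1" using inp by (simp add: s1_def)
    have i: "inputs s" by (rule inputs_frame[OF is1]) (auto intro!: fr simp: t_body)
    from J obtain m where m: "m \<le> k" "s (Var 10) = real m"
      "arr s 6 ` {..<m} = real ` {i. i < k \<and> al i < 0}" "sorted_by (arr s 6) m"
      and M: "\<forall>i<k. al i < 0 \<longrightarrow> arr s 7 i = slope i" unfolding J_def by auto
    have vals: "arr s a k = al k" "arr s b k = be k" using i k by (auto simp: inputs_def)
    have lt: "k < cp" "m < cp" "a < 32" "b < 32" using k m cp ab by auto
    show "wp body (\<lambda>s' t'. s' (Var 4) = real k \<and> J (Suc k) s' \<and> t' + 0 \<ge> t + 0 - (6 * real n + 7)) s t"
      unfolding body_def
    proof (rule wp_If)
      assume "apply_compare Less (aval s (A a (V 4))) (aval s (Num 0))"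
      then have neg: "al k < 0" using v vals by (simp add: Arr_arr)
      define s2 where "s2 = s(Arr 7 k := slope k, Var 11 := real k)"
      define X where "X = insert (real k) (real ` {i. i < k \<and> al i < 0})"
      have "wp sort_pass (\<lambda>s t'. insert (s (Var 11)) (arr s 6 ` {..<m}) = X \<and> sorted_by (arr s 6) m \<and>
        (\<forall>k<m. slope (idx (arr s 6 k)) \<le> slope (idx (s (Var 11)))) \<and> t' \<ge> (t - 3) - (6 * real m + 2)) s2 (t - 3)"
      proof (rule sort_pass_spec)
        show "X \<subseteq> real ` {i. i < n \<and> arr s2 7 i = slope i}"
          using M k by (auto simp: X_def s2_def)
      qed (use m lt in \<open>simp_all add: s2_def X_def\<close>)
      then have "wp sort_pass (wp (SetA 6 (V 10) (V 11) ;; SetV 10 (V 10 \<oplus> Num 1))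
        (\<lambda>s' t'. s' (Var 4) = real k \<and> J (Suc k) s' \<and> t' + 0 \<ge> t + 0 - (6 * real n + 7))) s2 (t - 3)"
      proof (rule wp_conseq_frame)
        fix s3 t3
        assume *: "insert (s3 (Var 11)) (arr s3 6 ` {..<m}) = X \<and> sorted_by (arr s3 6) m \<and>
          (\<forall>k<m. slope (idx (arr s3 6 k)) \<le> slope (idx (s3 (Var 11)))) \<and> t3 \<ge> (t - 3) - (6 * real m + 2)"
          and fr3: "\<And>l. \<not> touches sort_pass l \<Longrightarrow> s3 l = s2 l"
        have 10: "s3 (Var 10) = real m" "s3 (Var 4) = real k" and 7: "arr s3 7 = arr s2 7"
          using fr3 m v by (auto simp: sort_pass_def s2_def arr_def)
        define s4 where "s4 = s3(Arr 6 m := s3 (Var 11), Var 10 := real m + 1)"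
        have "J (Suc k) s4" unfolding J_def
        proof (intro conjI exI[of _ "Suc m"])
          have "arr s4 6 ` {..<Suc m} = insert (s3 (Var 11)) (arr s3 6 ` {..<m})"
            by (auto simp: s4_def lessThan_Suc)
          also have "\<dots> = real ` {i. i < Suc k \<and> al i < 0}"
            using * neg by (auto simp: X_def less_Suc_eq)
          finally show "arr s4 6 ` {..<Suc m} = real ` {i. i < Suc k \<and> al i < 0}" .
          show "sorted_by (arr s4 6) (Suc m)" using * by (auto simp: s4_def sorted_by_def less_Suc_eq)
          show "\<forall>i<Suc k. al i < 0 \<longrightarrow> arr s4 7 i = slope i"
            using M 7 by (auto simp: s4_def s2_def less_Suc_eq)
        qed (use m in \<open>auto simp: s4_def\<close>)
        moreover have "real m \<le> real n" using m k by simp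
        ultimately show "wp (SetA 6 (V 10) (V 11) ;; SetV 10 (V 10 \<oplus> Num 1))
          (\<lambda>s' t'. s' (Var 4) = real k \<and> J (Suc k) s' \<and> t' + 0 \<ge> t + 0 - (6 * real n + 7)) s3 t3"
          by (intro wp_Seq wp_SetV wp_SetA) (use 10 lt * in \<open>simp_all add: s4_def\<close>)
      qed
      then show "wp (SetA 7 (V 4) (A b (V 4) \<oslash> (Num 0 \<ominus> A a (V 4))) ;; SetV 11 (V 4) ;; sort_pass ;;
          SetA 6 (V 10) (V 11) ;; SetV 10 (V 10 \<oplus> Num 1))
         (\<lambda>s' t'. s' (Var 4) = real k \<and> J (Suc k) s' \<and> t' + 0 \<ge> t + 0 - (6 * real n + 7)) s (t - 1)"
        by (intro wp_Seq wp_SetV wp_SetA)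
          (use v lt vals neg in \<open>simp_all add: Arr_arr s2_def slope_def\<close>)
    next
      assume "\<not> apply_compare Less (aval s (A a (V 4))) (aval s (Num 0))"
      then have "\<not> al k < 0" using v vals by (simp add: Arr_arr)
      then have "{i. i < Suc k \<and> al i < 0} = {i. i < k \<and> al i < 0}" by (auto simp: less_Suc_eq)
      then have "J (Suc k) s" using m M \<open>\<not> al k < 0\<close> unfolding J_def
        by (auto simp: less_Suc_eq intro!: exI[of _ m])
      then show "wp CSkip (\<lambda>s' t'. s' (Var 4) = real k \<and> J (Suc k) s' \<and> t' + 0 \<ge> t + 0 - (6 * real n + 7)) s (t - 1)"
        using v by simp
    qed (use v lt in \<open>simp_all add: Arr_arr\<close>)
  qed (simp_all add: J_def)
  then have "wp (CFor 4 (V 3) body) (\<lambda>s t'. (\<exists>m\<le>n. s (Var 10) = real m \<and>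
      arr s 6 ` {..<m} = real ` {i. i < n \<and> al i < 0} \<and> sorted_by (arr s 6) m) \<and>
    (\<forall>i<n. al i < 0 \<longrightarrow> arr s 7 i = slope i) \<and>
    t' \<ge> t - (real n * (6 * real n + 9) + 3)) s1 (t - 1)"
    by (rule wp_conseq) (simp add: J_def algebra_simps)
  then show ?thesis unfolding sort_prog_def body_def[symmetric]
    by (intro wp_Seq wp_SetV) (simp_all add: s1_def)
qed

end

subsection \<open>Upper envelopes of lines\<close>

text \<open>The lines are \<open>t \<mapsto> m t - c\<close>; the point \<open>t\<close> is given in homogeneous coordinates as
  \<open>tn / td\<close> with \<open>td \<ge> 0\<close>, so that \<open>(1, 0)\<close> is the point at infinity.\<close>

definition cvx_chain :: "nat \<Rightarrow> (nat \<Rightarrow> real) \<Rightarrow> (nat \<Rightarrow> real) \<Rightarrow> bool" where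
  "cvx_chain l M C \<longleftrightarrow> (\<forall>k. Suc k < l \<longrightarrow> M k < M (Suc k)) \<and>
    (\<forall>k. Suc (Suc k) < l \<longrightarrow>
      (M (Suc (Suc k)) - M k) * C (Suc k) <
      (M (Suc k) - M k) * C (Suc (Suc k)) + (M (Suc (Suc k)) - M (Suc k)) * C k)"

definition below :: "(real \<times> real) set \<Rightarrow> real \<Rightarrow> real \<Rightarrow> real \<Rightarrow> bool" where
  "below B tn td W \<longleftrightarrow> (\<forall>(m, c)\<in>B. m * tn - c * td \<le> W)"

definition lines :: "nat \<Rightarrow> (nat \<Rightarrow> real) \<Rightarrow> (nat \<Rightarrow> real) \<Rightarrow> (real \<times> real) set" where
  "lines l M C = (\<lambda>k. (M k, C k)) ` {..<l}"

text \<open>Quantifying over all \<open>W\<close> makes the maxima of the two sets of lines agree at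
  every point, including infinity. An empty \<open>S\<close> forces \<open>B\<close> to be empty,
  which \<open>query_for\<close> exploits.\<close>

definition envelope :: "(real \<times> real) set \<Rightarrow> (real \<times> real) set \<Rightarrow> bool" where
  "envelope S B \<longleftrightarrow> S \<subseteq> B \<and> (\<forall>tn td W. 0 \<le> td \<longrightarrow> below S tn td W \<longrightarrow> below B tn td W)"

lemma lines_Suc: "lines (Suc l) M C = insert (M l, C l) (lines l M C)"
  by (auto simp: lines_def lessThan_Suc)

lemma lines_upd: "lines l (M(l := m)) (C(l := c)) = lines l M C"
  by (auto simp: lines_def)

lemma below_insert [simp]: "below (insert (m, c) B) tn td W \<longleftrightarrow> m * tn - c * td \<le> W \<and> below B tn td W"
  by (auto simp: below_def)

lemma cvx_chain_mono: "cvx_chain l M C \<Longrightarrow> l' \<le> l \<Longrightarrow> cvx_chain l' M C"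
  by (auto simp: cvx_chain_def)

lemma cvx_chain_push:
  assumes "cvx_chain l M C" "0 < l \<Longrightarrow> M (l - 1) < m"
    and "1 < l \<Longrightarrow> (m - M (l - 2)) * C (l - 1) < (M (l - 1) - M (l - 2)) * c + (m - M (l - 1)) * C (l - 2)"
  shows "cvx_chain (Suc l) (M(l := m)) (C(l := c))"
  unfolding cvx_chain_def
proof (intro conjI allI impI)
  fix k assume "Suc k < Suc l"
  then show "(M(l := m)) k < (M(l := m)) (Suc k)"
    using assms(1,2) by (cases "Suc k = l") (auto simp: cvx_chain_def)
next
  fix k assume k: "Suc (Suc k) < Suc l"
  show "((M(l := m)) (Suc (Suc k)) - (M(l := m)) k) * (C(l := c)) (Suc k)
    < ((M(l := m)) (Suc k) - (M(l := m)) k) * (C(l := c)) (Suc (Suc k)) +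
      ((M(l := m)) (Suc (Suc k)) - (M(l := m)) (Suc k)) * (C(l := c)) k"
  proof (cases "Suc (Suc k) = l")
    case True
    then have "l - 1 = Suc k" "l - 2 = k" "1 < l" "Suc k \<noteq> l" "k \<noteq> l" by auto
    then show ?thesis using assms(3) True by simp
  next
    case False
    then show ?thesis using assms(1) k by (simp add: cvx_chain_def)
  qed
qed

text \<open>The middle slope is a convex combination of the outer ones. The hypothesis on the
  intercepts says that the middle line lies below the same combination of the outer lines, hence
  below their maximum.\<close>

lemma between_dominated:
  fixes m :: real
  assumes "m0 < m1" "m1 < m" "(m1 - m0) * c + (m - m1) * c0 \<le> (m - m0) * c1" "0 \<le> td"
    and "m0 * tn - c0 * td \<le> W" "m * tn - c * td \<le> W"
  shows "m1 * tn - c1 * td \<le> W"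
proof -
  have "(m - m0) * (m1 * tn - c1 * td) \<le> (m - m1) * (m0 * tn - c0 * td) + (m1 - m0) * (m * tn - c * td)"
    using mult_right_mono[OF assms(3,4)] by (simp add: algebra_simps)
  also have "\<dots> \<le> (m - m1) * W + (m1 - m0) * W"
    using assms by (intro add_mono mult_left_mono) auto
  also have "\<dots> = (m - m0) * W" by (simp add: algebra_simps)
  finally show ?thesis using assms by simp
qed

text \<open>Of two lines with the same slope only the higher one is kept: the new line takes over the
  smaller intercept before the old one is popped.\<close>

definition pop_body :: com where
  "pop_body = CIf Less (Num 0) (V 13)
     (SetV 18 (A 8 (V 13 \<ominus> Num 1)) ;; SetV 19 (A 9 (V 13 \<ominus> Num 1)) ;;
      CIf Less (V 18) (V 15)
        (CIf Less (Num 1) (V 13)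
          (CIf Leq ((V 18 \<ominus> A 8 (V 13 \<ominus> Num 2)) \<otimes> V 16 \<oplus> (V 15 \<ominus> V 18) \<otimes> A 9 (V 13 \<ominus> Num 2))
              ((V 15 \<ominus> A 8 (V 13 \<ominus> Num 2)) \<otimes> V 19)
            (SetV 13 (V 13 \<ominus> Num 1)) (SetV 17 (Num 0)))
          (SetV 17 (Num 0)))
        (CIf Less (V 19) (V 16) (SetV 16 (V 19)) CSkip ;; SetV 13 (V 13 \<ominus> Num 1)))
     (SetV 17 (Num 0))"

text \<open>The guard of a loop is a single comparison; the decision to go on popping is kept in the
  flag \<open>V 17\<close>.\<close>

definition stack_body :: "nat \<Rightarrow> com" where
  "stack_body a = SetV 4 (A 6 (V 2)) ;; SetV 14 (dist_exp (V 1) (A 5 (V 4))) ;;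
     CIf Leq (Num 0) (V 14)
       (SetV 15 (A 7 (V 4)) ;;
        SetV 16 ((A 4 (V 4) \<oplus> I (Num 2) \<otimes> V 14) \<oslash> (Num 0 \<ominus> A a (V 4))) ;;
        SetV 17 (Num 1) ;; CWhile Less (Num 0) (V 17) pop_body ;;
        SetA 8 (V 13) (V 15) ;; SetA 9 (V 13) (V 16) ;; SetV 13 (V 13 \<oplus> Num 1))
       CSkip"

section \<open>Building the envelope with a stack\<close>

context machine
begin

text \<open>Throughout, the new line together with the remaining stack is an envelope of
  \<open>B\<close>: a line is popped only if its two neighbours dominate it or if the new line,
  having the same slope, takes over its role. The conditions under which the loop stops are those of
  \<open>cvx_chain_push\<close>. Every pop is charged 9 credits to the lost height; the 9 extra
  credits pay for the round that clears the flag and for the last test.\<close>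

lemma pop_loop:
  assumes cp: "0 < cp" "l0 \<le> cp"
    and s0: "s0 (Var 13) = real l0" "s0 (Var 15) = m" "s0 (Var 16) = c0" "s0 (Var 17) = 1"
    and KM: "M = arr s0 8" "C = arr s0 9"
    and cvx: "cvx_chain l0 M C" and le: "\<forall>k<l0. M k \<le> m"
    and env: "envelope (insert (m, c0) (lines l0 M C)) B"
  shows "wp (CWhile Less (Num 0) (V 17) pop_body) (\<lambda>s t'. \<exists>l\<le>l0. \<exists>c. s (Var 13) = real l \<and> s (Var 16) = c \<and>
      envelope (insert (m, c) (lines l M C)) B \<and>
      (0 < l \<longrightarrow> M (l - 1) < m) \<and>
      (1 < l \<longrightarrow> (m - M (l - 2)) * C (l - 1) < (M (l - 1) - M (l - 2)) * c + (m - M (l - 1)) * C (l - 2)) \<and>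
      t' \<ge> t - (9 * (real l0 - real l) + 9)) s0 t"
proof -
  define K where "K = (\<lambda>s t'. \<exists>l\<le>l0. \<exists>c. s (Var 13) = real l \<and> s (Var 15) = m \<and> s (Var 16) = c \<and>
      arr s 8 = M \<and> arr s 9 = C \<and>
      envelope (insert (m, c) (lines l M C)) B \<and> (s (Var 17) = 1 \<or> s (Var 17) = 0 \<and>
      (0 < l \<longrightarrow> M (l - 1) < m) \<and>
      (1 < l \<longrightarrow> (m - M (l - 2)) * C (l - 1) < (M (l - 1) - M (l - 2)) * c + (m - M (l - 1)) * C (l - 2))) \<and>
      t' \<ge> t - 9 * (real l0 - real l) - (if s (Var 17) = 1 then 0 else 8))"
  show ?thesis
  proof (rule wp_While[where J = K and e = "t - 9 * real l0 - 8"])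
    show "K s0 t" unfolding K_def using s0 KM env by (intro exI[of _ l0] exI[of _ c0]) auto
    fix s t' assume "K s t'"
    then obtain l c where l: "l \<le> l0" "s (Var 13) = real l" "s (Var 15) = m" "s (Var 16) = c"
      "arr s 8 = M" "arr s 9 = C" and e: "envelope (insert (m, c) (lines l M C)) B"
      and go: "s (Var 17) = 1 \<or> s (Var 17) = 0 \<and>
      (0 < l \<longrightarrow> M (l - 1) < m) \<and>
      (1 < l \<longrightarrow> (m - M (l - 2)) * C (l - 1) < (M (l - 1) - M (l - 2)) * c + (m - M (l - 1)) * C (l - 2))"
      and t': "t' \<ge> t - 9 * (real l0 - real l) - (if s (Var 17) = 1 then 0 else 8)"
      unfolding K_def by blast
    show "t - 9 * real l0 - 8 \<le> t'" using t' by (auto split: if_splits)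
    show "safe s (Num 0) \<and> safe s (V 17)" by simp
    show "\<exists>l\<le>l0. \<exists>c. s (Var 13) = real l \<and> s (Var 16) = c \<and>
      envelope (insert (m, c) (lines l M C)) B \<and>
      (0 < l \<longrightarrow> M (l - 1) < m) \<and>
      (1 < l \<longrightarrow> (m - M (l - 2)) * C (l - 1) < (M (l - 1) - M (l - 2)) * c + (m - M (l - 1)) * C (l - 2)) \<and>
      t' - 1 \<ge> t - (9 * (real l0 - real l) + 9)"
      if "\<not> apply_compare Less (aval s (Num 0)) (aval s (V 17))"
      using that l go e t' by (intro exI[of _ l] exI[of _ c]) auto
    assume "apply_compare Less (aval s (Num 0)) (aval s (V 17))"
    then have g1: "s (Var 17) = 1" using go by auto
    have t1: "t' \<ge> t - 9 * (real l0 - real l)" using t' g1 by simp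
    show "wp pop_body K s (t' - 1)"
    proof (cases "l = 0")
      case True
      have "K (s(Var 17 := 0)) (t' - 3)" unfolding K_def
        by (rule exI[of _ l]) (use True l e t1 in auto)
      then show ?thesis unfolding pop_body_def
        by (intro wp_If wp_SetV) (use True l in simp_all)
    next
      case False
      then obtain l' where l': "l = Suc l'" by (cases l) auto
      have i1: "real l - 1 = real l'" and ib: "l' < cp" using l' l cp by auto
      define s2 where "s2 = s(Var 18 := M l', Var 19 := C l')"
      have stop: "K (s2(Var 17 := 0)) (t' - u)"
        if "M l' < m" "u \<le> 8" "1 < l \<longrightarrow> (m - M (l - 2)) * C (l - 1) < (M (l - 1) - M (l - 2)) * c + (m - M (l - 1)) * C (l - 2)" for u
        unfolding K_def s2_def by (rule exI[of _ l]) (use l l' e t1 that in auto)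
      have pop: "K (s2(Var 16 := c', Var 13 := real l')) (t' - u)"
        if "envelope (insert (m, c') (lines l' M C)) B" "u \<le> 8" for c' u
        unfolding K_def s2_def by (rule exI[of _ l']) (use l l' t1 that g1 in auto)
      define D where "D = CIf Less (V 18) (V 15)
        (CIf Less (Num 1) (V 13)
          (CIf Leq ((V 18 \<ominus> A 8 (V 13 \<ominus> Num 2)) \<otimes> V 16 \<oplus> (V 15 \<ominus> V 18) \<otimes> A 9 (V 13 \<ominus> Num 2))
              ((V 15 \<ominus> A 8 (V 13 \<ominus> Num 2)) \<otimes> V 19)
            (SetV 13 (V 13 \<ominus> Num 1)) (SetV 17 (Num 0)))
          (SetV 17 (Num 0)))
        (CIf Less (V 19) (V 16) (SetV 16 (V 19)) CSkip ;; SetV 13 (V 13 \<ominus> Num 1))"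
      have "wp D K s2 (t' - 4)"
      proof (cases "M l' < m")
        case lt: True
        show ?thesis
        proof (cases "1 < l")
          case True
          then obtain l'' where l'': "l' = Suc l''" using l' by (cases l') auto
          have i2: "real l - 2 = real l''" and ib2: "l'' < cp" using l' l'' l cp by auto
          have l2: "l - 1 = l'" "l - 2 = l''" using l' l'' by auto
          have M2: "M l'' < M l'" using cvx l l' l'' by (auto simp: cvx_chain_def)
          show ?thesis
          proof (cases "(M l' - M l'') * c + (m - M l') * C l'' \<le> (m - M l'') * C l'")
            case c: True
            have "envelope (insert (m, c) (lines l' M C)) B"
              unfolding envelope_def
            proof (intro conjI allI impI)
              show "insert (m, c) (lines l' M C) \<subseteq> B" using e l' by (auto simp: envelope_def lines_Suc)
              fix tn td W assume td: "(0::real) \<le> td" and b: "below (insert (m, c) (lines l' M C)) tn td W"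
              then have "M l' * tn - C l' * td \<le> W"
                using between_dominated[OF M2 lt c td] l'' by (simp add: lines_Suc)
              then show "below B tn td W" using e b td l' by (simp add: envelope_def lines_Suc)
            qed
            from pop[OF this, of 8]
            have "K (s2(Var 13 := real l')) (t' - 8)" using l by (simp add: s2_def fun_upd_twist fun_upd_idem)
            then show ?thesis unfolding D_def
              by (intro wp_If wp_SetV) (use c lt True l i1 i2 ib ib2 in \<open>simp_all add: s2_def Arr_arr\<close>)
          next
            case c: False
            then have "K (s2(Var 17 := 0)) (t' - 8)" using lt l2 by (intro stop) auto
            then show ?thesis unfolding D_def
              by (intro wp_If wp_SetV) (use c lt True l i1 i2 ib ib2 in \<open>simp_all add: s2_def Arr_arr\<close>)
          qed
        next
          case False
          then have "K (s2(Var 17 := 0)) (t' - 7)" using lt by (intro stop) auto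
          then show ?thesis unfolding D_def
            by (intro wp_If wp_SetV) (use False lt l in \<open>simp_all add: s2_def\<close>)
        qed
      next
        case ge: False
        then have eq: "M l' = m" using le l l' by (metis lessI less_le_trans order_antisym not_less)
        define c' where "c' = (if C l' < c then C l' else c)"
        have "envelope (insert (m, c') (lines l' M C)) B"
          unfolding envelope_def
        proof (intro conjI allI impI)
          show "insert (m, c') (lines l' M C) \<subseteq> B" using e l' eq by (auto simp: envelope_def lines_Suc c'_def)
          fix tn td W assume td: "(0::real) \<le> td" and b: "below (insert (m, c') (lines l' M C)) tn td W"
          have "c' * td \<le> C l' * td" "c' * td \<le> c * td" using td by (auto simp: c'_def intro!: mult_right_mono)
          then have "M l' * tn - C l' * td \<le> W" "m * tn - c * td \<le> W" using b eq by auto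
          then show "below B tn td W" using e b td l' by (simp add: envelope_def lines_Suc)
        qed
        from pop[OF this, of 8] pop[OF this, of 7] 
        have "K (s2(Var 16 := c', Var 13 := real l')) (t' - 8)" "K (s2(Var 16 := c', Var 13 := real l')) (t' - 7)" by auto
        moreover have "s2(Var 13 := real l') = s2(Var 16 := c, Var 13 := real l')"
          using l by (auto simp: s2_def fun_eq_iff)
        ultimately show ?thesis unfolding D_def
          by (intro wp_If wp_SetV wp_Seq wp_Skip) (use ge l i1 ib in \<open>simp_all add: s2_def c'_def split: if_splits\<close>)
      qed
      then show ?thesis unfolding pop_body_def D_def[symmetric]
        by (intro wp_If wp_SetV wp_Seq) (use False l i1 ib in \<open>simp_all add: s2_def Arr_arr\<close>)
    qed
  qed
qed

end

definition stack_prog :: "nat \<Rightarrow> com" where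
  "stack_prog a = (SetV 13 (Num 0) ;; CFor 2 (V 10) (stack_body a))"

lemma envelope_insert: "envelope S B \<Longrightarrow> envelope (insert p S) (insert p B)"
  by (cases p) (auto simp: envelope_def)

context direction
begin

definition line :: "nat \<Rightarrow> nat \<Rightarrow> real \<times> real" where
  "line x i = (slope i, sh i x / (0 - al i))"

definition sorted_state :: "nat \<Rightarrow> state \<Rightarrow> bool" where
  "sorted_state m s \<longleftrightarrow> m \<le> n \<and> s (Var 10) = real m \<and>
      arr s 6 ` {..<m} = real ` {i. i < n \<and> al i < 0} \<and> sorted_by (arr s 6) m \<and>
    (\<forall>i<n. al i < 0 \<longrightarrow> arr s 7 i = slope i)"

lemma sorted_state_frame:
  "sorted_state m s \<Longrightarrow> s' (Var 10) = s (Var 10) \<Longrightarrow> (\<And>i. s' (Arr 6 i) = s (Arr 6 i)) \<Longrightarrow>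
    (\<And>i. s' (Arr 7 i) = s (Arr 7 i)) \<Longrightarrow> sorted_state m s'"
  by (simp add: sorted_state_def arr_def)

lemma stack_body_touches: "touches (stack_body a) l \<longleftrightarrow>
    l \<in> {Var 4, Var 13, Var 14, Var 15, Var 16, Var 17, Var 18, Var 19} \<or> (\<exists>j. l = Arr 8 j \<or> l = Arr 9 j)"
  by (auto simp: stack_body_def pop_body_def)

text \<open>The potential is -9 times the height of the stack. A round may pop many lines, but every
  pop was paid for when the line was pushed, so the total cost is linear in n.\<close>

lemma stack_prog_spec:
  assumes inp: "inputs s0" and srt: "sorted_state m s0" and x: "s0 (Var 1) = real x" "x < N"
  shows "wp (stack_prog a) (\<lambda>s t'. (\<exists>l\<le>n. s (Var 13) = real l \<and> cvx_chain l (arr s 8) (arr s 9) \<and>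
      envelope (lines l (arr s 8) (arr s 9)) (line x ` {i \<in> act x. al i < 0})) \<and>
      t' \<ge> t - (29 * real n + 3)) s0 t"
proof -
  define f where "f = arr s0 6"
  define B where "B = (\<lambda>k. line x ` {i \<in> act x. real i \<in> f ` {..<k}})"
  define J where "J = (\<lambda>k s. \<exists>l\<le>k. s (Var 13) = real l \<and> cvx_chain l (arr s 8) (arr s 9) \<and>
      envelope (lines l (arr s 8) (arr s 9)) (B k))"
  define s1 where "s1 = s0(Var 13 := 0)"
  have m: "m \<le> n" "s0 (Var 10) = real m" "f ` {..<m} = real ` {i. i < n \<and> al i < 0}"
    "sorted_by f m" "\<forall>i<n. al i < 0 \<longrightarrow> arr s0 7 i = slope i"
    using srt by (auto simp: sorted_state_def f_def)
  have "wp (CFor 2 (V 10) (stack_body a)) (\<lambda>s' t'. J m s' \<and> s' (Var 2) = real m \<and>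
      t' + (- (9 * s' (Var 13))) \<ge> (t - 1) + (- (9 * s1 (Var 13))) - (real m * (27 + 2) + 2)) s1 (t - 1)"
  proof (rule wp_For)
    show "J 0 s1" by (simp add: J_def s1_def B_def cvx_chain_def envelope_def lines_def)
  next
    fix k s
    assume "\<And>l. l \<noteq> Var 2 \<Longrightarrow> \<not> touches (stack_body a) l \<Longrightarrow> s l = s1 l"
    from this[of "Var 10"] show "safe s (V 10) \<and> aval s (V 10) = real m"
      using m by (simp add: stack_body_touches s1_def)
  next
    fix k s t assume k: "k < m" and J: "J k s" and v: "s (Var 2) = real k"
      and fr: "\<And>l. l \<noteq> Var 2 \<Longrightarrow> \<not> touches (stack_body a) l \<Longrightarrow> s l = s1 l"
    have is1: "inputs s1" using inp by (simp add: s1_def)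
    have i: "inputs s" by (rule inputs_frame[OF is1]) (auto intro!: fr simp: stack_body_touches)
    have x': "s (Var 1) = real x" and f: "arr s 6 = f" and a7: "arr s 7 = arr s0 7"
      using fr x by (auto simp: stack_body_touches s1_def f_def arr_def)
    obtain l where l: "l \<le> k" "s (Var 13) = real l" "cvx_chain l (arr s 8) (arr s 9)"
      "envelope (lines l (arr s 8) (arr s 9)) (B k)" using J unfolding J_def by blast
    have "f k \<in> real ` {i. i < n \<and> al i < 0}" using m k by auto
    then obtain i where ik: "f k = real i" "i < n" "al i < 0" by blast
    have vals: "arr s a i = al i" "arr s 4 i = \<gamma> i" "arr s 5 i = real (z i)" "s (Inp 2) = lam"
      using \<open>inputs s\<close> ik by (auto simp: inputs_def)
    have lt: "k < cp" "i < cp" "l < cp" "a < 32" "2 < il" using ik k m l cp ab il by auto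
    have zi: "z i < N" using z ik by simp
    define r where "r = \<rho> x (z i)"
    define s2 where "s2 = s(Var 4 := real i, Var 14 := r)"
    have d: "aval (s(Var 4 := real i)) (dist_exp (V 1) (A 5 (V 4))) = r"
      "safe (s(Var 4 := real i)) (dist_exp (V 1) (A 5 (V 4)))"
      unfolding r_def by (rule dist_val; use i x' vals x zi lt in \<open>simp add: Arr_arr\<close>)+
    have B: "B (Suc k) = (if 0 \<le> r then insert (line x i) (B k) else B k)"
      using ik unfolding B_def by (auto simp: lessThan_Suc act_def r_def)
    show "wp (stack_body a) (\<lambda>s' t'. s' (Var 2) = real k \<and> J (Suc k) s' \<and>
       t' + (- (9 * s' (Var 13))) \<ge> t + (- (9 * s (Var 13))) - 27) s t"
      (is "wp _ ?Q _ _")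
    proof -
      define c where "c = (\<gamma> i + lam * r) / (0 - al i)"
      define D where "D = (SetV 15 (A 7 (V 4)) ;;
        SetV 16 ((A 4 (V 4) \<oplus> I (Num 2) \<otimes> V 14) \<oslash> (Num 0 \<ominus> A a (V 4))) ;;
        SetV 17 (Num 1) ;; CWhile Less (Num 0) (V 17) pop_body ;;
        SetA 8 (V 13) (V 15) ;; SetA 9 (V 13) (V 16) ;; SetV 13 (V 13 \<oplus> Num 1))"
      have "wp (CIf Leq (Num 0) (V 14) D CSkip) ?Q s2 (t - 2)"
      proof (rule wp_If)
        assume "apply_compare Leq (aval s2 (Num 0)) (aval s2 (V 14))"
        then have r: "0 \<le> r" by (simp add: s2_def)
        define s3 where "s3 = s2(Var 15 := slope i, Var 16 := c, Var 17 := 1)"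
        have "wp (CWhile Less (Num 0) (V 17) pop_body) (\<lambda>s t'. \<exists>l'\<le>l. \<exists>c. s (Var 13) = real l' \<and> s (Var 16) = c \<and>
          envelope (insert (slope i, c) (lines l' (arr s3 8) (arr s3 9))) (B (Suc k)) \<and>
          (0 < l' \<longrightarrow> arr s3 8 (l' - 1) < slope i) \<and>
          (1 < l' \<longrightarrow> (slope i - arr s3 8 (l' - 2)) * arr s3 9 (l' - 1)
             < (arr s3 8 (l' - 1) - arr s3 8 (l' - 2)) * c + (slope i - arr s3 8 (l' - 1)) * arr s3 9 (l' - 2)) \<and>
          t' \<ge> (t - 6) - (9 * (real l - real l') + 9)) s3 (t - 6)"
        proof (rule pop_loop[where ?c0.0 = c])
          show "\<forall>j<l. arr s3 8 j \<le> slope i"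
          proof (intro allI impI)
            fix j assume "j < l"
            then have "(arr s 8 j, arr s 9 j) \<in> B k" using l(4) by (auto simp: envelope_def lines_def)
            then obtain i' k' where i': "arr s 8 j = slope i'" "real i' = f k'" "k' < k"
              unfolding B_def line_def by auto
            have "slope (idx (f k')) \<le> slope (idx (f k))" using m(4) i' k by (auto simp: sorted_by_def)
            then have "slope i' \<le> slope i" using ik i' by (metis idx_of_nat)
            then show "arr s3 8 j \<le> slope i" using i' by (simp add: s3_def s2_def)
          qed
          have "(slope i, c) = line x i" by (simp add: line_def c_def sh_def r_def)
          then show "envelope (insert (slope i, c) (lines l (arr s3 8) (arr s3 9))) (B (Suc k))"
            using envelope_insert[OF l(4)] B r by (simp add: s3_def s2_def)
        qed (use l lt cp in \<open>simp_all add: s3_def s2_def\<close>)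
        then have w: "wp (CWhile Less (Num 0) (V 17) pop_body)
          (wp (SetA 8 (V 13) (V 15) ;; SetA 9 (V 13) (V 16) ;; SetV 13 (V 13 \<oplus> Num 1)) ?Q) s3 (t - 6)"
        proof (rule wp_conseq_frame)
          fix s4 t4
          assume "\<exists>l'\<le>l. \<exists>c. s4 (Var 13) = real l' \<and> s4 (Var 16) = c \<and>
          envelope (insert (slope i, c) (lines l' (arr s3 8) (arr s3 9))) (B (Suc k)) \<and>
          (0 < l' \<longrightarrow> arr s3 8 (l' - 1) < slope i) \<and>
          (1 < l' \<longrightarrow> (slope i - arr s3 8 (l' - 2)) * arr s3 9 (l' - 1)
             < (arr s3 8 (l' - 1) - arr s3 8 (l' - 2)) * c + (slope i - arr s3 8 (l' - 1)) * arr s3 9 (l' - 2)) \<and>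
          t4 \<ge> (t - 6) - (9 * (real l - real l') + 9)"
            and fr4: "\<And>l. \<not> touches (CWhile Less (Num 0) (V 17) pop_body) l \<Longrightarrow> s4 l = s3 l"
          then obtain l' c' where l': "l' \<le> l" "s4 (Var 13) = real l'" "s4 (Var 16) = c'"
            and e: "envelope (insert (slope i, c') (lines l' (arr s3 8) (arr s3 9))) (B (Suc k))"
            and h: "0 < l' \<longrightarrow> arr s3 8 (l' - 1) < slope i"
              "1 < l' \<longrightarrow> (slope i - arr s3 8 (l' - 2)) * arr s3 9 (l' - 1)
             < (arr s3 8 (l' - 1) - arr s3 8 (l' - 2)) * c' + (slope i - arr s3 8 (l' - 1)) * arr s3 9 (l' - 2)"
            and t4: "t4 \<ge> (t - 6) - (9 * (real l - real l') + 9)" by blast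
          have 4: "arr s4 8 = arr s3 8" "arr s4 9 = arr s3 9" "s4 (Var 15) = slope i" "s4 (Var 2) = real k"
            using fr4 v by (auto simp: pop_body_def arr_def s3_def s2_def)
          have 3: "arr s3 8 = arr s 8" "arr s3 9 = arr s 9" by (simp_all add: s3_def s2_def)
          define s5 where "s5 = s4(Arr 8 l' := slope i, Arr 9 l' := c', Var 13 := real l' + 1)"
          have "J (Suc k) s5" unfolding J_def
          proof (intro exI[of _ "Suc l'"] conjI)
            have "arr s5 8 = (arr s3 8)(l' := slope i)" "arr s5 9 = (arr s3 9)(l' := c')"
              using 4 by (simp_all add: s5_def)
            moreover have "cvx_chain (Suc l') ((arr s3 8)(l' := slope i)) ((arr s3 9)(l' := c'))"
              by (rule cvx_chain_push) (use l(3) 3 h cvx_chain_mono[OF l(3) l'(1)] in auto)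
            ultimately show "cvx_chain (Suc l') (arr s5 8) (arr s5 9)"
              and "envelope (lines (Suc l') (arr s5 8) (arr s5 9)) (B (Suc k))"
              using e by (simp_all add: lines_Suc lines_upd)
          qed (use l l' in \<open>simp_all add: s5_def\<close>)
          then show "wp (SetA 8 (V 13) (V 15) ;; SetA 9 (V 13) (V 16) ;; SetV 13 (V 13 \<oplus> Num 1)) ?Q s4 t4"
            by (intro wp_Seq wp_SetV wp_SetA) (use l l' lt 4 t4 in \<open>simp_all add: s5_def\<close>)
        qed
        have "slope i = arr s 7 i" using a7 m(5) ik by simp
        then show "wp D ?Q s2 (t - 2 - 1)" unfolding D_def
          by (intro wp_Seq wp_SetV) (use w vals ik lt in \<open>simp_all add: s2_def s3_def c_def Arr_arr\<close>)
      next
        assume "\<not> apply_compare Leq (aval s2 (Num 0)) (aval s2 (V 14))"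
        then have "\<not> 0 \<le> r" by (simp add: s2_def)
        then have "J (Suc k) s2" using l B unfolding J_def s2_def by (intro exI[of _ l]) simp
        then show "wp CSkip ?Q s2 (t - 2 - 1)" using v by (simp add: s2_def)
      qed simp_all
      then show ?thesis unfolding stack_body_def D_def[symmetric]
        by (intro wp_Seq wp_SetV) (use d v lt f ik in \<open>simp_all add: s2_def Arr_arr del: aval.simps(3) safe.simps(3)\<close>)
    qed
  qed (simp_all add: J_def)
  then have "wp (CFor 2 (V 10) (stack_body a)) (\<lambda>s t'. (\<exists>l\<le>n. s (Var 13) = real l \<and> cvx_chain l (arr s 8) (arr s 9) \<and>
      envelope (lines l (arr s 8) (arr s 9)) (line x ` {i \<in> act x. al i < 0})) \<and>
      t' \<ge> t - (29 * real n + 3)) s1 (t - 1)"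
  proof (rule wp_conseq)
    fix s t' assume *: "J m s \<and> s (Var 2) = real m \<and>
      t' + (- (9 * s (Var 13))) \<ge> (t - 1) + (- (9 * s1 (Var 13))) - (real m * (27 + 2) + 2)"
    then obtain l where l: "l \<le> m" "s (Var 13) = real l" "cvx_chain l (arr s 8) (arr s 9)"
      "envelope (lines l (arr s 8) (arr s 9)) (B m)" unfolding J_def by blast
    have "B m = line x ` {i \<in> act x. al i < 0}" unfolding B_def m(3) by (auto simp: act_def)
    moreover have "real m \<le> real n" using m by simp
    ultimately show "(\<exists>l\<le>n. s (Var 13) = real l \<and> cvx_chain l (arr s 8) (arr s 9) \<and>
      envelope (lines l (arr s 8) (arr s 9)) (line x ` {i \<in> act x. al i < 0})) \<and>
      t' \<ge> t - (29 * real n + 3)" using * l m by (auto simp: s1_def intro!: exI[of _ l])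
  qed
  then show ?thesis unfolding stack_prog_def
    by (intro wp_Seq wp_SetV) (simp_all add: s1_def)
qed

end

section \<open>Finding the highest line of a convex chain at a point\<close>

lemma cvx_chain_less: "cvx_chain l M C \<Longrightarrow> k < j \<Longrightarrow> j < l \<Longrightarrow> M k < M j"
proof (induction j)
  case (Suc j)
  then have "M j < M (Suc j)" by (simp add: cvx_chain_def)
  then show ?case using Suc by (cases "k = j") auto
qed simp

text \<open>The values of the lines at a fixed point, listed by increasing slope, are unimodal:
  consecutive crossings move to the right, so where line k + 2 has caught up with line k + 1, the
  latter has already caught up with line k.\<close>

lemma cvx_chain_step:
  assumes "cvx_chain l M C" "Suc (Suc k) < l" "0 \<le> td"
    and "M (Suc k) * tn - C (Suc k) * td \<le> M (Suc (Suc k)) * tn - C (Suc (Suc k)) * td"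
  shows "M k * tn - C k * td \<le> M (Suc k) * tn - C (Suc k) * td"
proof -
  define m0 m1 m2 c0 c1 c2 where "m0 = M k" "m1 = M (Suc k)" "m2 = M (Suc (Suc k))"
    "c0 = C k" "c1 = C (Suc k)" "c2 = C (Suc (Suc k))"
  note d = this
  have m: "m0 < m1" "m1 < m2" using cvx_chain_less[OF assms(1)] assms(2) by (auto simp: d)
  have "(m2 - m0) * c1 < (m1 - m0) * c2 + (m2 - m1) * c0"
    using assms(1,2) by (simp add: cvx_chain_def d)
  then have "((m2 - m0) * c1) * td \<le> ((m1 - m0) * c2 + (m2 - m1) * c0) * td"
    using assms(3) by (intro mult_right_mono) auto
  moreover have "(m1 - m0) * (m1 * tn - c1 * td) \<le> (m1 - m0) * (m2 * tn - c2 * td)"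
    using assms(4) m by (intro mult_left_mono) (auto simp: d)
  ultimately have "(m2 - m1) * (m0 * tn - c0 * td) \<le> (m2 - m1) * (m1 * tn - c1 * td)"
    by (simp add: algebra_simps)
  then show ?thesis using m by (simp add: d)
qed

text \<open>By unimodality one comparison with the next flatter line settles the comparison with all
  flatter lines. This is what allows \<open>query_iter\<close> to stop.\<close>

lemma cvx_chain_active:
  assumes "cvx_chain l M C" "Suc j < l" "0 \<le> td"
    and "M j * tn - C j * td \<le> M (Suc j) * tn - C (Suc j) * td" and "k \<le> Suc j"
  shows "M k * tn - C k * td \<le> M (Suc j) * tn - C (Suc j) * td"
  using assms(2,4,5)
proof (induction j arbitrary: k)
  case 0
  then show ?case by (cases k) auto
next
  case (Suc j)
  have s: "M j * tn - C j * td \<le> M (Suc j) * tn - C (Suc j) * td"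
    using cvx_chain_step[OF assms(1) Suc.prems(1) assms(3) Suc.prems(2)] .
  show ?case
  proof (cases "k = Suc (Suc j)")
    case False
    then have "M k * tn - C k * td \<le> M (Suc j) * tn - C (Suc j) * td"
      using Suc.IH[of k] s Suc.prems by auto
    then show ?thesis using Suc.prems(2) by linarith
  qed simp
qed

subsection \<open>Bounds at a point from pairs of constraints\<close>

text \<open>Upper bounds that hold at \<open>tn / td\<close> persist at \<open>tn' / td'\<close>; thus
  \<open>tn' / td' \<le> tn / td\<close>, also for the point at infinity.\<close>

definition keeps_bounds :: "real \<Rightarrow> real \<Rightarrow> real \<Rightarrow> real \<Rightarrow> bool" where
  "keeps_bounds tn td tn' td' \<longleftrightarrow> (\<forall>A B. 0 < A \<longrightarrow> A * tn \<le> B * td \<longrightarrow> A * tn' \<le> B * td')"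

lemma keeps_bounds_refl: "keeps_bounds tn td tn td"
  by (simp add: keeps_bounds_def)

lemma keeps_bounds_trans:
  "keeps_bounds a b c d \<Longrightarrow> keeps_bounds c d e f \<Longrightarrow> keeps_bounds a b e f"
  by (simp add: keeps_bounds_def)

text \<open>Violation means that cc / mm is smaller than the current point, and an upper bound
  passes to smaller points. At infinity there is nothing to keep: \<open>A * tn \<le> B * td\<close>
  would say \<open>A \<le> 0\<close>.\<close>

lemma keeps_bounds_violated:
  assumes "0 < td \<or> td = 0 \<and> tn = 1" "cc * td < mm * tn" "0 < mm"
  shows "keeps_bounds tn td cc mm"
  unfolding keeps_bounds_def
proof (intro allI impI)
  fix A B :: real assume A: "0 < A" "A * tn \<le> B * td"
  show "A * cc \<le> B * mm"
  proof (cases "td = 0")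
    case True
    then show ?thesis using assms A by auto
  next
    case False
    then have td: "0 < td" using assms by auto
    have "A * (cc * td) \<le> A * (mm * tn)" using A assms by simp
    also have "\<dots> = mm * (A * tn)" by simp
    also have "\<dots> \<le> mm * (B * td)" using A assms by (intro mult_left_mono) auto
    finally have "(A * cc) * td \<le> (B * mm) * td" by (simp add: mult.assoc mult.left_commute)
    then show ?thesis using td by simp
  qed
qed

text \<open>If the constraint and the active line conflict at the current upper bound without yielding a
  smaller one, there is no feasible point. The bound \<open>(0, 0)\<close> then violates nothing, which ends
  the loop.\<close>

definition query_iter :: "nat \<Rightarrow> nat \<Rightarrow> com" where
  "query_iter a b = SetV 24 (A b (V 4) \<oplus> A a (V 4) \<otimes> A 8 (V 20 \<ominus> Num 1)) ;;
     SetV 25 (V 23 \<oplus> A a (V 4) \<otimes> A 9 (V 20 \<ominus> Num 1)) ;;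
     CIf Less (V 25 \<otimes> V 22) (V 24 \<otimes> V 21)
       (CIf Less (Num 0) (V 24) (SetV 21 (V 25) ;; SetV 22 (V 24))
         (SetV 6 (Num 1) ;; SetV 21 (Num 0) ;; SetV 22 (Num 0)))
       CSkip ;;
     CIf Less (Num 1) (V 20)
       (CIf Less (A 8 (V 20 \<ominus> Num 1) \<otimes> V 21 \<ominus> A 9 (V 20 \<ominus> Num 1) \<otimes> V 22)
          (A 8 (V 20 \<ominus> Num 2) \<otimes> V 21 \<ominus> A 9 (V 20 \<ominus> Num 2) \<otimes> V 22)
         (SetV 20 (V 20 \<ominus> Num 1)) (SetV 17 (Num 0)))
       (SetV 17 (Num 0))"

text \<open>The loop is skipped for the constraints that form the lines, for owners at infinite
  distance, and for positive coefficients if there is no line to pair with. A constraint with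
  coefficient 0 does run: the line then enters with weight 0, and the loop tests the constraint
  alone.\<close>

definition query_body :: "nat \<Rightarrow> nat \<Rightarrow> com" where
  "query_body a b = SetV 14 (dist_exp (V 1) (A 5 (V 4))) ;; SetV 17 (Num 1) ;;
     CIf Less (A a (V 4)) (Num 0) (SetV 17 (Num 0)) CSkip ;;
     CIf Less (V 14) (Num 0) (SetV 17 (Num 0)) CSkip ;;
     CIf Leq (V 13) (Num 0) (CIf Less (Num 0) (A a (V 4)) (SetV 17 (Num 0)) CSkip) CSkip ;;
     SetV 23 (A 4 (V 4) \<oplus> I (Num 2) \<otimes> V 14) ;;
     CWhile Less (Num 0) (V 17) (query_iter a b)"

context direction
begin

definition feas :: "nat \<Rightarrow> real \<Rightarrow> real \<Rightarrow> bool" where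
  "feas x u t \<longleftrightarrow> (\<forall>i\<in>act x. al i * u + be i * t \<le> sh i x)"

text \<open>The bound tn / td without division. At (1, 0), no bound yet, and at (0, 0), after a
  contradiction, it holds trivially.\<close>

definition valid :: "nat \<Rightarrow> real \<Rightarrow> real \<Rightarrow> bool" where
  "valid x tn td \<longleftrightarrow> (\<forall>u t. feas x u t \<longrightarrow> t * td \<le> tn)"

text \<open>Like \<open>V 20\<close>, \<open>j\<close> is a height and counts from 1; the active
  line is entry \<open>j - 1\<close>.\<close>

definition top_line :: "(nat \<Rightarrow> real) \<Rightarrow> (nat \<Rightarrow> real) \<Rightarrow> nat \<Rightarrow> nat \<Rightarrow> real \<Rightarrow> real \<Rightarrow> bool" where
  "top_line M C l j tn td \<longleftrightarrow> (\<forall>k<l. M k * tn - C k * td \<le> M (j - 1) * tn - C (j - 1) * td)"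

text \<open>If the constraint and the active line conflict at the current bound, the bound drops to
  the value that they allow together. A smaller bound favours flatter lines, so the active line can
  only move down the chain. During the loop the invariant therefore compares the active line with
  steeper lines only; the comparison with flatter ones is restored when the loop stops. Every round
  but the last lowers the height, which accounts for 12 credits per unit of height. Once the flag is
  set only validity, termination and cost are claimed.\<close>

lemma query_loop:
  assumes vals: "s0 (Var 4) = real i" "i < cp" "arr s0 a i = al i" "arr s0 b i = be i" "s0 (Var 23) = g"
    and KM: "M = arr s0 8" "C = arr s0 9" and l: "cvx_chain l M C" "l \<le> cp"
    and j0: "s0 (Var 20) = real j0" "1 \<le> j0" "j0 \<le> l"
    and T0: "s0 (Var 21) = tn0" "s0 (Var 22) = td0" "0 \<le> td0" "valid x tn0 td0"
    and fl: "s0 (Var 6) = fl"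
    and good: "fl = 0 \<Longrightarrow> (0 < td0 \<or> td0 = 0 \<and> tn0 = 1) \<and> top_line M C l j0 tn0 td0"
    and sound: "\<And>k u t. k < l \<Longrightarrow> feas x u t \<Longrightarrow> (be i + al i * M k) * t \<le> g + al i * C k"
    and go: "s0 (Var 17) = 1"
  shows "wp (CWhile Less (Num 0) (V 17) (query_iter a b)) (\<lambda>s t'. \<exists>j tn td.
      s (Var 20) = real j \<and> 1 \<le> j \<and> j \<le> j0 \<and> s (Var 21) = tn \<and> s (Var 22) = td \<and> 0 \<le> td \<and> valid x tn td \<and>
      (s (Var 6) = fl \<or> s (Var 6) = 1 \<and> (\<forall>u t. \<not> feas x u t)) \<and>
      (s (Var 6) = 0 \<longrightarrow> (0 < td \<or> td = 0 \<and> tn = 1) \<and> top_line M C l j tn td \<and> keeps_bounds tn0 td0 tn td \<and>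
        (be i + al i * M (j - 1)) * tn \<le> (g + al i * C (j - 1)) * td) \<and>
      t' \<ge> t - (12 * (real j0 - real j) + 12)) s0 t"
proof -
  define K where "K = (\<lambda>s t'. \<exists>j tn td.
      s (Var 20) = real j \<and> 1 \<le> j \<and> j \<le> j0 \<and> s (Var 21) = tn \<and> s (Var 22) = td \<and> 0 \<le> td \<and> valid x tn td \<and>
      s (Var 4) = real i \<and> arr s a i = al i \<and> arr s b i = be i \<and> s (Var 23) = g \<and> arr s 8 = M \<and> arr s 9 = C \<and>
      (s (Var 6) = fl \<or> s (Var 6) = 1 \<and> (\<forall>u t. \<not> feas x u t)) \<and>
      (s (Var 6) = 0 \<longrightarrow> (0 < td \<or> td = 0 \<and> tn = 1) \<and> keeps_bounds tn0 td0 tn td \<and>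
        (\<forall>k<l. j \<le> k \<longrightarrow> M k * tn - C k * td \<le> M (j - 1) * tn - C (j - 1) * td)) \<and>
      (s (Var 17) = 1 \<or> s (Var 17) = 0 \<and> (s (Var 6) = 0 \<longrightarrow> top_line M C l j tn td \<and>
        (be i + al i * M (j - 1)) * tn \<le> (g + al i * C (j - 1)) * td)) \<and>
      t' \<ge> t - 12 * (real j0 - real j) - (if s (Var 17) = 1 then 0 else 11))"
  show ?thesis
  proof (rule wp_While[where J = K and e = "t - 12 * real j0 - 11"])
    show "K s0 t" unfolding K_def
      by (rule exI[of _ j0], rule exI[of _ tn0], rule exI[of _ td0])
        (use vals KM j0 T0 fl go good keeps_bounds_refl in \<open>auto simp: top_line_def\<close>)
    fix s t' assume "K s t'"
    then obtain j tn td where j: "s (Var 20) = real j" "1 \<le> j" "j \<le> j0"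
      and T: "s (Var 21) = tn" "s (Var 22) = td" "0 \<le> td" "valid x tn td"
      and v: "s (Var 4) = real i" "arr s a i = al i" "arr s b i = be i" "s (Var 23) = g" "arr s 8 = M" "arr s 9 = C"
      and f: "s (Var 6) = fl \<or> s (Var 6) = 1 \<and> (\<forall>u t. \<not> feas x u t)"
      and g0: "s (Var 6) = 0 \<longrightarrow> (0 < td \<or> td = 0 \<and> tn = 1) \<and> keeps_bounds tn0 td0 tn td \<and>
        (\<forall>k<l. j \<le> k \<longrightarrow> M k * tn - C k * td \<le> M (j - 1) * tn - C (j - 1) * td)"
      and go: "s (Var 17) = 1 \<or> s (Var 17) = 0 \<and> (s (Var 6) = 0 \<longrightarrow> top_line M C l j tn td \<and>
        (be i + al i * M (j - 1)) * tn \<le> (g + al i * C (j - 1)) * td)"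
      and t': "t' \<ge> t - 12 * (real j0 - real j) - (if s (Var 17) = 1 then 0 else 11)"
      unfolding K_def by blast
    show "t - 12 * real j0 - 11 \<le> t'" using t' by (auto split: if_splits)
    show "safe s (Num 0) \<and> safe s (V 17)" by simp
    show "\<exists>j tn td.
      s (Var 20) = real j \<and> 1 \<le> j \<and> j \<le> j0 \<and> s (Var 21) = tn \<and> s (Var 22) = td \<and> 0 \<le> td \<and> valid x tn td \<and>
      (s (Var 6) = fl \<or> s (Var 6) = 1 \<and> (\<forall>u t. \<not> feas x u t)) \<and>
      (s (Var 6) = 0 \<longrightarrow> (0 < td \<or> td = 0 \<and> tn = 1) \<and> top_line M C l j tn td \<and> keeps_bounds tn0 td0 tn td \<and>
        (be i + al i * M (j - 1)) * tn \<le> (g + al i * C (j - 1)) * td) \<and>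
      t' - 1 \<ge> t - (12 * (real j0 - real j) + 12)"
      if "\<not> apply_compare Less (aval s (Num 0)) (aval s (V 17))"
    proof -
      have s17: "s (Var 17) = 0" using that go by auto
      have "s (Var 6) = 0 \<longrightarrow> (0 < td \<or> td = 0 \<and> tn = 1) \<and> top_line M C l j tn td \<and> keeps_bounds tn0 td0 tn td \<and>
        (be i + al i * M (j - 1)) * tn \<le> (g + al i * C (j - 1)) * td" using g0 go s17 by simp
      moreover have "t' - 1 \<ge> t - (12 * (real j0 - real j) + 12)" using t' s17 by simp
      ultimately show ?thesis using j T f by blast
    qed
    assume "apply_compare Less (aval s (Num 0)) (aval s (V 17))"
    then have g1: "s (Var 17) = 1" using go by auto
    have t1: "t' \<ge> t - 12 * (real j0 - real j)" using t' g1 by simp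
    obtain j' where j': "j = Suc j'" using j by (cases j) auto
    have i1: "real j - 1 = real j'" "j - 1 = j'" and ib: "j' < cp" "j' < l" using j' j j0 l by auto
    have ab32: "a < 32" "b < 32" using ab by auto
    define mm where "mm = be i + al i * M j'"
    define cc where "cc = g + al i * C j'"
    define s2 where "s2 = s(Var 24 := mm, Var 25 := cc)"
    define D where "D = CIf Less (Num 1) (V 20)
       (CIf Less (A 8 (V 20 \<ominus> Num 1) \<otimes> V 21 \<ominus> A 9 (V 20 \<ominus> Num 1) \<otimes> V 22)
          (A 8 (V 20 \<ominus> Num 2) \<otimes> V 21 \<ominus> A 9 (V 20 \<ominus> Num 2) \<otimes> V 22)
         (SetV 20 (V 20 \<ominus> Num 1)) (SetV 17 (Num 0)))
       (SetV 17 (Num 0))"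
    \<comment> \<open>The state between the two halves of the loop body: the bound has been updated,
      the active line has not.\<close>
    define mid where "mid = (\<lambda>s tn td. s (Var 20) = real j \<and> s (Var 21) = tn \<and> s (Var 22) = td \<and> 0 \<le> td \<and> valid x tn td \<and>
      s (Var 4) = real i \<and> arr s a i = al i \<and> arr s b i = be i \<and> s (Var 23) = g \<and> arr s 8 = M \<and> arr s 9 = C \<and>
      (s (Var 6) = fl \<or> s (Var 6) = 1 \<and> (\<forall>u t. \<not> feas x u t)) \<and> s (Var 17) = 1 \<and>
      (s (Var 6) = 0 \<longrightarrow> (0 < td \<or> td = 0 \<and> tn = 1) \<and> keeps_bounds tn0 td0 tn td \<and>
        (\<forall>k<l. j \<le> k \<longrightarrow> M k * tn - C k * td \<le> M j' * tn - C j' * td) \<and> mm * tn \<le> cc * td))"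
    have D: "wp D K s3 t3" if mid: "mid s3 tn td" and t3: "t3 \<ge> t' - 8" for s3 tn td t3
    proof -
      note m = mid[unfolded mid_def]
      have m_act: "\<forall>k<l. j \<le> k \<longrightarrow> M k * tn - C k * td \<le> M j' * tn - C j' * td" if "s3 (Var 6) = 0"
        using m that by blast
      have stop: "K (s3(Var 17 := 0)) (t3 - u)" if "u \<le> 3"
        "s3 (Var 6) = 0 \<longrightarrow> top_line M C l j tn td" for u
        unfolding K_def by (rule exI[of _ j], rule exI[of _ tn], rule exI[of _ td])
          (use m that j t1 t3 i1 in \<open>simp add: mm_def cc_def\<close>)
      show ?thesis
      proof (cases "1 < j")
        case False
        have "s3 (Var 6) = 0 \<longrightarrow> top_line M C l j tn td" unfolding top_line_def i1(2)
        proof (intro impI allI)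
          fix k assume "s3 (Var 6) = 0" "k < l"
          then show "M k * tn - C k * td \<le> M j' * tn - C j' * td"
            using m_act j' False by (cases "k = j'") auto
        qed
        from stop[OF _ this, of 2] show ?thesis unfolding D_def
          by (intro wp_If wp_SetV) (use False m in simp_all)
      next
        case True
        then obtain j'' where j'': "j' = Suc j''" using j' by (cases j') auto
        have i2: "real j - 2 = real j''" "j'' < cp" using j' j'' ib by auto
        show ?thesis
        proof (cases "M j' * tn - C j' * td < M j'' * tn - C j'' * td")
          case lt: True
          have "K (s3(Var 20 := real j')) (t3 - 3)" unfolding K_def
          proof (rule exI[of _ j'], rule exI[of _ tn], rule exI[of _ td], intro conjI)
            show "(s3(Var 20 := real j')) (Var 6) = 0 \<longrightarrow>
              (0 < td \<or> td = 0 \<and> tn = 1) \<and> keeps_bounds tn0 td0 tn td \<and>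
              (\<forall>k<l. j' \<le> k \<longrightarrow> M k * tn - C k * td \<le> M (j' - 1) * tn - C (j' - 1) * td)"
            proof (intro impI conjI allI)
              fix k assume "(s3(Var 20 := real j')) (Var 6) = 0" "k < l" "j' \<le> k"
              then have "M k * tn - C k * td \<le> M j' * tn - C j' * td"
                using m_act j' by (cases "k = j'") auto
              then show "M k * tn - C k * td \<le> M (j' - 1) * tn - C (j' - 1) * td" using lt j'' by simp
            qed (use m in auto)
          qed (use m j j' j'' t1 t3 in \<open>auto\<close>)
          then show ?thesis unfolding D_def
            by (intro wp_If wp_SetV) (use True lt m i1 i2 ib in \<open>simp_all add: Arr_arr\<close>)
        next
          case ge: False
          have "s3 (Var 6) = 0 \<longrightarrow> top_line M C l j tn td" unfolding top_line_def i1(2)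
          proof (intro impI allI)
            fix k assume "s3 (Var 6) = 0" "k < l"
            then show "M k * tn - C k * td \<le> M j' * tn - C j' * td"
              using m_act m j' j'' ib ge cvx_chain_active[OF l(1), of j'' td tn k]
              by (cases "j \<le> k") (auto simp: not_less)
          qed
          from stop[OF _ this, of 3] show ?thesis unfolding D_def
            by (intro wp_If wp_SetV) (use True ge m i1 i2 ib in \<open>simp_all add: Arr_arr\<close>)
        qed
      qed
    qed
    have "wp (CIf Less (V 25 \<otimes> V 22) (V 24 \<otimes> V 21)
       (CIf Less (Num 0) (V 24) (SetV 21 (V 25) ;; SetV 22 (V 24))
         (SetV 6 (Num 1) ;; SetV 21 (Num 0) ;; SetV 22 (Num 0)))
       CSkip) (wp D K) s2 (t' - 3)"
    proof (cases "cc * td < mm * tn")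
      case viol: True
      show ?thesis
      proof (cases "0 < mm")
        case True
        have "mid (s2(Var 21 := cc, Var 22 := mm)) cc mm" unfolding mid_def
        proof (intro conjI)
          show "valid x cc mm" unfolding valid_def
            using sound[OF ib(2)] by (auto simp: mm_def cc_def mult.commute)
          show "(s2(Var 21 := cc, Var 22 := mm)) (Var 6) = 0 \<longrightarrow>
            (0 < mm \<or> mm = 0 \<and> cc = 1) \<and> keeps_bounds tn0 td0 cc mm \<and>
            (\<forall>k<l. j \<le> k \<longrightarrow> M k * cc - C k * mm \<le> M j' * cc - C j' * mm) \<and> mm * cc \<le> cc * mm"
          proof (intro impI conjI allI)
            assume "(s2(Var 21 := cc, Var 22 := mm)) (Var 6) = 0"
            then have 6: "s (Var 6) = 0" by (simp add: s2_def)
            have kb: "keeps_bounds tn td cc mm" using keeps_bounds_violated viol True 6 g0 by blast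
            then show "keeps_bounds tn0 td0 cc mm" using keeps_bounds_trans 6 g0 by blast
            fix k assume k: "k < l" "j \<le> k"
            \<comment> \<open>That a steeper line lies below the active one is an upper bound on the
              point, and so it survives the decrease of the point.\<close>
            then have "0 < M k - M j'" using cvx_chain_less[OF l(1), of j' k] j' by auto
            moreover have "(M k - M j') * tn \<le> (C k - C j') * td"
              using 6 g0 k i1 by (simp add: algebra_simps)
            ultimately have "(M k - M j') * cc \<le> (C k - C j') * mm" using kb by (simp add: keeps_bounds_def)
            then show "M k * cc - C k * mm \<le> M j' * cc - C j' * mm" by (simp add: algebra_simps)
          qed (use True in auto)
        qed (use j v f g1 True in \<open>simp_all add: s2_def\<close>)
        from D[OF this, of "t' - 7"] show ?thesis
          by (intro wp_If wp_SetV wp_Seq) (use viol True T in \<open>simp_all add: s2_def\<close>)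
      next
        case False
        \<comment> \<open>The pair demands \<open>mm * t \<le> cc\<close>. Every feasible t has
          \<open>t * td \<le> tn\<close>, and multiplying by the nonpositive \<open>mm\<close>
          reverses this, so that \<open>mm * t * td\<close> is at least \<open>mm * tn\<close> and
          exceeds \<open>cc * td\<close>.\<close>
        have infeas: "\<not> feas x u t" for u t
        proof
          assume fe: "feas x u t"
          have "t * td \<le> tn" using fe T(4) unfolding valid_def by blast
          then have "mm * tn \<le> mm * (t * td)" using False by (intro mult_left_mono_neg) auto
          also have "\<dots> = (mm * t) * td" by simp
          also have "\<dots> \<le> cc * td"
            using sound[OF ib(2) fe] T(3) by (intro mult_right_mono) (auto simp: mm_def cc_def)
          finally show False using viol by simp
        qed
        have "mid (s2(Var 6 := 1, Var 21 := 0, Var 22 := 0)) 0 0" unfolding mid_def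
          using j v g1 infeas by (simp add: s2_def valid_def)
        from D[OF this, of "t' - 8"] show ?thesis
          by (intro wp_If wp_SetV wp_Seq) (use viol False T in \<open>simp_all add: s2_def\<close>)
      qed
    next
      case False
      have "mid s2 tn td" unfolding mid_def
        using j v f g0 g1 T False i1 by (simp add: s2_def)
      from D[OF this, of "t' - 4"] show ?thesis
        by (intro wp_If wp_Skip) (use False T in \<open>simp_all add: s2_def\<close>)
    qed
    then show "wp (query_iter a b) K s (t' - 1)"
      unfolding query_iter_def D_def[symmetric]
      by (intro wp_SetV wp_Seq) (use v i1 ib j ab32 vals in \<open>simp_all add: s2_def mm_def cc_def Arr_arr\<close>)
  qed
qed

end

text \<open>An empty stack receives the line (0, 0), so that constraints with coefficient 0 can pass
  through the same loop; \<open>V 13\<close> remains 0 and tells \<open>query_body\<close> that no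
  real line exists. The bound starts at infinity, (1, 0).\<close>

definition point_prog :: "nat \<Rightarrow> nat \<Rightarrow> com" where
  "point_prog a b = stack_prog a ;;
     CIf Leq (V 13) (Num 0) (SetA 8 (Num 0) (Num 0) ;; SetA 9 (Num 0) (Num 0) ;; SetV 20 (Num 1))
       (SetV 20 (V 13)) ;;
     SetV 21 (Num 1) ;; SetV 22 (Num 0) ;; CFor 4 (V 3) (query_body a b) ;;
     CIf Less (Num 0) (V 22) (SetA 10 (V 1) (V 21 \<oslash> V 22) ;; SetA 11 (V 1) (Num 1))
       (SetA 11 (V 1) (Num 0))"

context direction
begin

text \<open>A pair bounds t from above only if its coefficient \<open>be i + al i * slope j\<close>
  is positive; negative coefficients are the business of the reflected direction.\<close>

definition exact :: "nat \<Rightarrow> nat \<Rightarrow> real \<Rightarrow> real \<Rightarrow> bool" where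
  "exact x i tn td \<longleftrightarrow> (\<forall>j\<in>act x. al j < 0 \<longrightarrow> 0 < be i + al i * slope j \<longrightarrow>
      (be i + al i * slope j) * tn \<le> (sh i x + al i * snd (line x j)) * td) \<and>
    (al i = 0 \<longrightarrow> 0 < be i \<longrightarrow> be i * tn \<le> sh i x * td)"

lemma exact_keeps: "exact x i tn td \<Longrightarrow> keeps_bounds tn td tn' td' \<Longrightarrow> exact x i tn' td'"
  by (auto simp: exact_def keeps_bounds_def)

lemma line_below:
  assumes "feas x u t" "j \<in> act x" "al j < 0"
  shows "slope j * t - snd (line x j) \<le> u"
proof -
  have "al j * u + be j * t \<le> sh j x" using assms by (auto simp: feas_def)
  then have "be j * t - sh j x \<le> (0 - al j) * u" by simp
  then have "(be j * t - sh j x) / (0 - al j) \<le> u"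
    by (subst pos_divide_le_eq) (use assms(3) in \<open>simp_all add: mult.commute\<close>)
  then show ?thesis by (simp add: slope_def line_def diff_divide_distrib)
qed

lemma query_body_touches: "touches (query_body a b) l \<longleftrightarrow>
    l \<in> {Var 6, Var 14, Var 17, Var 20, Var 21, Var 22, Var 23, Var 24, Var 25}"
  by (auto simp: query_body_def query_iter_def)

text \<open>The potential is -12 times the height of the active line. This height never increases,
  so the descents for all constraints together cost at most 12 l. Bounds obtained from earlier
  constraints persist by \<open>keeps_bounds\<close>.\<close>

lemma query_for:
  assumes inp: "inputs s0" and x: "s0 (Var 1) = real x" "x < N"
    and l0: "s0 (Var 13) = real l0" "envelope (lines l0 M C) (line x ` {i \<in> act x. al i < 0})"
    and l: "cvx_chain l M C" "1 \<le> l" "l \<le> cp" "l0 = 0 \<or> l0 = l"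
    and KM: "M = arr s0 8" "C = arr s0 9"
    and T0: "s0 (Var 20) = real l" "s0 (Var 21) = 1" "s0 (Var 22) = 0"
    and fl: "s0 (Var 6) = fl"
  shows "wp (CFor 4 (V 3) (query_body a b)) (\<lambda>s t'. \<exists>tn td. s (Var 21) = tn \<and> s (Var 22) = td \<and> 0 \<le> td \<and>
      valid x tn td \<and> (s (Var 6) = fl \<or> s (Var 6) = 1 \<and> (\<forall>u t. \<not> feas x u t)) \<and>
      (s (Var 6) = 0 \<longrightarrow> (0 < td \<or> td = 0 \<and> tn = 1) \<and>
        (\<forall>i\<in>act x. 0 \<le> al i \<longrightarrow> exact x i tn td)) \<and> t' \<ge> t - (24 * real n + 12 * real l + 2)) s0 t"
proof -
  define J where "J = (\<lambda>k s. \<exists>j tn td. s (Var 20) = real j \<and> 1 \<le> j \<and> j \<le> l \<and>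
      s (Var 21) = tn \<and> s (Var 22) = td \<and> 0 \<le> td \<and> valid x tn td \<and>
      (s (Var 6) = fl \<or> s (Var 6) = 1 \<and> (\<forall>u t. \<not> feas x u t)) \<and>
      (s (Var 6) = 0 \<longrightarrow> (0 < td \<or> td = 0 \<and> tn = 1) \<and> top_line M C l j tn td \<and>
        (\<forall>i<k. i \<in> act x \<longrightarrow> 0 \<le> al i \<longrightarrow> exact x i tn td)))"
  have blue_empty: "\<not> (j \<in> act x \<and> al j < 0)" if "l0 = 0" for j
  proof
    assume j: "j \<in> act x \<and> al j < 0"
    \<comment> \<open>At the homogeneous point (0, 0) every line has the value 0, so only an empty
      set of lines lies below -1.\<close>
    have "below {} 0 0 (- 1)" by (simp add: below_def)
    then have "below (line x ` {i \<in> act x. al i < 0}) 0 0 (- 1)"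
      using l0(2) that by (simp add: envelope_def lines_def)
    then show False using j by (auto simp: below_def split: prod.splits)
  qed
  have "wp (CFor 4 (V 3) (query_body a b)) (\<lambda>s' t'. J n s' \<and> s' (Var 4) = real n \<and>
      t' + (- (12 * s' (Var 20))) \<ge> t + (- (12 * s0 (Var 20))) - (real n * (22 + 2) + 2)) s0 t"
  proof (rule wp_For)
    \<comment> \<open>At infinity lines compare by slope alone, so the last line of the chain is the
      active one.\<close>
    have "M k * 1 - C k * 0 \<le> M (l - 1) * 1 - C (l - 1) * 0" if "k < l" for k
    proof (cases "k < l - 1")
      case True
      then have "M k < M (l - 1)" using cvx_chain_less[OF l(1) True] that by simp
      then show ?thesis by simp
    next
      case False
      then have "k = l - 1" using that by simp
      then show ?thesis by simp
    qed
    then have "top_line M C l l 1 0" by (simp add: top_line_def)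
    then show "J 0 s0" unfolding J_def
      by (rule_tac exI[of _ l], rule_tac exI[of _ 1], rule_tac exI[of _ 0])
        (use l T0 fl in \<open>simp add: valid_def\<close>)
  next
    fix k s
    assume "\<And>l. l \<noteq> Var 4 \<Longrightarrow> \<not> touches (query_body a b) l \<Longrightarrow> s l = s0 l"
    from this[of "Var 3"] show "safe s (V 3) \<and> aval s (V 3) = real n"
      using inp by (simp add: query_body_touches inputs_def)
  next
    fix i s t assume k: "i < n" and J: "J i s" and v: "s (Var 4) = real i"
      and fr: "\<And>l. l \<noteq> Var 4 \<Longrightarrow> \<not> touches (query_body a b) l \<Longrightarrow> s l = s0 l"
    have inps: "inputs s" by (rule inputs_frame[OF inp]) (auto intro!: fr simp: query_body_touches)
    have s: "s (Var 1) = real x" "s (Var 13) = real l0" "arr s 8 = M" "arr s 9 = C"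
      using fr x l0 KM by (auto simp: query_body_touches arr_def)
    have vals: "arr s a i = al i" "arr s b i = be i" "arr s 4 i = \<gamma> i" "arr s 5 i = real (z i)" "s (Inp 2) = lam"
      using \<open>inputs s\<close> k by (auto simp: inputs_def)
    have lt: "i < cp" "a < 32" "b < 32" "2 < il" using k cp ab il x by auto
    have zi: "z i < N" using z k by simp
    define r where "r = \<rho> x (z i)"
    have d: "aval s (dist_exp (V 1) (A 5 (V 4))) = r"
      "safe s (dist_exp (V 1) (A 5 (V 4)))"
      unfolding r_def by (rule dist_val; use inps vals v s x zi lt in \<open>simp add: Arr_arr\<close>)+
    obtain j tn td where j: "s (Var 20) = real j" "1 \<le> j" "j \<le> l"
      and T: "s (Var 21) = tn" "s (Var 22) = td" "0 \<le> td" "valid x tn td"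
      and f: "s (Var 6) = fl \<or> s (Var 6) = 1 \<and> (\<forall>u t. \<not> feas x u t)"
      and g0: "s (Var 6) = 0 \<Longrightarrow> (0 < td \<or> td = 0 \<and> tn = 1) \<and> top_line M C l j tn td \<and>
        (\<forall>i'<i. i' \<in> act x \<longrightarrow> 0 \<le> al i' \<longrightarrow> exact x i' tn td)"
      using J unfolding J_def by blast
    show "wp (query_body a b) (\<lambda>s' t'. s' (Var 4) = real i \<and> J (Suc i) s' \<and>
       t' + (- (12 * s' (Var 20))) \<ge> t + (- (12 * s (Var 20))) - 22) s t"
      (is "wp _ ?Q _ _")
    proof -
      define W where "W = CWhile Less (Num 0) (V 17) (query_iter a b)"
      define go where "go \<longleftrightarrow> 0 \<le> al i \<and> 0 \<le> r \<and> \<not> (l0 = 0 \<and> 0 < al i)"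
      define s2 where "s2 = (\<lambda>g. s(Var 14 := r, Var 17 := g, Var 23 := \<gamma> i + lam * r))"
      have stop: "wp W ?Q (s2 0) t2" if "\<not> go" "t2 \<ge> t - 20" for t2
      proof -
        have "\<not> (i \<in> act x \<and> 0 \<le> al i) \<or> exact x i tn td"
          using that blue_empty by (auto simp: go_def act_def r_def exact_def)
        then have "J (Suc i) (s2 0)" unfolding J_def
          by (rule_tac exI[of _ j], rule_tac exI[of _ tn], rule_tac exI[of _ td])
            (use j T f g0 in \<open>simp add: s2_def less_Suc_eq; blast\<close>)
        then have "?Q (s2 0) (t2 - 1)" using v that j by (simp add: s2_def)
        moreover have "runs W (s2 0) 1 (s2 0)" unfolding W_def
          by (rule runs.While_False) (simp_all add: s2_def)
        ultimately show ?thesis unfolding wp_def by (metis of_nat_1)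
      qed
      have loop: "wp W ?Q (s2 1) t2" if go: "go" and t2: "t2 \<ge> t - 10" for t2
      proof -
        have act: "i \<in> act x" using go k by (simp add: go_def act_def r_def)
        have shi: "\<gamma> i + lam * r = sh i x" by (simp add: sh_def r_def)
        have "wp W (\<lambda>s' t'. \<exists>j' tn' td'.
          s' (Var 20) = real j' \<and> 1 \<le> j' \<and> j' \<le> j \<and> s' (Var 21) = tn' \<and> s' (Var 22) = td' \<and> 0 \<le> td' \<and> valid x tn' td' \<and>
          (s' (Var 6) = s (Var 6) \<or> s' (Var 6) = 1 \<and> (\<forall>u t. \<not> feas x u t)) \<and>
          (s' (Var 6) = 0 \<longrightarrow> (0 < td' \<or> td' = 0 \<and> tn' = 1) \<and> top_line M C l j' tn' td' \<and> keeps_bounds tn td tn' td' \<and>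
            (be i + al i * M (j' - 1)) * tn' \<le> (sh i x + al i * C (j' - 1)) * td') \<and>
          t' \<ge> t2 - (12 * (real j - real j') + 12)) (s2 1) t2"
          unfolding W_def
        proof (rule query_loop)
          show "(be i + al i * M k) * t \<le> sh i x + al i * C k" if "k < l" "feas x u t" for k u t
          proof (cases "l0 = 0")
            case True
            then have "al i = 0" using go by (auto simp: go_def)
            then show ?thesis using that act by (auto simp: feas_def)
          next
            case False
            then have "(M k, C k) \<in> line x ` {i \<in> act x. al i < 0}"
              using l0(2) l(4) that by (auto simp: envelope_def lines_def)
            then obtain i' where i': "i' \<in> act x" "al i' < 0" "M k = slope i'" "C k = snd (line x i')"
              by (auto simp: line_def)
            have "al i * (M k * t - C k) \<le> al i * u"
              using line_below[OF that(2) i'(1,2)] i' go by (intro mult_left_mono) (auto simp: go_def)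
            moreover have "al i * u + be i * t \<le> sh i x" using that act by (auto simp: feas_def)
            ultimately show ?thesis by (simp add: algebra_simps)
          qed
          show "s (Var 6) = 0 \<Longrightarrow> (0 < td \<or> td = 0 \<and> tn = 1) \<and> top_line M C l j tn td"
            using g0 by blast
        qed (use s vals v j T l lt in \<open>simp_all add: s2_def shi\<close>)
        then show ?thesis
        proof (rule wp_conseq_frame)
          fix s' t'
          assume "\<exists>j' tn' td'.
          s' (Var 20) = real j' \<and> 1 \<le> j' \<and> j' \<le> j \<and> s' (Var 21) = tn' \<and> s' (Var 22) = td' \<and> 0 \<le> td' \<and> valid x tn' td' \<and>
          (s' (Var 6) = s (Var 6) \<or> s' (Var 6) = 1 \<and> (\<forall>u t. \<not> feas x u t)) \<and>
          (s' (Var 6) = 0 \<longrightarrow> (0 < td' \<or> td' = 0 \<and> tn' = 1) \<and> top_line M C l j' tn' td' \<and> keeps_bounds tn td tn' td' \<and>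
            (be i + al i * M (j' - 1)) * tn' \<le> (sh i x + al i * C (j' - 1)) * td') \<and>
          t' \<ge> t2 - (12 * (real j - real j') + 12)"
            and fr': "\<And>l. \<not> touches W l \<Longrightarrow> s' l = s2 1 l"
          then obtain j' tn' td' where j': "s' (Var 20) = real j'" "1 \<le> j'" "j' \<le> j"
            and T': "s' (Var 21) = tn'" "s' (Var 22) = td'" "0 \<le> td'" "valid x tn' td'"
            and f': "s' (Var 6) = s (Var 6) \<or> s' (Var 6) = 1 \<and> (\<forall>u t. \<not> feas x u t)"
            and g': "s' (Var 6) = 0 \<Longrightarrow> (0 < td' \<or> td' = 0 \<and> tn' = 1) \<and> top_line M C l j' tn' td' \<and> keeps_bounds tn td tn' td' \<and>
            (be i + al i * M (j' - 1)) * tn' \<le> (sh i x + al i * C (j' - 1)) * td'"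
            and t': "t' \<ge> t2 - (12 * (real j - real j') + 12)" by blast
          have v': "s' (Var 4) = real i" using fr' v by (simp add: W_def query_iter_def s2_def)
          \<comment> \<open>Testing one line is enough: at the current point the active line is the
            highest on the stack, hence at least as high as every line of x, and its weight
            \<open>al i\<close> is nonnegative.\<close>
          have ex: "exact x i tn' td'" if 6: "s' (Var 6) = 0"
            unfolding exact_def
          proof (intro conjI ballI impI)
            fix i' assume i': "i' \<in> act x" "al i' < 0"
            then have "l0 = l" using blue_empty l(4) by blast
            then have "below (lines l M C) tn' td' (M (j' - 1) * tn' - C (j' - 1) * td')"
              using g'[OF 6] by (auto simp: top_line_def below_def lines_def)
            then have "below (line x ` {i \<in> act x. al i < 0}) tn' td' (M (j' - 1) * tn' - C (j' - 1) * td')"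
              using l0(2) T'(3) \<open>l0 = l\<close> by (simp add: envelope_def)
            then have "slope i' * tn' - snd (line x i') * td' \<le> M (j' - 1) * tn' - C (j' - 1) * td'"
              using i' by (auto simp: below_def line_def)
            then have "al i * (slope i' * tn' - snd (line x i') * td') \<le> al i * (M (j' - 1) * tn' - C (j' - 1) * td')"
              using go by (intro mult_left_mono) (auto simp: go_def)
            then show "(be i + al i * slope i') * tn' \<le> (sh i x + al i * snd (line x i')) * td'"
              using g'[OF 6] by (simp add: algebra_simps)
          next
            assume "al i = 0" "0 < be i"
            then show "be i * tn' \<le> sh i x * td'" using g'[OF 6] by simp
          qed
          have "s' (Var 6) = 0 \<Longrightarrow> s (Var 6) = 0" using f' by auto
          then have old: "\<forall>i'<i. i' \<in> act x \<longrightarrow> 0 \<le> al i' \<longrightarrow> exact x i' tn' td'" if "s' (Var 6) = 0"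
            using g0 g' that exact_keeps by blast
          have "J (Suc i) s'" unfolding J_def
          proof (rule exI[of _ j'], rule exI[of _ tn'], rule exI[of _ td'], intro conjI)
            show "s' (Var 6) = 0 \<longrightarrow> (0 < td' \<or> td' = 0 \<and> tn' = 1) \<and> top_line M C l j' tn' td' \<and>
              (\<forall>i'<Suc i. i' \<in> act x \<longrightarrow> 0 \<le> al i' \<longrightarrow> exact x i' tn' td')"
              using g' ex old by (auto simp: less_Suc_eq)
            show "s' (Var 6) = fl \<or> s' (Var 6) = 1 \<and> (\<forall>u t. \<not> feas x u t)" using f f' by auto
          qed (use j j' T' in auto)
          then show "?Q s' t'" using v' t' t2 j j' by simp
        qed
      qed
      define Q' where "Q' = ?Q"
      have SS: "s2 g = s(Var 14 := r, Var 17 := g, Var 23 := \<gamma> i + lam * r)" for g by (simp add: s2_def)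
      have stop': "wp W Q' (s(Var 14 := r, Var 17 := 0, Var 23 := \<gamma> i + lam * r)) t2" if "\<not> go" "t2 \<ge> t - 20" for t2
        using stop that unfolding Q'_def SS .
      have loop': "wp W Q' (s(Var 14 := r, Var 17 := 1, Var 23 := \<gamma> i + lam * r)) t2" if "go" "t2 \<ge> t - 10" for t2
        using loop that unfolding Q'_def SS .
      have lam2: "safe s' (I (Num 2))" "aval s' (I (Num 2)) = s' (Inp 2)" for s' using lt by simp_all
      show ?thesis unfolding query_body_def W_def[symmetric] Q'_def[symmetric]
        by (intro wp_Seq wp_SetV wp_If wp_Skip)
          (use lam2 d v lt vals s stop' loop' in \<open>simp_all add: Arr_arr go_def del: aval.simps(3) safe.simps(3)\<close>)
    qed
  qed (simp_all add: J_def)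
  then show ?thesis
  proof (rule wp_conseq)
    fix s' t' assume *: "J n s' \<and> s' (Var 4) = real n \<and>
      t' + (- (12 * s' (Var 20))) \<ge> t + (- (12 * s0 (Var 20))) - (real n * (22 + 2) + 2)"
    then obtain j tn td where j: "s' (Var 20) = real j" "1 \<le> j"
      and T: "s' (Var 21) = tn" "s' (Var 22) = td" "0 \<le> td" "valid x tn td"
      and f: "s' (Var 6) = fl \<or> s' (Var 6) = 1 \<and> (\<forall>u t. \<not> feas x u t)"
      and g0: "s' (Var 6) = 0 \<longrightarrow> (0 < td \<or> td = 0 \<and> tn = 1) \<and> top_line M C l j tn td \<and>
        (\<forall>i'<n. i' \<in> act x \<longrightarrow> 0 \<le> al i' \<longrightarrow> exact x i' tn td)"
      unfolding J_def by blast
    have "t' \<ge> t - (24 * real n + 12 * real l + 2)" using * T0 j by simp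
    moreover have "s' (Var 6) = 0 \<longrightarrow> (0 < td \<or> td = 0 \<and> tn = 1) \<and>
        (\<forall>i\<in>act x. 0 \<le> al i \<longrightarrow> exact x i tn td)" using g0 by (simp add: act_def)
    ultimately show "\<exists>tn td. s' (Var 21) = tn \<and> s' (Var 22) = td \<and> 0 \<le> td \<and>
      valid x tn td \<and> (s' (Var 6) = fl \<or> s' (Var 6) = 1 \<and> (\<forall>u t. \<not> feas x u t)) \<and>
      (s' (Var 6) = 0 \<longrightarrow> (0 < td \<or> td = 0 \<and> tn = 1) \<and>
        (\<forall>i\<in>act x. 0 \<le> al i \<longrightarrow> exact x i tn td)) \<and> t' \<ge> t - (24 * real n + 12 * real l + 2)"
      using T f by blast
  qed
qed

end

subsection \<open>Lipschitz extension of the bounds\<close>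

definition ext_inner :: com where
  "ext_inner = CIf Less (Num 0) (A 11 (V 5))
     (SetV 14 (dist_exp (V 1) (V 5)) ;;
      CIf Leq (Num 0) (V 14)
        (SetV 15 (A 10 (V 5) \<oplus> I (Num 2) \<otimes> V 14) ;;
         CIf Leq (V 27) (Num 0) (SetV 26 (V 15) ;; SetV 27 (Num 1))
           (CIf Less (V 15) (V 26) (SetV 26 (V 15)) CSkip))
        CSkip)
     CSkip"

definition ext_body :: "nat \<Rightarrow> com" where
  "ext_body e = SetV 26 (Num 0) ;; SetV 27 (Num 0) ;; CFor 5 (I (Num 1)) ext_inner ;;
     SetA e (V 1) (V 26) ;; SetA (Suc e) (V 1) (V 27)"

definition dir_prog :: "nat \<Rightarrow> nat \<Rightarrow> nat \<Rightarrow> com" where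
  "dir_prog a b e = sort_prog a b ;; CFor 1 (I (Num 1)) (point_prog a b) ;;
     CFor 1 (I (Num 1)) (ext_body e)"

context direction
begin

text \<open>The counterpart of \<open>exact\<close> for a real number with a finiteness flag
  \<open>e\<close>: as soon as some pair gives a bound, the flag must be 1.\<close>

definition pair_ok :: "nat \<Rightarrow> real \<Rightarrow> real \<Rightarrow> bool" where
  "pair_ok x e T \<longleftrightarrow> (\<forall>i\<in>act x. 0 \<le> al i \<longrightarrow>
     (\<forall>j\<in>act x. al j < 0 \<longrightarrow> 0 < be i + al i * slope j \<longrightarrow>
        e = 1 \<and> (be i + al i * slope j) * T \<le> sh i x + al i * snd (line x j)) \<and>
     (al i = 0 \<longrightarrow> 0 < be i \<longrightarrow> e = 1 \<and> be i * T \<le> sh i x))"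

text \<open>A finite bound is valid in any case; that it obeys all pairs is claimed only as long as
  no contradiction has been found.\<close>

definition point_ok :: "bool \<Rightarrow> nat \<Rightarrow> real \<Rightarrow> real \<Rightarrow> bool" where
  "point_ok ok x e T \<longleftrightarrow> (e = 0 \<or> e = 1) \<and> (e = 1 \<longrightarrow> (\<forall>u t. feas x u t \<longrightarrow> t \<le> T)) \<and>
     (ok \<longrightarrow> pair_ok x e T)"

lemma exact_pair_ok:
  assumes "0 < td \<or> td = 0 \<and> tn = 1" "\<forall>i\<in>act x. 0 \<le> al i \<longrightarrow> exact x i tn td"
  shows "pair_ok x (if 0 < td then 1 else 0) (tn / td)"
proof -
  \<comment> \<open>A bound with \<open>0 < A\<close> fails at (1, 0), so its validity there forces
    a finite point.\<close>
  have *: "0 < td \<and> A * (tn / td) \<le> B" if "0 < A" "A * tn \<le> B * td" for A B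
  proof -
    have "0 < td" using assms(1) that by auto
    then show ?thesis using that by (simp add: pos_divide_le_eq)
  qed
  show ?thesis unfolding pair_ok_def
  proof (intro ballI impI conjI)
    fix i j assume i: "i \<in> act x" "0 \<le> al i" "j \<in> act x" "al j < 0" "0 < be i + al i * slope j"
    then have "0 < td \<and> (be i + al i * slope j) * (tn / td) \<le> sh i x + al i * snd (line x j)"
      using assms(2) by (intro *) (auto simp: exact_def)
    then show "(if 0 < td then 1 else 0) = (1::real)"
      "(be i + al i * slope j) * (tn / td) \<le> sh i x + al i * snd (line x j)" by auto
  next
    fix i assume i: "i \<in> act x" "0 \<le> al i" "al i = 0" "0 < be i"
    then have "0 < td \<and> be i * (tn / td) \<le> sh i x"
      using assms(2) by (intro *) (auto simp: exact_def)
    then show "(if 0 < td then 1 else 0) = (1::real)" "be i * (tn / td) \<le> sh i x" by auto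
  qed
qed

lemma stack_prog_touches: "touches (stack_prog a) l \<longleftrightarrow>
    l = Var 2 \<or> touches (stack_body a) l"
  by (auto simp: stack_prog_def stack_body_touches)

lemma point_prog_touches: "touches (point_prog a b) l \<longleftrightarrow>
    l \<in> {Var 2, Var 4, Var 6, Var 13, Var 14, Var 15, Var 16, Var 17, Var 18, Var 19, Var 20,
      Var 21, Var 22, Var 23, Var 24, Var 25} \<or> (\<exists>k\<in>{8, 9, 10, 11}. \<exists>j. l = Arr k j)"
  unfolding point_prog_def
  by (auto simp: stack_prog_touches stack_body_touches query_body_touches)

lemma point_prog_spec:
  assumes inp: "inputs s0" and srt: "sorted_state m s0" and x: "s0 (Var 1) = real x" "x < N"
    and fl: "s0 (Var 6) = fl"
  shows "wp (point_prog a b) (\<lambda>s t'. (\<exists>e T. arr s 11 = (arr s0 11)(x := e) \<and>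
      (\<forall>y. y \<noteq> x \<longrightarrow> arr s 10 y = arr s0 10 y) \<and> arr s 10 x = T \<and>
      point_ok (s (Var 6) = 0) x e T) \<and>
      (s (Var 6) = fl \<or> s (Var 6) = 1 \<and> (\<forall>u t. \<not> feas x u t)) \<and>
      t' \<ge> t - (65 * real n + 30)) s0 t"
    (is "wp _ ?Q _ _")
proof -
  define F where "F = CFor 4 (V 3) (query_body a b)"
  define st where "st = CIf Less (Num 0) (V 22) (SetA 10 (V 1) (V 21 \<oslash> V 22) ;; SetA 11 (V 1) (Num 1))
       (SetA 11 (V 1) (Num 0))"
  define pre where "pre = CIf Leq (V 13) (Num 0) (SetA 8 (Num 0) (Num 0) ;; SetA 9 (Num 0) (Num 0) ;; SetV 20 (Num 1))
       (SetV 20 (V 13))"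
  define FS where "FS = (F ;; st)"
  have xcp: "x < cp" using x cp by simp
  have "wp (stack_prog a) (wp (pre ;; SetV 21 (Num 1) ;; SetV 22 (Num 0) ;; F ;; st) ?Q) s0 t"
  proof (rule wp_conseq_frame[OF stack_prog_spec[OF inp srt x]])
    fix s t1
    assume "(\<exists>l\<le>n. s (Var 13) = real l \<and> cvx_chain l (arr s 8) (arr s 9) \<and>
      envelope (lines l (arr s 8) (arr s 9)) (line x ` {i \<in> act x. al i < 0})) \<and>
      t1 \<ge> t - (29 * real n + 3)"
      and fr: "\<And>l. \<not> touches (stack_prog a) l \<Longrightarrow> s l = s0 l"
    then obtain l where l: "l \<le> n" "s (Var 13) = real l" "cvx_chain l (arr s 8) (arr s 9)"
      "envelope (lines l (arr s 8) (arr s 9)) (line x ` {i \<in> act x. al i < 0})"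
      and t1: "t1 \<ge> t - (29 * real n + 3)" by blast
    have inps: "inputs s" by (rule inputs_frame[OF inp]) (auto intro!: fr simp: stack_prog_touches stack_body_touches)
    have v: "s (Var 1) = real x" "s (Var 6) = fl" "arr s 10 = arr s0 10" "arr s 11 = arr s0 11"
      using fr x fl by (auto simp: stack_prog_touches stack_body_touches arr_def)
    have query: "wp (F ;; st) ?Q s1 t2"
      if s1: "inputs s1" "s1 (Var 1) = real x" "s1 (Var 13) = real l" "cvx_chain l1 (arr s1 8) (arr s1 9)"
        "1 \<le> l1" "l1 \<le> n + 1" "l1 \<le> cp" "l = 0 \<or> l = l1"
        "envelope (lines l (arr s1 8) (arr s1 9)) (line x ` {i \<in> act x. al i < 0})"
        "s1 (Var 20) = real l1" "s1 (Var 21) = 1" "s1 (Var 22) = 0" "s1 (Var 6) = fl"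
        "arr s1 10 = arr s0 10" "arr s1 11 = arr s0 11" and t2: "t2 \<ge> t1 - 6"
      for s1 t2 l1
    proof (rule wp_Seq, unfold F_def, rule wp_conseq_frame[OF query_for[OF s1(1,2) x(2) s1(3,9,4,5,7,8) HOL.refl HOL.refl s1(10-13)]])
      fix s2 t3
      assume "\<exists>tn td. s2 (Var 21) = tn \<and> s2 (Var 22) = td \<and> 0 \<le> td \<and>
        valid x tn td \<and> (s2 (Var 6) = fl \<or> s2 (Var 6) = 1 \<and> (\<forall>u t. \<not> feas x u t)) \<and>
        (s2 (Var 6) = 0 \<longrightarrow> (0 < td \<or> td = 0 \<and> tn = 1) \<and>
        (\<forall>i\<in>act x. 0 \<le> al i \<longrightarrow> exact x i tn td)) \<and> t3 \<ge> t2 - (24 * real n + 12 * real l1 + 2)"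
        and fr2: "\<And>l. \<not> touches (CFor 4 (V 3) (query_body a b)) l \<Longrightarrow> s2 l = s1 l"
      then obtain tn td where T: "s2 (Var 21) = tn" "s2 (Var 22) = td" "0 \<le> td" "valid x tn td"
        and f: "s2 (Var 6) = fl \<or> s2 (Var 6) = 1 \<and> (\<forall>u t. \<not> feas x u t)"
        and ex: "s2 (Var 6) = 0 \<longrightarrow> (0 < td \<or> td = 0 \<and> tn = 1) \<and>
        (\<forall>i\<in>act x. 0 \<le> al i \<longrightarrow> exact x i tn td)" and t3: "t3 \<ge> t2 - (24 * real n + 12 * real l1 + 2)"
        by blast
      have v2: "s2 (Var 1) = real x" "arr s2 10 = arr s0 10" "arr s2 11 = arr s0 11"
        using fr2 s1 by (auto simp: query_body_touches arr_def)
      \<comment> \<open>29 per constraint for the stack, 24 for the queries and 12 for the descent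
        of the active line make 65. The height is at most n + 1 because of the line put on an empty
        stack.\<close>
      have t4: "t3 - 3 \<ge> t - (65 * real n + 30)" using t1 t2 t3 s1(6) by (simp add: algebra_simps)
      have po: "s2 (Var 6) = 0 \<longrightarrow> pair_ok x (if 0 < td then 1 else 0) (tn / td)"
        using ex exact_pair_ok by blast
      have up: "t \<le> tn / td" if "0 < td" "feas x u t" for u t
        using T(4) that unfolding valid_def by (simp add: pos_le_divide_eq)
      show "wp st ?Q s2 t3"
      proof (cases "0 < td")
        case True
        define s3 where "s3 = s2(Arr 10 x := tn / td, Arr 11 x := 1)"
        have "point_ok (s3 (Var 6) = 0) x 1 (tn / td)"
          using po up True by (auto simp: point_ok_def s3_def)
        then have "\<exists>e T. arr s3 11 = (arr s0 11)(x := e) \<and>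
          (\<forall>y. y \<noteq> x \<longrightarrow> arr s3 10 y = arr s0 10 y) \<and> arr s3 10 x = T \<and> point_ok (s3 (Var 6) = 0) x e T"
          by (rule_tac exI[of _ 1], rule_tac exI[of _ "tn / td"]) (use v2 in \<open>simp add: s3_def\<close>)
        then have "?Q s3 (t3 - 3)" using f t4 by (auto simp: s3_def)
        then show ?thesis unfolding st_def
          by (intro wp_If wp_Seq wp_SetA) (use True T v2 xcp in \<open>simp_all add: s3_def\<close>)
      next
        case False
        define s3 where "s3 = s2(Arr 11 x := 0)"
        have *: "tn / td = 0" using False T by simp
        have "pair_ok x 0 (tn / td)" if "s2 (Var 6) = 0" using po False that by simp
        \<comment> \<open>With flag 0, \<open>pair_ok\<close> says that no pair gives a bound; it
          then holds for whatever number the cell contains.\<close>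
        then have "pair_ok x 0 T" if "s2 (Var 6) = 0" for T using that by (auto simp: pair_ok_def)
        then have "point_ok (s3 (Var 6) = 0) x 0 (arr s3 10 x)"
          by (auto simp: point_ok_def s3_def)
        then have "\<exists>e T. arr s3 11 = (arr s0 11)(x := e) \<and>
          (\<forall>y. y \<noteq> x \<longrightarrow> arr s3 10 y = arr s0 10 y) \<and> arr s3 10 x = T \<and> point_ok (s3 (Var 6) = 0) x e T"
          by (rule_tac exI[of _ 0], rule_tac exI[of _ "arr s3 10 x"]) (use v2 in \<open>simp add: s3_def\<close>)
        then have "?Q s3 (t3 - 2)" using f t4 by (auto simp: s3_def)
        then show ?thesis unfolding st_def
          by (intro wp_If wp_Seq wp_SetA) (use False T v2 xcp in \<open>simp_all add: s3_def\<close>)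
      qed
    qed
    show "wp (pre ;; SetV 21 (Num 1) ;; SetV 22 (Num 0) ;; F ;; st) ?Q s t1"
    proof (cases "l = 0")
      case True
      define s1 where "s1 = s(Arr 8 0 := 0, Arr 9 0 := 0, Var 20 := 1, Var 21 := 1, Var 22 := 0)"
      have "wp (F ;; st) ?Q s1 (t1 - 6)"
      proof (rule query[where ?l1.0 = 1])
        show "inputs s1" using inps by (simp add: s1_def)
        show "envelope (lines l (arr s1 8) (arr s1 9)) (line x ` {i \<in> act x. al i < 0})"
          using l(4) True by (simp add: lines_def)
      qed (use v l True cp in \<open>simp_all add: s1_def cvx_chain_def\<close>)
      then show ?thesis unfolding pre_def FS_def[symmetric]
        by (intro wp_If wp_Seq wp_SetA wp_SetV) (use True l cp in \<open>simp_all add: s1_def\<close>)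
    next
      case False
      define s1 where "s1 = s(Var 20 := real l, Var 21 := 1, Var 22 := 0)"
      have "wp (F ;; st) ?Q s1 (t1 - 4)"
      proof (rule query[where ?l1.0 = l])
        show "inputs s1" using inps by (simp add: s1_def)
      qed (use v l False cp in \<open>simp_all add: s1_def\<close>)
      then show ?thesis unfolding pre_def FS_def[symmetric]
        by (intro wp_If wp_Seq wp_SetA wp_SetV) (use False l cp in \<open>simp_all add: s1_def\<close>)
    qed
  qed
  then show ?thesis unfolding point_prog_def F_def[symmetric] st_def[symmetric] pre_def[symmetric]
    by (intro wp_Seq) (auto intro: wp_conseq)
qed

definition infeasible :: bool where "infeasible \<longleftrightarrow> (\<exists>x<N. \<forall>u t. \<not> feas x u t)"

lemma points_spec:
  assumes inp: "inputs s0" and srt: "sorted_state m s0" and fl: "s0 (Var 6) = fl"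
  shows "wp (CFor 1 (I (Num 1)) (point_prog a b)) (\<lambda>s t'.
      (\<forall>x<N. point_ok (s (Var 6) = 0) x (arr s 11 x) (arr s 10 x)) \<and>
      (s (Var 6) = fl \<or> s (Var 6) = 1 \<and> infeasible) \<and>
      t' \<ge> t - (real N * (65 * real n + 32) + 2)) s0 t"
proof -
  define J where "J = (\<lambda>k s. (\<forall>x<k. point_ok (s (Var 6) = 0) x (arr s 11 x) (arr s 10 x)) \<and>
      (s (Var 6) = fl \<or> s (Var 6) = 1 \<and> infeasible))"
  have "wp (CFor 1 (I (Num 1)) (point_prog a b)) (\<lambda>s' t'. J N s' \<and> s' (Var 1) = real N \<and>
      t' + 0 \<ge> t + 0 - (real N * (65 * real n + 30 + 2) + 2)) s0 t"
  proof (rule wp_For[where \<phi> = "\<lambda>_. 0"])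
    show "J 0 s0" using fl by (simp add: J_def)
  next
    fix k s
    assume "\<And>l. l \<noteq> Var 1 \<Longrightarrow> \<not> touches (point_prog a b) l \<Longrightarrow> s l = s0 l"
    from this[of "Inp 1"] show "safe s (I (Num 1)) \<and> aval s (I (Num 1)) = real N"
      using inp il by (simp add: point_prog_touches inputs_def)
  next
    fix x s t assume k: "x < N" and J: "J x s" and v: "s (Var 1) = real x"
      and fr: "\<And>l. l \<noteq> Var 1 \<Longrightarrow> \<not> touches (point_prog a b) l \<Longrightarrow> s l = s0 l"
    have inps: "inputs s" by (rule inputs_frame[OF inp]) (auto intro!: fr simp: point_prog_touches)
    have ss: "sorted_state m s"
      by (rule sorted_state_frame[OF srt]) (auto intro!: fr simp: point_prog_touches)
    show "wp (point_prog a b) (\<lambda>s' t'. s' (Var 1) = real x \<and> J (Suc x) s' \<and>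
       t' + 0 \<ge> t + 0 - (65 * real n + 30)) s t"
    proof (rule wp_conseq_frame[OF point_prog_spec[OF inps ss v k HOL.refl]])
      fix s' t'
      assume *: "(\<exists>e T. arr s' 11 = (arr s 11)(x := e) \<and>
        (\<forall>y. y \<noteq> x \<longrightarrow> arr s' 10 y = arr s 10 y) \<and> arr s' 10 x = T \<and>
        point_ok (s' (Var 6) = 0) x e T) \<and>
        (s' (Var 6) = s (Var 6) \<or> s' (Var 6) = 1 \<and> (\<forall>u t. \<not> feas x u t)) \<and>
        t' \<ge> t - (65 * real n + 30)"
        and fr': "\<And>l. \<not> touches (point_prog a b) l \<Longrightarrow> s' l = s l"
      have "s' (Var 1) = real x" using fr' v by (simp add: point_prog_touches)
      moreover have "J (Suc x) s'" unfolding J_def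
      proof (intro conjI allI impI)
        show "s' (Var 6) = fl \<or> s' (Var 6) = 1 \<and> infeasible"
          using * J k unfolding J_def infeasible_def by auto
        fix y assume y: "y < Suc x"
        have 6: "s' (Var 6) = 0 \<longrightarrow> s (Var 6) = 0" using * by auto
        show "point_ok (s' (Var 6) = 0) y (arr s' 11 y) (arr s' 10 y)"
        proof (cases "y = x")
          case True
          then show ?thesis using * by auto
        next
          case False
          then have "point_ok (s (Var 6) = 0) y (arr s' 11 y) (arr s' 10 y)"
            using * J y unfolding J_def by auto
          then show ?thesis using 6 by (auto simp: point_ok_def)
        qed
      qed
      ultimately show "s' (Var 1) = real x \<and> J (Suc x) s' \<and> t' + 0 \<ge> t + 0 - (65 * real n + 30)"
        using * by simp
    qed
  qed (simp_all add: J_def)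
  then show ?thesis by (rule wp_conseq) (simp add: J_def algebra_simps)
qed

text \<open>A running minimum, empty while the flag is 0. Attainment is part of it because the
  extended bound inherits its validity from the point where the minimum is attained.\<close>

definition ext_val :: "(nat \<Rightarrow> real) \<Rightarrow> (nat \<Rightarrow> real) \<Rightarrow> nat \<Rightarrow> nat \<Rightarrow> real \<Rightarrow> real \<Rightarrow> bool" where
  "ext_val F T x k e v \<longleftrightarrow> e = 0 \<and> (\<forall>y<k. \<not> (F y = 1 \<and> 0 \<le> \<rho> x y)) \<or>
     e = 1 \<and> (\<forall>y<k. F y = 1 \<and> 0 \<le> \<rho> x y \<longrightarrow> v \<le> T y + lam * \<rho> x y) \<and>
       (\<exists>y<k. F y = 1 \<and> 0 \<le> \<rho> x y \<and> v = T y + lam * \<rho> x y)"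

lemma ext_inner_touches: "touches ext_inner l \<longleftrightarrow> l \<in> {Var 14, Var 15, Var 26, Var 27}"
  by (auto simp: ext_inner_def)

lemma ext_for:
  assumes inp: "inputs s0" and x: "s0 (Var 1) = real x" "x < N"
    and F: "\<forall>y<N. arr s0 11 y = 0 \<or> arr s0 11 y = 1" and e0: "s0 (Var 27) = 0"
  shows "wp (CFor 5 (I (Num 1)) ext_inner) (\<lambda>s t'. ext_val (arr s0 11) (arr s0 10) x N (s (Var 27)) (s (Var 26)) \<and>
      t' \<ge> t - (real N * 9 + 2)) s0 t"
proof -
  define J where "J = (\<lambda>k s. ext_val (arr s0 11) (arr s0 10) x k (s (Var 27)) (s (Var 26)))"
  have "wp (CFor 5 (I (Num 1)) ext_inner) (\<lambda>s' t'. J N s' \<and> s' (Var 5) = real N \<and>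
      t' + 0 \<ge> t + 0 - (real N * (7 + 2) + 2)) s0 t"
  proof (rule wp_For[where \<phi> = "\<lambda>_. 0"])
    show "J 0 s0" using e0 by (simp add: J_def ext_val_def)
  next
    fix k s
    assume "\<And>l. l \<noteq> Var 5 \<Longrightarrow> \<not> touches ext_inner l \<Longrightarrow> s l = s0 l"
    from this[of "Inp 1"] show "safe s (I (Num 1)) \<and> aval s (I (Num 1)) = real N"
      using inp il by (simp add: ext_inner_touches inputs_def)
  next
    fix y s and t :: real assume k: "y < N" and J: "J y s" and v: "s (Var 5) = real y"
      and fr: "\<And>l. l \<noteq> Var 5 \<Longrightarrow> \<not> touches ext_inner l \<Longrightarrow> s l = s0 l"
    have inps: "inputs s" by (rule inputs_frame[OF inp]) (auto intro!: fr simp: ext_inner_touches)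
    have s: "s (Var 1) = real x" "arr s 10 = arr s0 10" "arr s 11 = arr s0 11" "s (Inp 2) = lam"
      using fr x inps by (auto simp: ext_inner_touches arr_def inputs_def)
    have lt: "y < cp" "2 < il" using k cp il by auto
    have d: "aval s (dist_exp (V 1) (V 5)) = \<rho> x y" "safe s (dist_exp (V 1) (V 5))"
      by (rule dist_val; use inps v s x k in simp)+
    have lam2: "safe s' (I (Num 2))" "aval s' (I (Num 2)) = s' (Inp 2)" for s' using lt by simp_all
    define w where "w = arr s0 10 y + lam * \<rho> x y"
    define Q where "Q = (\<lambda>s' t'::real. s' (Var 5) = real y \<and> J (Suc y) s' \<and> t' + 0 \<ge> t + 0 - 7)"
    have J': "ext_val (arr s0 11) (arr s0 10) x y (s (Var 27)) (s (Var 26))" using J by (simp add: J_def)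
    have skip: "ext_val (arr s0 11) (arr s0 10) x (Suc y) (s (Var 27)) (s (Var 26))"
      if "arr s0 11 y \<noteq> 1 \<or> \<not> 0 \<le> \<rho> x y \<or> s (Var 27) = 1 \<and> s (Var 26) \<le> w"
      using J' that unfolding ext_val_def w_def by (auto simp: less_Suc_eq)
    have new: "ext_val (arr s0 11) (arr s0 10) x (Suc y) 1 w"
      if "arr s0 11 y = 1 \<and> 0 \<le> \<rho> x y" "s (Var 27) = 0 \<or> w \<le> s (Var 26)"
      using J' that unfolding ext_val_def w_def
      by (auto simp: less_Suc_eq intro: order.trans)
    have e: "s (Var 27) = 0 \<or> s (Var 27) = 1" using J' by (auto simp: ext_val_def)
    have "wp ext_inner Q s t"
    proof (cases "arr s0 11 y = 1")
      case False
      then have z: "arr s0 11 y = 0" using F k by auto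
      have "Q s (t - 1)" using skip False v by (auto simp: Q_def J_def)
      then show ?thesis unfolding ext_inner_def
        by (intro wp_If wp_Skip) (use z v s lt in \<open>simp_all add: Arr_arr\<close>)
    next
      case one: True
      show ?thesis
      proof (cases "0 \<le> \<rho> x y")
        case False
        have "Q (s(Var 14 := \<rho> x y)) (t - 3)" using skip False v by (auto simp: Q_def J_def)
        then show ?thesis unfolding ext_inner_def
          by (intro wp_If wp_Seq wp_SetV wp_Skip)
            (use one False v s lt d lam2 in \<open>simp_all add: Arr_arr del: aval.simps(3) safe.simps(3)\<close>)
      next
        case True
        define s2 where "s2 = s(Var 14 := \<rho> x y, Var 15 := w)"
        have "wp (CIf Leq (V 27) (Num 0) (SetV 26 (V 15) ;; SetV 27 (Num 1))
           (CIf Less (V 15) (V 26) (SetV 26 (V 15)) CSkip)) Q s2 (t - 4)"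
        proof (cases "s (Var 27) = 0")
          case z: True
          have "Q (s2(Var 26 := w, Var 27 := 1)) (t - 7)"
            using new one True z v by (auto simp: Q_def J_def s2_def)
          then show ?thesis by (intro wp_If wp_Seq wp_SetV) (use z in \<open>simp_all add: s2_def\<close>)
        next
          case False
          then have e1: "s (Var 27) = 1" using e by auto
          show ?thesis
          proof (cases "w < s (Var 26)")
            case lt: True
            have "Q (s2(Var 26 := w)) (t - 7)"
              using new one True lt e1 v by (auto simp: Q_def J_def s2_def)
            then show ?thesis by (intro wp_If wp_Seq wp_SetV) (use lt e1 in \<open>simp_all add: s2_def\<close>)
          next
            case ge: False
            have "Q s2 (t - 6)" using skip ge e1 v by (auto simp: Q_def J_def s2_def)
            then show ?thesis by (intro wp_If wp_Skip) (use ge e1 in \<open>simp_all add: s2_def\<close>)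
          qed
        qed
        moreover define D where "D = CIf Leq (V 27) (Num 0) (SetV 26 (V 15) ;; SetV 27 (Num 1))
           (CIf Less (V 15) (V 26) (SetV 26 (V 15)) CSkip)"
        ultimately have "wp D Q s2 (t - 4)" by simp
        then show ?thesis unfolding ext_inner_def D_def[symmetric]
          by (intro wp_If wp_Seq wp_SetV)
            (use one True v s lt d lam2 in \<open>simp_all add: Arr_arr s2_def w_def del: aval.simps(3) safe.simps(3)\<close>)
      qed
    qed
    then show "wp ext_inner (\<lambda>s' t'. s' (Var 5) = real y \<and> J (Suc y) s' \<and> t' + 0 \<ge> t + 0 - 7) s t"
      by (simp add: Q_def)
  qed (simp_all add: J_def)
  then show ?thesis by (rule wp_conseq) (simp add: J_def)
qed

end

context direction
begin

text \<open>Validity is claimed for Lipschitz selections and not for single feasible points, since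
  the extension draws on bounds at other points. The clause on distances also makes the flag
  constant on each class of points at finite mutual distance.\<close>

definition dir_ok :: "bool \<Rightarrow> (nat \<Rightarrow> real) \<Rightarrow> (nat \<Rightarrow> real) \<Rightarrow> bool" where
  "dir_ok ok e v \<longleftrightarrow> (\<forall>x<N. e x = 0 \<or> e x = 1) \<and>
     (\<forall>h1 h2. (\<forall>x<N. feas x (h1 x) (h2 x)) \<longrightarrow>
        (\<forall>x<N. \<forall>y<N. 0 \<le> \<rho> x y \<longrightarrow> \<bar>h2 x - h2 y\<bar> \<le> lam * \<rho> x y) \<longrightarrow>
        (\<forall>x<N. e x = 1 \<longrightarrow> h2 x \<le> v x)) \<and>
     (\<forall>x<N. \<forall>y<N. 0 \<le> \<rho> x y \<longrightarrow> e x = 1 \<longrightarrow> e y = 1 \<and> v y \<le> v x + lam * \<rho> x y) \<and>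
     (ok \<longrightarrow> (\<forall>x<N. pair_ok x (e x) (v x)))"

lemma ext_val_witness:
  "ext_val F T x N e v \<Longrightarrow> e = 1 \<Longrightarrow> \<exists>y<N. F y = 1 \<and> 0 \<le> \<rho> x y \<and> v = T y + lam * \<rho> x y"
  by (auto simp: ext_val_def)

lemma ext_val_upper:
  "ext_val F T x N e v \<Longrightarrow> y < N \<Longrightarrow> F y = 1 \<Longrightarrow> 0 \<le> \<rho> x y \<Longrightarrow> e = 1 \<and> v \<le> T y + lam * \<rho> x y"
  by (auto simp: ext_val_def)

text \<open>A Lipschitz selection obeys the bound at the minimising y and, by its Lipschitz
  property, the extended bound at x. The triangle inequality makes the extension Lipschitz. Taking y
  = x shows that it is at most \<open>T x\<close>, so the bounds from pairs, whose coefficients are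
  positive, remain true.\<close>

lemma ext_dir_ok:
  assumes P: "\<forall>x<N. point_ok ok x (F x) (T x)" and E: "\<forall>x<N. ext_val F T x N (e x) (v x)"
  shows "dir_ok ok e v"
  unfolding dir_ok_def
proof (intro conjI allI impI)
  show "e x = 0 \<or> e x = 1" if "x < N" for x using E that by (auto simp: ext_val_def)
  show "h2 x \<le> v x"
    if f: "\<forall>x<N. feas x (h1 x) (h2 x)"
      and h: "\<forall>x<N. \<forall>y<N. 0 \<le> \<rho> x y \<longrightarrow> \<bar>h2 x - h2 y\<bar> \<le> lam * \<rho> x y"
      and x: "x < N" "e x = 1" for h1 h2 x
  proof -
    obtain y where y: "y < N" "F y = 1" "0 \<le> \<rho> x y" "v x = T y + lam * \<rho> x y"
      using ext_val_witness E x by blast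
    have "h2 y \<le> T y" using P f y by (auto simp: point_ok_def)
    moreover have "\<bar>h2 x - h2 y\<bar> \<le> lam * \<rho> x y" using h x y by blast
    ultimately show ?thesis using y by linarith
  qed
  have lip: "e y = 1 \<and> v y \<le> v x + lam * \<rho> x y" if xy: "x < N" "y < N" "0 \<le> \<rho> x y" "e x = 1" for x y
  proof -
    obtain w where w: "w < N" "F w = 1" "0 \<le> \<rho> x w" "v x = T w + lam * \<rho> x w"
      using ext_val_witness E xy by blast
    have yx: "\<rho> y x = \<rho> x y" using sym xy by simp
    have t: "0 \<le> \<rho> y w" "\<rho> y w \<le> \<rho> x y + \<rho> x w" using tri[of y x w] xy w yx by auto
    have "e y = 1 \<and> v y \<le> T w + lam * \<rho> y w" using ext_val_upper E xy w t by blast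
    moreover have "lam * \<rho> y w \<le> lam * (\<rho> x y + \<rho> x w)" using t lam by simp
    ultimately show ?thesis using w by (simp add: algebra_simps)
  qed
  then show "e y = 1" "v y \<le> v x + lam * \<rho> x y" if "x < N" "y < N" "0 \<le> \<rho> x y" "e x = 1" for x y
    using that by blast+
  fix x assume ok: ok and x: "x < N"
  have p: "pair_ok x (F x) (T x)" using P ok x by (auto simp: point_ok_def)
  have up: "e x = 1 \<and> v x \<le> T x" if "F x = 1"
    using ext_val_upper[of F T x "e x" "v x" x] E x that refl[OF x] by auto
  have mult: "A * v x \<le> B" if "F x = 1" "A * T x \<le> B" "0 < A" for A B
  proof -
    have "A * v x \<le> A * T x" using up that by (intro mult_left_mono) auto
    then show ?thesis using that by linarith
  qed
  show "pair_ok x (e x) (v x)" unfolding pair_ok_def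
  proof (intro ballI impI conjI)
    fix i j assume ij: "i \<in> act x" "0 \<le> al i" "j \<in> act x" "al j < 0" "0 < be i + al i * slope j"
    then have "F x = 1 \<and> (be i + al i * slope j) * T x \<le> sh i x + al i * snd (line x j)"
      using p unfolding pair_ok_def by blast
    then show "e x = 1" "(be i + al i * slope j) * v x \<le> sh i x + al i * snd (line x j)"
      using up mult ij(5) by auto
  next
    fix i assume i: "i \<in> act x" "0 \<le> al i" "al i = 0" "0 < be i"
    then have "F x = 1 \<and> be i * T x \<le> sh i x" using p unfolding pair_ok_def by blast
    then show "e x = 1" "be i * v x \<le> sh i x" using up mult i(4) by auto
  qed
qed

lemma ext_body_touches: "touches (ext_body e) l \<longleftrightarrow>
    l \<in> {Var 5, Var 14, Var 15, Var 26, Var 27} \<or> (\<exists>j. l = Arr e j \<or> l = Arr (Suc e) j)"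
  by (auto simp: ext_body_def ext_inner_touches)

lemma ext_spec:
  assumes inp: "inputs s0" and F: "\<forall>y<N. arr s0 11 y = 0 \<or> arr s0 11 y = 1" and e: "12 \<le> e" "e < 20"
  shows "wp (CFor 1 (I (Num 1)) (ext_body e)) (\<lambda>s t'.
      (\<forall>x<N. ext_val (arr s0 11) (arr s0 10) x N (arr s (Suc e) x) (arr s e x)) \<and>
      t' \<ge> t - (real N * (9 * real N + 8) + 2)) s0 t"
proof -
  define J where "J = (\<lambda>k s. \<forall>x<k. ext_val (arr s0 11) (arr s0 10) x N (arr s (Suc e) x) (arr s e x))"
  have "wp (CFor 1 (I (Num 1)) (ext_body e)) (\<lambda>s' t'. J N s' \<and> s' (Var 1) = real N \<and>
      t' + 0 \<ge> t + 0 - (real N * (9 * real N + 6 + 2) + 2)) s0 t"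
  proof (rule wp_For[where \<phi> = "\<lambda>_. 0"])
    show "J 0 s0" by (simp add: J_def)
  next
    fix k s
    assume "\<And>l. l \<noteq> Var 1 \<Longrightarrow> \<not> touches (ext_body e) l \<Longrightarrow> s l = s0 l"
    from this[of "Inp 1"] show "safe s (I (Num 1)) \<and> aval s (I (Num 1)) = real N"
      using inp il by (simp add: ext_body_touches inputs_def)
  next
    fix x s t assume k: "x < N" and J: "J x s" and v: "s (Var 1) = real x"
      and fr: "\<And>l. l \<noteq> Var 1 \<Longrightarrow> \<not> touches (ext_body e) l \<Longrightarrow> s l = s0 l"
    define s1 where "s1 = s(Var 26 := 0, Var 27 := 0)"
    have inps: "inputs s" by (rule inputs_frame[OF inp]) (use e in \<open>auto intro!: fr simp: ext_body_touches\<close>)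
    have a: "arr s1 10 = arr s0 10" "arr s1 11 = arr s0 11"
      using fr e by (auto simp: ext_body_touches arr_def s1_def)
    have lt: "x < cp" "Suc e < 32" "e < 32" using k cp e by auto
    define Q where "Q = (\<lambda>s' t'. s' (Var 1) = real x \<and> J (Suc x) s' \<and> t' + 0 \<ge> t + 0 - (9 * real N + 6))"
    have "wp (CFor 5 (I (Num 1)) ext_inner) (wp (SetA e (V 1) (V 26) ;; SetA (Suc e) (V 1) (V 27)) Q) s1 (t - 2)"
    proof (rule wp_conseq_frame[OF ext_for])
      show "inputs s1" using inps by (simp add: s1_def)
      show "s1 (Var 1) = real x" "s1 (Var 27) = 0" using v by (simp_all add: s1_def)
      show "x < N" by fact
      show "\<forall>y<N. arr s1 11 y = 0 \<or> arr s1 11 y = 1" using F a by simp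
      fix s2 t2
      assume *: "ext_val (arr s1 11) (arr s1 10) x N (s2 (Var 27)) (s2 (Var 26)) \<and>
        t2 \<ge> t - 2 - (real N * 9 + 2)"
        and fr2: "\<And>l. \<not> touches (CFor 5 (I (Num 1)) ext_inner) l \<Longrightarrow> s2 l = s1 l"
      have v2: "s2 (Var 1) = real x" "arr s2 e = arr s e" "arr s2 (Suc e) = arr s (Suc e)"
        using fr2 v by (auto simp: ext_inner_touches s1_def arr_def)
      define s3 where "s3 = s2(Arr e x := s2 (Var 26), Arr (Suc e) x := s2 (Var 27))"
      have "J (Suc x) s3" using J * v2 a unfolding J_def s3_def by (auto simp: less_Suc_eq)
      then have "Q s3 (t2 - 2)" using v2 * by (simp add: Q_def s3_def)
      then show "wp (SetA e (V 1) (V 26) ;; SetA (Suc e) (V 1) (V 27)) Q s2 t2"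
        by (intro wp_Seq wp_SetA) (use v2 lt in \<open>simp_all add: s3_def\<close>)
    qed
    moreover define D where "D = CFor 5 (I (Num 1)) ext_inner"
    ultimately have "wp D (wp (SetA e (V 1) (V 26) ;; SetA (Suc e) (V 1) (V 27)) Q) s1 (t - 2)" by simp
    then have "wp (ext_body e) Q s t"
      unfolding ext_body_def D_def[symmetric]
      by (intro wp_Seq wp_SetV) (auto simp: s1_def intro: wp_Seq elim: wp_conseq)
    then show "wp (ext_body e) (\<lambda>s' t'. s' (Var 1) = real x \<and> J (Suc x) s' \<and>
       t' + 0 \<ge> t + 0 - (9 * real N + 6)) s t" by (simp add: Q_def)
  qed (simp_all add: J_def)
  then show ?thesis by (rule wp_conseq) (simp add: J_def algebra_simps)
qed

definition dir_cost :: real where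
  "dir_cost = real n * (6 * real n + 9) + real N * (65 * real n + 32) + real N * (9 * real N + 8) + 7"

lemma sort_prog_touches: "touches (sort_prog a b) l \<longleftrightarrow>
    l \<in> {Var 2, Var 4, Var 10, Var 11, Var 12} \<or> (\<exists>j. l = Arr 6 j \<or> l = Arr 7 j)"
  by (auto simp: sort_prog_def sort_pass_def)

lemma dir_prog_touches: "touches (dir_prog a b e) l \<Longrightarrow>
    (\<exists>v\<in>{1, 2} \<union> {4..27}. l = Var v) \<or> (\<exists>k\<in>{6..11} \<union> {e, Suc e}. \<exists>j. l = Arr k j)"
  unfolding dir_prog_def
  by (auto simp: sort_prog_touches point_prog_touches ext_body_touches)

lemma dir_prog_spec:
  assumes inp: "inputs s0" and fl: "s0 (Var 6) = fl" and e: "12 \<le> e" "e < 20"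
  shows "wp (dir_prog a b e) (\<lambda>s t'. dir_ok (s (Var 6) = 0) (arr s (Suc e)) (arr s e) \<and>
      (s (Var 6) = fl \<or> s (Var 6) = 1 \<and> infeasible) \<and> t' \<ge> t - dir_cost) s0 t"
    (is "wp _ ?Q _ _")
proof -
  define P where "P = CFor 1 (I (Num 1)) (point_prog a b)"
  define X where "X = CFor 1 (I (Num 1)) (ext_body e)"
  have "wp (sort_prog a b) (wp P (wp X ?Q)) s0 t"
  proof (rule wp_conseq_frame[OF sort_prog_spec[OF inp]])
    fix s1 t1
    assume *: "(\<exists>m\<le>n. s1 (Var 10) = real m \<and>
      arr s1 6 ` {..<m} = real ` {i. i < n \<and> al i < 0} \<and> sorted_by (arr s1 6) m) \<and>
    (\<forall>i<n. al i < 0 \<longrightarrow> arr s1 7 i = slope i) \<and>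
    t1 \<ge> t - (real n * (6 * real n + 9) + 3)"
      and fr: "\<And>l. \<not> touches (sort_prog a b) l \<Longrightarrow> s1 l = s0 l"
    have inps: "inputs s1" by (rule inputs_frame[OF inp]) (auto intro!: fr simp: sort_prog_touches)
    have fl1: "s1 (Var 6) = fl" using fr fl by (simp add: sort_prog_touches)
    obtain m where m: "sorted_state m s1" using * by (auto simp: sorted_state_def)
    show "wp P (wp X ?Q) s1 t1" unfolding P_def
    proof (rule wp_conseq_frame[OF points_spec[OF inps m fl1]])
      fix s2 t2
      assume **: "(\<forall>x<N. point_ok (s2 (Var 6) = 0) x (arr s2 11 x) (arr s2 10 x)) \<and>
        (s2 (Var 6) = fl \<or> s2 (Var 6) = 1 \<and> infeasible) \<and>
        t2 \<ge> t1 - (real N * (65 * real n + 32) + 2)"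
        and fr2: "\<And>l. \<not> touches (CFor 1 (I (Num 1)) (point_prog a b)) l \<Longrightarrow> s2 l = s1 l"
      have inps2: "inputs s2" by (rule inputs_frame[OF inps]) (auto intro!: fr2 simp: point_prog_touches)
      have F: "\<forall>y<N. arr s2 11 y = 0 \<or> arr s2 11 y = 1" using ** by (auto simp: point_ok_def)
      show "wp X ?Q s2 t2" unfolding X_def
      proof (rule wp_conseq_frame[OF ext_spec[OF inps2 F e]])
        fix s3 t3
        assume ***: "(\<forall>x<N. ext_val (arr s2 11) (arr s2 10) x N (arr s3 (Suc e) x) (arr s3 e x)) \<and>
          t3 \<ge> t2 - (real N * (9 * real N + 8) + 2)"
          and fr3: "\<And>l. \<not> touches (CFor 1 (I (Num 1)) (ext_body e)) l \<Longrightarrow> s3 l = s2 l"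
        have 6: "s3 (Var 6) = s2 (Var 6)" by (rule fr3) (simp add: ext_body_touches)
        have "dir_ok (s3 (Var 6) = 0) (arr s3 (Suc e)) (arr s3 e)"
          by (rule ext_dir_ok[where F = "arr s2 11" and T = "arr s2 10"]) (use ** *** 6 in auto)
        then show "?Q s3 t3" using * ** *** 6 by (auto simp: dir_cost_def)
      qed
    qed
  qed
  then show ?thesis unfolding dir_prog_def P_def[symmetric] X_def[symmetric]
    by - (rule wp_Seq, erule wp_conseq, erule wp_Seq)
qed

end

subsection \<open>The selection\<close>

definition choose_body :: "nat \<Rightarrow> nat \<Rightarrow> nat \<Rightarrow> com" where
  "choose_body u d g =
     CIf Less (Num 0) (A (Suc d) (V 1))
       (SetV 28 (Num 0 \<ominus> A d (V 1)) ;;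
        CIf Less (Num 0) (A (Suc u) (V 1)) (CIf Less (A u (V 1)) (V 28) (SetV 6 (Num 1)) CSkip) CSkip)
       (CIf Less (Num 0) (A (Suc u) (V 1)) (SetV 28 (A u (V 1))) (SetV 28 (Num 0))) ;;
     SetA g (V 1) (V 28)"

text \<open>The lower bound is preferred. It appears as \<open>- d\<close> because \<open>d\<close>
  bounds the reflected coordinate from above.\<close>

definition choice :: "(nat \<Rightarrow> real) \<Rightarrow> (nat \<Rightarrow> real) \<Rightarrow> (nat \<Rightarrow> real) \<Rightarrow> (nat \<Rightarrow> real) \<Rightarrow> nat \<Rightarrow> real" where
  "choice eu u ed d x = (if ed x = 1 then - d x else if eu x = 1 then u x else 0)"

definition crossing :: "nat \<Rightarrow> (nat \<Rightarrow> real) \<Rightarrow> (nat \<Rightarrow> real) \<Rightarrow> (nat \<Rightarrow> real) \<Rightarrow> (nat \<Rightarrow> real) \<Rightarrow> bool" where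
  "crossing N eu u ed d \<longleftrightarrow> (\<exists>x<N. ed x = 1 \<and> eu x = 1 \<and> u x < - d x)"

lemma choose_body_touches: "touches (choose_body u d g) l \<longleftrightarrow> l \<in> {Var 6, Var 28} \<or> (\<exists>j. l = Arr g j)"
  by (auto simp: choose_body_def)

lemma (in machine) choose_spec:
  assumes il: "1 < il" "s0 (Inp 1) = real N" "N \<le> cp"
    and fl: "s0 (Var 6) = fl"
    and ids: "u < 19" "d < 19" "20 \<le> g" "g < 32"
    and e: "\<forall>x<N. arr s0 (Suc u) x = 0 \<or> arr s0 (Suc u) x = 1" "\<forall>x<N. arr s0 (Suc d) x = 0 \<or> arr s0 (Suc d) x = 1"
  shows "wp (CFor 1 (I (Num 1)) (choose_body u d g)) (\<lambda>s t'.
    (\<forall>x<N. arr s g x = choice (arr s0 (Suc u)) (arr s0 u) (arr s0 (Suc d)) (arr s0 d) x) \<and>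
    (s (Var 6) = fl \<and> \<not> crossing N (arr s0 (Suc u)) (arr s0 u) (arr s0 (Suc d)) (arr s0 d) \<or>
     s (Var 6) = 1 \<and> crossing N (arr s0 (Suc u)) (arr s0 u) (arr s0 (Suc d)) (arr s0 d)) \<and>
    t' \<ge> t - (real N * 8 + 2)) s0 t"
proof -
  define eu where "eu = arr s0 (Suc u)"
  define ed where "ed = arr s0 (Suc d)"
  define uu where "uu = arr s0 u"
  define dd where "dd = arr s0 d"
  note defs = eu_def ed_def uu_def dd_def
  define J where "J = (\<lambda>k s. (\<forall>x<k. arr s g x = choice eu uu ed dd x) \<and>
    (s (Var 6) = fl \<and> \<not> crossing k eu uu ed dd \<or> s (Var 6) = 1 \<and> crossing k eu uu ed dd))"
  have "wp (CFor 1 (I (Num 1)) (choose_body u d g)) (\<lambda>s' t'. J N s' \<and> s' (Var 1) = real N \<and>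
      t' + 0 \<ge> t + 0 - (real N * (6 + 2) + 2)) s0 t"
  proof (rule wp_For[where \<phi> = "\<lambda>_. 0"])
    show "J 0 s0" using fl by (simp add: J_def crossing_def)
  next
    fix k s
    assume "\<And>l. l \<noteq> Var 1 \<Longrightarrow> \<not> touches (choose_body u d g) l \<Longrightarrow> s l = s0 l"
    from this[of "Inp 1"] show "safe s (I (Num 1)) \<and> aval s (I (Num 1)) = real N"
      using il by (simp add: choose_body_touches)
  next
    fix x s and t :: real assume k: "x < N" and J: "J x s" and v: "s (Var 1) = real x"
      and fr: "\<And>l. l \<noteq> Var 1 \<Longrightarrow> \<not> touches (choose_body u d g) l \<Longrightarrow> s l = s0 l"
    have a: "arr s (Suc u) = eu" "arr s (Suc d) = ed" "arr s u = uu" "arr s d = dd"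
      using fr ids by (auto simp: choose_body_touches arr_def defs)
    have lt: "x < cp" "u < 32" "Suc u < 32" "d < 32" "Suc d < 32" "g < 32" using k il ids by auto
    define Q where "Q = (\<lambda>s' t'. s' (Var 1) = real x \<and> J (Suc x) s' \<and> t' + 0 \<ge> t + 0 - 6)"
    have cr: "crossing (Suc x) eu uu ed dd \<longleftrightarrow> crossing x eu uu ed dd \<or> (ed x = 1 \<and> eu x = 1 \<and> uu x < - dd x)"
      by (auto simp: crossing_def less_Suc_eq)
    have fin: "Q (s(Var 28 := w, Arr g x := w)) (t - 6)" "Q (s(Var 28 := w, Arr g x := w)) (t - 5)"
      "Q (s(Var 28 := w, Arr g x := w)) (t - 4)"
      if "w = choice eu uu ed dd x" "\<not> (ed x = 1 \<and> eu x = 1 \<and> uu x < - dd x)" for w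
      using J v that cr unfolding Q_def J_def by (auto simp: less_Suc_eq)
    have fin1: "Q (s(Var 28 := w, Var 6 := 1, Arr g x := w)) (t - 6)"
      if "w = choice eu uu ed dd x" "ed x = 1 \<and> eu x = 1 \<and> uu x < - dd x" for w
      using J v that cr unfolding Q_def J_def by (auto simp: less_Suc_eq)
    have eu: "eu x = 0 \<or> eu x = 1" and ed: "ed x = 0 \<or> ed x = 1" using e k by (auto simp: defs)
    have "wp (choose_body u d g) Q s t"
      unfolding choose_body_def
      by (intro wp_Seq wp_If wp_SetV wp_SetA wp_Skip)
        (use a v lt eu ed fin fin1 in \<open>auto simp: Arr_arr choice_def\<close>)
    then show "wp (choose_body u d g) (\<lambda>s' t'. s' (Var 1) = real x \<and> J (Suc x) s' \<and> t' + 0 \<ge> t + 0 - 6) s t"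
      by (simp add: Q_def)
  qed (simp_all add: J_def)
  then show ?thesis by (rule wp_conseq) (simp add: J_def defs)
qed

text \<open>Both directions eliminate the same coordinate. Negating \<open>be\<close> reflects the
  remaining one, so that the upper bounds of \<open>D\<close> are lower bounds for the original
  problem.\<close>

locale two_directions =
  U: direction il cp N n \<rho> lam al be \<gamma> z a b +
  D: direction il cp N n \<rho> lam al "\<lambda>i. - be i" \<gamma> z a c
  for il cp N n :: nat and \<rho> :: "nat \<Rightarrow> nat \<Rightarrow> real" and lam :: real
    and al be \<gamma> :: "nat \<Rightarrow> real" and z :: "nat \<Rightarrow> nat" and a b c :: nat
begin

text \<open>Flags agree at points of finite distance, so both points choose by the same case, and
  each of the possible values is Lipschitz on its own.\<close>

lemma choice_lipschitz:
  assumes U: "U.dir_ok ok eu u" and D: "D.dir_ok ok ed d"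
    and xy: "x < N" "y < N" "0 \<le> \<rho> x y"
  shows "\<bar>choice eu u ed d x - choice eu u ed d y\<bar> \<le> lam * \<rho> x y"
proof -
  have yx: "\<rho> y x = \<rho> x y" using U.sym xy by simp
  have ed: "ed x = 1 \<Longrightarrow> ed y = 1 \<and> d y \<le> d x + lam * \<rho> x y" "ed y = 1 \<Longrightarrow> ed x = 1 \<and> d x \<le> d y + lam * \<rho> x y"
    using D xy yx unfolding D.dir_ok_def by metis+
  have eu: "eu x = 1 \<Longrightarrow> eu y = 1 \<and> u y \<le> u x + lam * \<rho> x y" "eu y = 1 \<Longrightarrow> eu x = 1 \<and> u x \<le> u y + lam * \<rho> x y"
    using U xy yx unfolding U.dir_ok_def by metis+
  have "0 \<le> lam * \<rho> x y" using U.lam xy by simp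
  then show ?thesis using ed eu unfolding choice_def by (auto simp: abs_le_iff)
qed

lemma crossing_no_selection:
  assumes U: "U.dir_ok ok eu u" and D: "D.dir_ok ok ed d" and cr: "crossing N eu u ed d"
    and f: "\<forall>x<N. U.feas x (h1 x) (h2 x)"
    and h: "\<forall>x<N. \<forall>y<N. 0 \<le> \<rho> x y \<longrightarrow> \<bar>h2 x - h2 y\<bar> \<le> lam * \<rho> x y"
  shows False
proof -
  obtain x where x: "x < N" "ed x = 1" "eu x = 1" "u x < - d x" using cr by (auto simp: crossing_def)
  have "h2 x \<le> u x" using U f h x unfolding U.dir_ok_def by blast
  moreover have "\<forall>x<N. D.feas x (h1 x) (- h2 x)"
    using f unfolding U.feas_def D.feas_def by simp
  moreover have "\<forall>x<N. \<forall>y<N. 0 \<le> \<rho> x y \<longrightarrow> \<bar>- h2 x - - h2 y\<bar> \<le> lam * \<rho> x y"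
    using h by (metis abs_minus_commute minus_diff_minus abs_minus_cancel)
  ultimately have "- h2 x \<le> d x"
    using D x unfolding D.dir_ok_def by (metis (no_types, lifting))
  then show False using \<open>h2 x \<le> u x\<close> x by simp
qed

text \<open>Opposite constraints give no bound when a coordinate is eliminated, but may contradict each
  other. By the triangle inequality it suffices to compare them at the point that owns one of
  them.\<close>

definition no_conflict :: bool where
  "no_conflict \<longleftrightarrow> (\<forall>i<n. \<forall>j<n. al i + al j = 0 \<longrightarrow> be i + be j = 0 \<longrightarrow> 0 \<le> \<rho> (z i) (z j) \<longrightarrow>
     0 \<le> \<gamma> i + \<gamma> j + lam * \<rho> (z i) (z j))"

text \<open>Multiplying by \<open>w = - al j\<close> clears the denominators in slope and intercept
  and turns a bound of the form A g \<le> C into one of \<open>box\<close>. For A > 0 it comes from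
  \<open>U\<close>, for A < 0 from the reflected direction \<open>D\<close>, and for A = 0 it says
  only that C is nonnegative, which is where \<open>no_conflict\<close> enters.\<close>

lemma box_of_pairs:
  assumes pu: "U.pair_ok x (eu x) (u x)" and pd: "D.pair_ok x (ed x) (d x)"
    and nc: no_conflict and x: "x < N" and cr: "\<not> crossing N eu u ed d"
  shows "U.box x (choice eu u ed d x)"
proof -
  define g where "g = choice eu u ed d x"
  have gu: "g \<le> u x" if "eu x = 1" using that cr x by (auto simp: g_def choice_def crossing_def not_less)
  have gd: "g = - d x" if "ed x = 1" using that by (simp add: g_def choice_def)
  have main: "(\<bar>al i\<bar> * be j + \<bar>al j\<bar> * be i) * g \<le> \<bar>al i\<bar> * U.sh j x + \<bar>al j\<bar> * U.sh i x"
    if ij: "i \<in> U.act x" "j \<in> U.act x" "0 < al i" "al j < 0" for i j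
  proof -
    define w where "w = - al j"
    have w: "0 < w" using ij by (simp add: w_def)
    define A where "A = be i + al i * U.slope j"
    define C where "C = U.sh i x + al i * snd (U.line x j)"
    have wA: "w * A = \<bar>al i\<bar> * be j + \<bar>al j\<bar> * be i"
      using ij w by (simp add: A_def U.slope_def w_def[symmetric] field_simps)
    have wC: "w * C = \<bar>al i\<bar> * U.sh j x + \<bar>al j\<bar> * U.sh i x"
      using ij w by (simp add: C_def U.line_def w_def[symmetric] field_simps)
    have "A * g \<le> C"
    proof (cases "0 < A")
      case True
      then have e: "eu x = 1 \<and> A * u x \<le> C" using pu ij unfolding U.pair_ok_def A_def C_def by (meson less_imp_le)
      then have "A * g \<le> A * u x" using gu True by (intro mult_left_mono) auto
      then show ?thesis using e by linarith
    next
      case nA: False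
      show ?thesis
      proof (cases "A < 0")
        case True
        have A': "- be i + al i * D.slope j = - A" by (simp add: A_def U.slope_def D.slope_def algebra_simps)
        have C': "U.sh i x + al i * snd (D.line x j) = C" by (simp add: C_def U.line_def D.line_def)
        have "ed x = 1 \<and> (- be i + al i * D.slope j) * d x \<le> U.sh i x + al i * snd (D.line x j)"
          using pd ij True A' unfolding D.pair_ok_def by (metis less_imp_le neg_0_less_iff_less)
        then show ?thesis using gd A' C' by auto
      next
        case False
        \<comment> \<open>The normals are parallel and their first coefficients have opposite signs;
          being normalised, they are negatives of each other.\<close>
        then have A0: "A = 0" using nA by simp
        then have e: "al i * be j = al j * be i" using wA ij by simp
        have ni: "al i + \<bar>be i\<bar> = 1" "- al j + \<bar>be j\<bar> = 1"
          using U.norm[of i] U.norm[of j] ij by (auto simp: U.act_def)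
        have "al i * \<bar>be j\<bar> = - al j * \<bar>be i\<bar>" using arg_cong[OF e, of abs] ij by (simp add: abs_mult)
        moreover have "\<bar>be i\<bar> = 1 - al i" "\<bar>be j\<bar> = 1 + al j" using ni by auto
        ultimately have s: "al i + al j = 0" by (simp add: algebra_simps)
        then have "al j = - al i" by simp
        then have "al i * (be i + be j) = 0" using e by (simp add: algebra_simps)
        then have t: "be i + be j = 0" using ij by simp
        have n: "i < n" "j < n" "z i < N" "z j < N" "0 \<le> \<rho> x (z i)" "0 \<le> \<rho> x (z j)"
          using ij U.z by (auto simp: U.act_def)
        have "\<rho> (z i) x = \<rho> x (z i)" using U.sym n x by simp
        \<comment> \<open>The two relaxations at x together are at least the relaxation between the
          owners, for which \<open>no_conflict\<close> is stated.\<close>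
        then have tr: "0 \<le> \<rho> (z i) (z j)" "\<rho> (z i) (z j) \<le> \<rho> x (z i) + \<rho> x (z j)"
          using U.tri[of "z i" x "z j"] n x by auto
        have "0 \<le> \<gamma> i + \<gamma> j + lam * \<rho> (z i) (z j)" using nc n s t tr unfolding no_conflict_def by blast
        moreover have "lam * \<rho> (z i) (z j) \<le> lam * (\<rho> x (z i) + \<rho> x (z j))" using tr U.lam by simp
        ultimately have "0 \<le> U.sh i x + U.sh j x" by (simp add: U.sh_def algebra_simps)
        then have "0 \<le> al i * (U.sh i x + U.sh j x)" using ij by simp
        then have "0 \<le> w * C" using wC ij \<open>al j = - al i\<close> by (simp add: algebra_simps)
        then show ?thesis using A0 w by (simp add: zero_le_mult_iff)
      qed
    qed
    then have "w * (A * g) \<le> w * C" using w by simp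
    then show ?thesis using wA wC by (metis mult.assoc)
  qed
  show ?thesis unfolding U.box_def g_def[symmetric]
  proof (intro conjI ballI impI)
    fix i j assume ij: "i \<in> U.act x" "j \<in> U.act x" "al i * al j < 0"
    show "(\<bar>al i\<bar> * be j + \<bar>al j\<bar> * be i) * g \<le> \<bar>al i\<bar> * U.sh j x + \<bar>al j\<bar> * U.sh i x"
    proof (cases "0 < al i")
      case True
      then show ?thesis using main[OF ij(1,2)] ij(3) by (simp add: mult_less_0_iff)
    next
      case False
      then show ?thesis using main[OF ij(2,1)] ij(3) by (simp add: mult_less_0_iff add.commute)
    qed
  next
    fix i assume i: "i \<in> U.act x" "al i = 0"
    then have nz: "be i \<noteq> 0" using U.norm[of i] by (auto simp: U.act_def)
    show "be i * g \<le> U.sh i x"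
    proof (cases "0 < be i")
      case True
      then have e: "eu x = 1 \<and> be i * u x \<le> U.sh i x" using pu i unfolding U.pair_ok_def by simp
      then have "be i * g \<le> be i * u x" using gu True by (intro mult_left_mono) auto
      then show ?thesis using e by linarith
    next
      case False
      then have "0 < - be i" using nz by simp
      then have "ed x = 1 \<and> - be i * d x \<le> U.sh i x" using pd i unfolding D.pair_ok_def by simp
      then show ?thesis using gd by auto
    qed
  qed
qed

end

section \<open>Conflicts, projection and the assembled computation\<close>

lemma (in machine) wp_SeqI:
  "wp c P s t \<Longrightarrow> (\<And>s' t'. P s' t' \<Longrightarrow> wp d Q s' t') \<Longrightarrow> wp (c ;; d) Q s t"
  by (rule wp_Seq, rule wp_conseq)

text \<open>A single comparison tests that both sums vanish: the sum of their squares is at most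
  0.\<close>

definition conflict_inner :: com where
  "conflict_inner =
     CIf Leq ((A 0 (V 1) \<oplus> A 0 (V 2)) \<otimes> (A 0 (V 1) \<oplus> A 0 (V 2)) \<oplus>
         (A 1 (V 1) \<oplus> A 1 (V 2)) \<otimes> (A 1 (V 1) \<oplus> A 1 (V 2))) (Num 0)
       (SetV 14 (dist_exp (A 5 (V 1)) (A 5 (V 2))) ;;
        CIf Leq (Num 0) (V 14)
          (CIf Less (A 4 (V 1) \<oplus> A 4 (V 2) \<oplus> I (Num 2) \<otimes> V 14) (Num 0) (SetV 6 (Num 1)) CSkip)
          CSkip)
       CSkip"

definition conflict_prog :: com where
  "conflict_prog = CFor 1 (V 3) (CFor 2 (V 3) conflict_inner)"

definition project_inner :: com where
  "project_inner = SetV 14 (dist_exp (V 1) (A 5 (V 4))) ;;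
     CIf Leq (Num 0) (V 14)
       (SetV 15 (A 0 (V 4) \<otimes> A 20 (V 1) \<oplus> A 1 (V 4) \<otimes> A 21 (V 1) \<ominus>
           (A 4 (V 4) \<oplus> I (Num 2) \<otimes> V 14)) ;;
        CIf Less (V 29) (V 15)
          (SetV 29 (V 15) ;;
           CIf Less (Num 0) (A 0 (V 4)) (SetV 30 (Num 1)) (SetV 30 (Num 0 \<ominus> Num 1)) ;;
           CIf Less (Num 0) (A 1 (V 4)) (SetV 31 (Num 1)) (SetV 31 (Num 0 \<ominus> Num 1)))
          CSkip)
       CSkip"

definition project_body :: com where
  "project_body = SetV 29 (Num 0) ;; SetV 30 (Num 0) ;; SetV 31 (Num 0) ;;
     CFor 4 (V 3) project_inner ;;
     SetA 22 (V 1) (A 20 (V 1) \<ominus> V 29 \<otimes> V 30) ;;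
     SetA 23 (V 1) (A 21 (V 1) \<ominus> V 29 \<otimes> V 31)"

text \<open>\<open>dir_prog a b e\<close> takes the coefficients of the eliminated coordinate from
  array \<open>a\<close> and those of the bounded one from array \<open>b\<close>; arrays 2 and 3
  hold the negated copies for the lower bounds. A contradiction does not end the computation, it
  only sets \<open>V 6\<close>, which is never reset.\<close>

definition solve_prog :: com where
  "solve_prog = conflict_prog ;; dir_prog 0 1 12 ;; dir_prog 0 2 14 ;; dir_prog 1 0 16 ;; dir_prog 1 3 18 ;;
     CFor 1 (I (Num 1)) (choose_body 12 14 21) ;; CFor 1 (I (Num 1)) (choose_body 16 18 20) ;;
     CFor 1 (I (Num 1)) project_body"

lemma shifted_constraints_neg:
  assumes "shifted_constraints N n \<rho> lam p q z"
  shows "shifted_constraints N n \<rho> lam p (\<lambda>i. - q i) z"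
proof -
  interpret shifted_constraints N n \<rho> lam p q \<gamma> z by (rule assms)
  show ?thesis
  proof
    show "\<bar>p i\<bar> + \<bar>- q i\<bar> = 1" if "i < n" for i using norm[OF that] by simp
  qed (fact refl sym tri lam z)+
qed

locale selection_problem = machine il cp + shifted_constraints N n \<rho> lam p q \<gamma> z
  for il cp N n :: nat and \<rho> :: "nat \<Rightarrow> nat \<Rightarrow> real" and lam :: real
    and p q \<gamma> :: "nat \<Rightarrow> real" and z :: "nat \<Rightarrow> nat" +
  assumes cp: "n \<le> cp" "N \<le> cp" "0 < cp" and il: "3 + N * N \<le> il"
begin

text \<open>\<open>Y\<close> bounds the second coordinate and \<open>X\<close> the first one, \<open>U\<close> from above and \<open>D\<close> from below.\<close>

sublocale Y: two_directions il cp N n \<rho> lam p q \<gamma> z 0 1 2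
proof -
  interpret neg: shifted_constraints N n \<rho> lam p "\<lambda>i. - q i" \<gamma> z
    by (rule shifted_constraints_neg) unfold_locales
  show "two_directions il cp N n \<rho> lam p q z 0 1 2"
    by unfold_locales (use cp il in auto)
qed

sublocale X: two_directions il cp N n \<rho> lam q p \<gamma> z 1 0 3
proof -
  interpret sw: shifted_constraints N n \<rho> lam q p \<gamma> z by (rule swapped)
  interpret neg: shifted_constraints N n \<rho> lam q "\<lambda>i. - p i" \<gamma> z
    by (rule shifted_constraints_neg) unfold_locales
  show "two_directions il cp N n \<rho> lam q p z 1 0 3"
    by unfold_locales (use cp il in auto)
qed

definition selection :: "(nat \<Rightarrow> real) \<Rightarrow> (nat \<Rightarrow> real) \<Rightarrow> bool" where
  "selection h1 h2 \<longleftrightarrow> (\<forall>i<n. p i * h1 (z i) + q i * h2 (z i) \<le> \<gamma> i) \<and>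
     (\<forall>x<N. \<forall>y<N. 0 \<le> \<rho> x y \<longrightarrow> \<bar>h1 x - h1 y\<bar> \<le> lam * \<rho> x y \<and> \<bar>h2 x - h2 y\<bar> \<le> lam * \<rho> x y)"

text \<open>The duality between the normalisation \<bar>p\<bar> + \<bar>q\<bar> = 1 and the maximum
  norm.\<close>

lemma selection_near:
  assumes "selection h1 h2" "i < n" "x < N" "0 \<le> \<rho> x (z i)"
  shows "p i * (h1 x - h1 (z i)) + q i * (h2 x - h2 (z i)) \<le> lam * \<rho> x (z i)"
proof -
  define r where "r = lam * \<rho> x (z i)"
  have h: "\<bar>h1 x - h1 (z i)\<bar> \<le> r" "\<bar>h2 x - h2 (z i)\<bar> \<le> r"
    using assms z unfolding selection_def r_def by auto
  have "p i * (h1 x - h1 (z i)) \<le> \<bar>p i\<bar> * r"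
    using mult_left_mono[OF h(1), of "\<bar>p i\<bar>"] abs_ge_self[of "p i * (h1 x - h1 (z i))"] by (simp add: abs_mult)
  moreover have "q i * (h2 x - h2 (z i)) \<le> \<bar>q i\<bar> * r"
    using mult_left_mono[OF h(2), of "\<bar>q i\<bar>"] abs_ge_self[of "q i * (h2 x - h2 (z i))"] by (simp add: abs_mult)
  moreover have "\<bar>p i\<bar> * r + \<bar>q i\<bar> * r = r" using norm[OF assms(2)] by (metis distrib_right mult_1)
  ultimately show ?thesis by (simp add: r_def)
qed

lemma selection_feasible:
  assumes "selection h1 h2" "x < N" "i \<in> act x"
  shows "p i * h1 x + q i * h2 x \<le> sh i x"
proof -
  have i: "i < n" "0 \<le> \<rho> x (z i)" using assms by (auto simp: act_def)
  have "p i * h1 (z i) + q i * h2 (z i) \<le> \<gamma> i" using assms i by (auto simp: selection_def)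
  then show ?thesis using selection_near[OF assms(1) i(1) assms(2) i(2)] by (simp add: sh_def algebra_simps)
qed

lemma infeasible_no_selection:
  assumes "Y.U.infeasible \<or> Y.D.infeasible \<or> X.U.infeasible \<or> X.D.infeasible"
  shows "\<not> selection h1 h2"
proof
  assume s: "selection h1 h2"
  have f: "p i * h1 x + q i * h2 x \<le> sh i x" if "x < N" "i \<in> act x" for i x
    using selection_feasible[OF s that] .
  have "Y.U.feas x (h1 x) (h2 x)" "Y.D.feas x (h1 x) (- h2 x)" "X.U.feas x (h2 x) (h1 x)" "X.D.feas x (h2 x) (- h1 x)"
    if "x < N" for x
    using f[OF that] unfolding Y.U.feas_def Y.D.feas_def X.U.feas_def X.D.feas_def
    by (auto simp: add.commute)
  then show False
    using assms unfolding Y.U.infeasible_def Y.D.infeasible_def X.U.infeasible_def X.D.infeasible_def by blast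
qed

text \<open>Evaluating constraint j at \<open>z i\<close> instead of \<open>z j\<close> costs at
  most the relaxation. At the common point the two opposite linear forms cancel, which leaves a
  nonnegative right-hand side.\<close>

lemma conflict_no_selection:
  assumes "\<not> Y.no_conflict"
  shows "\<not> selection h1 h2"
proof
  assume s: "selection h1 h2"
  obtain i j where ij: "i < n" "j < n" "p i + p j = 0" "q i + q j = 0" "0 \<le> \<rho> (z i) (z j)"
    "\<gamma> i + \<gamma> j + lam * \<rho> (z i) (z j) < 0"
    using assms unfolding Y.no_conflict_def by (meson not_less)
  have "p i * h1 (z i) + q i * h2 (z i) \<le> \<gamma> i" using s ij by (auto simp: selection_def)
  moreover have "p j * h1 (z j) + q j * h2 (z j) \<le> \<gamma> j" using s ij by (auto simp: selection_def)
  moreover have "p j * (h1 (z i) - h1 (z j)) + q j * (h2 (z i) - h2 (z j)) \<le> lam * \<rho> (z i) (z j)"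
    by (rule selection_near[OF s]) (use ij z in auto)
  moreover have "p j = - p i" "q j = - q i" using ij by auto
  ultimately show False using ij(6) by (simp add: algebra_simps)
qed

lemma no_conflict_swapped: "X.no_conflict = Y.no_conflict"
  unfolding X.no_conflict_def Y.no_conflict_def by blast

definition all_inputs :: "state \<Rightarrow> bool" where
  "all_inputs s \<longleftrightarrow> Y.U.inputs s \<and> Y.D.inputs s \<and> X.U.inputs s \<and> X.D.inputs s"

lemma all_inputs_frame:
  assumes "all_inputs s" "\<And>i. s' (Inp i) = s (Inp i)" "s' (Var 3) = s (Var 3)"
    "\<And>k i. k < 6 \<Longrightarrow> s' (Arr k i) = s (Arr k i)"
  shows "all_inputs s'"
  using assms Y.U.inputs_frame[of s s'] Y.D.inputs_frame[of s s'] X.U.inputs_frame[of s s'] X.D.inputs_frame[of s s']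
  unfolding all_inputs_def by blast

lemma all_inputsD:
  assumes "all_inputs s"
  shows "s (Inp 1) = real N" "s (Inp 2) = lam" "s (Var 3) = real n"
    "i < n \<Longrightarrow> arr s 0 i = p i" "i < n \<Longrightarrow> arr s 1 i = q i"
    "i < n \<Longrightarrow> arr s 4 i = \<gamma> i" "i < n \<Longrightarrow> arr s 5 i = real (z i)"
  using assms unfolding all_inputs_def Y.U.inputs_def by auto

lemma all_inputs_upd [simp]: "v \<noteq> 3 \<Longrightarrow> all_inputs (s(Var v := w)) = all_inputs s"
  using Y.U.inputs_upd(1)[of v s w] Y.D.inputs_upd(1)[of v s w] X.U.inputs_upd(1)[of v s w]
    X.D.inputs_upd(1)[of v s w]
  unfolding all_inputs_def by blast

lemma dist_val':
  assumes "all_inputs s" "aval s e = real x" "aval s e' = real y" "safe s e" "safe s e'" "x < N" "y < N"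
  shows "aval s (dist_exp e e') = \<rho> x y" "safe s (dist_exp e e')"
  using Y.U.dist_val[OF _ assms(2-)] assms(1) unfolding all_inputs_def by blast+

definition conflict :: "nat \<Rightarrow> nat \<Rightarrow> bool" where
  "conflict i j \<longleftrightarrow> p i + p j = 0 \<and> q i + q j = 0 \<and> 0 \<le> \<rho> (z i) (z j) \<and>
     \<gamma> i + \<gamma> j + lam * \<rho> (z i) (z j) < 0"

lemma no_conflict_iff: "Y.no_conflict \<longleftrightarrow> (\<forall>i<n. \<forall>j<n. \<not> conflict i j)"
  unfolding Y.no_conflict_def conflict_def by (meson not_less)

lemma conflict_inner_touches: "touches conflict_inner l \<longleftrightarrow> l \<in> {Var 6, Var 14}"
  by (auto simp: conflict_inner_def)

lemma sum_squares_le_0: "(a::real) * a + b * b \<le> 0 \<longleftrightarrow> a = 0 \<and> b = 0"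
  by (metis add.right_neutral mult_zero_left order_refl sum_squares_le_zero_iff)

lemma conflict_for:
  assumes inp: "all_inputs s0" and i: "s0 (Var 1) = real i" "i < n"
  shows "wp (CFor 2 (V 3) conflict_inner) (\<lambda>s t'.
      (s (Var 6) = s0 (Var 6) \<and> (\<forall>j<n. \<not> conflict i j) \<or> s (Var 6) = 1 \<and> \<not> Y.no_conflict) \<and>
      t' \<ge> t - (real n * 7 + 2)) s0 t"
proof -
  define J where "J = (\<lambda>k (s::state). s (Var 6) = s0 (Var 6) \<and> (\<forall>j<k. \<not> conflict i j) \<or> s (Var 6) = 1 \<and> \<not> Y.no_conflict)"
  have "wp (CFor 2 (V 3) conflict_inner) (\<lambda>s' t'. J n s' \<and> s' (Var 2) = real n \<and>
      t' + 0 \<ge> t + 0 - (real n * (5 + 2) + 2)) s0 t"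
  proof (rule wp_For[where \<phi> = "\<lambda>_. 0"])
    show "J 0 s0" by (simp add: J_def)
  next
    fix k s
    assume "\<And>l. l \<noteq> Var 2 \<Longrightarrow> \<not> touches conflict_inner l \<Longrightarrow> s l = s0 l"
    from this[of "Var 3"] show "safe s (V 3) \<and> aval s (V 3) = real n"
      using all_inputsD(3)[OF inp] by (simp add: conflict_inner_touches)
  next
    fix j s and t :: real assume k: "j < n" and J: "J j s" and v: "s (Var 2) = real j"
      and fr: "\<And>l. l \<noteq> Var 2 \<Longrightarrow> \<not> touches conflict_inner l \<Longrightarrow> s l = s0 l"
    have inps: "all_inputs s" by (rule all_inputs_frame[OF inp]) (auto intro!: fr simp: conflict_inner_touches)
    note D = all_inputsD[OF inps]
    have v1: "s (Var 1) = real i" using fr i by (simp add: conflict_inner_touches)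
    have lt: "i < cp" "j < cp" "2 < il" using i k cp il z[of i] by (auto simp: Suc_le_eq intro: le_less_trans)
    have zz: "z i < N" "z j < N" using z i k by auto
    have d: "aval s (dist_exp (A 5 (V 1)) (A 5 (V 2))) = \<rho> (z i) (z j)" "safe s (dist_exp (A 5 (V 1)) (A 5 (V 2)))"
      by (rule dist_val'; use inps v v1 D(7) i k zz lt in \<open>simp add: Arr_arr\<close>)+
    have lam2: "safe s' (I (Num 2))" "aval s' (I (Num 2)) = s' (Inp 2)" for s' using lt by simp_all
    define Q where "Q = (\<lambda>s' t'. s' (Var 2) = real j \<and> J (Suc j) s' \<and> t' + 0 \<ge> t + 0 - 5)"
    have no: "Q s (t - u)" "Q (s(Var 14 := w)) (t - u)" if "\<not> conflict i j" "u \<le> 5" for u w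
      using J v that by (auto simp: Q_def J_def less_Suc_eq)
    have no1: "Q s (t - u)" if "p i + p j = 0 \<longrightarrow> q i + q j \<noteq> 0" "u \<le> 5" for u
      using no that unfolding conflict_def by blast
    have no2: "Q (s(Var 14 := w)) (t - u)" if "\<rho> (z i) (z j) < 0" "u \<le> 5" for u w
      using no that unfolding conflict_def by (meson not_le)
    have no3: "Q (s(Var 14 := w)) (t - u)" if "0 \<le> \<gamma> i + \<gamma> j + lam * \<rho> (z i) (z j)" "u \<le> 5" for u w
      using no that unfolding conflict_def by (meson not_le)
    have yes: "Q (s(Var 14 := w, Var 6 := 1)) (t - u)" if "conflict i j" "u \<le> 5" for u w
      using v that i k no_conflict_iff by (auto simp: Q_def J_def)
    have "wp conflict_inner Q s t"
      unfolding conflict_inner_def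
      by (intro wp_Seq wp_If wp_SetV wp_Skip)
        (use v v1 D k i lt d lam2 no1 no2 no3 yes in \<open>simp_all add: Arr_arr sum_squares_le_0 conflict_def not_le not_less del: aval.simps(3) safe.simps(3)\<close>)
    then show "wp conflict_inner (\<lambda>s' t'. s' (Var 2) = real j \<and> J (Suc j) s' \<and> t' + 0 \<ge> t + 0 - 5) s t"
      by (simp add: Q_def)
  qed (simp_all add: J_def)
  then show ?thesis by (rule wp_conseq) (simp add: J_def)
qed

lemma conflict_spec:
  assumes inp: "all_inputs s0" and 6: "s0 (Var 6) = 0"
  shows "wp conflict_prog (\<lambda>s t'.
      (s (Var 6) = 0 \<and> Y.no_conflict \<or> s (Var 6) = 1 \<and> \<not> Y.no_conflict) \<and>
      t' \<ge> t - (real n * (7 * real n + 4) + 2)) s0 t"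
proof -
  define J where "J = (\<lambda>k (s::state). s (Var 6) = 0 \<and> (\<forall>i<k. \<forall>j<n. \<not> conflict i j) \<or> s (Var 6) = 1 \<and> \<not> Y.no_conflict)"
  have "wp conflict_prog (\<lambda>s' t'. J n s' \<and> s' (Var 1) = real n \<and>
      t' + 0 \<ge> t + 0 - (real n * (7 * real n + 2 + 2) + 2)) s0 t"
    unfolding conflict_prog_def
  proof (rule wp_For[where \<phi> = "\<lambda>_. 0"])
    show "J 0 s0" using 6 by (simp add: J_def)
  next
    fix k s
    assume "\<And>l. l \<noteq> Var 1 \<Longrightarrow> \<not> touches (CFor 2 (V 3) conflict_inner) l \<Longrightarrow> s l = s0 l"
    from this[of "Var 3"] show "safe s (V 3) \<and> aval s (V 3) = real n"
      using all_inputsD(3)[OF inp] by (simp add: conflict_inner_touches)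
  next
    fix i s and t :: real assume k: "i < n" and J: "J i s" and v: "s (Var 1) = real i"
      and fr: "\<And>l. l \<noteq> Var 1 \<Longrightarrow> \<not> touches (CFor 2 (V 3) conflict_inner) l \<Longrightarrow> s l = s0 l"
    have inps: "all_inputs s" by (rule all_inputs_frame[OF inp]) (auto intro!: fr simp: conflict_inner_touches)
    show "wp (CFor 2 (V 3) conflict_inner) (\<lambda>s' t'. s' (Var 1) = real i \<and> J (Suc i) s' \<and>
       t' + 0 \<ge> t + 0 - (7 * real n + 2)) s t"
    proof (rule wp_conseq_frame[OF conflict_for[OF inps v k]])
      fix s' t' assume *: "(s' (Var 6) = s (Var 6) \<and> (\<forall>j<n. \<not> conflict i j) \<or> s' (Var 6) = 1 \<and> \<not> Y.no_conflict) \<and>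
        t' \<ge> t - (real n * 7 + 2)"
        and fr': "\<And>l. \<not> touches (CFor 2 (V 3) conflict_inner) l \<Longrightarrow> s' l = s l"
      have "s' (Var 1) = real i" using fr' v by (simp add: conflict_inner_touches)
      moreover have "J (Suc i) s'" using J * unfolding J_def by (auto simp: less_Suc_eq)
      ultimately show "s' (Var 1) = real i \<and> J (Suc i) s' \<and> t' + 0 \<ge> t + 0 - (7 * real n + 2)" using * by simp
    qed
  qed (simp_all add: J_def)
  then show ?thesis by (rule wp_conseq) (auto simp: J_def no_conflict_iff algebra_simps)
qed

lemma project_inner_touches: "touches project_inner l \<longleftrightarrow> l \<in> {Var 14, Var 15, Var 29, Var 30, Var 31}"
  by (auto simp: project_inner_def)

lemma project_for:
  assumes inp: "all_inputs s0" and x: "s0 (Var 1) = real x" "x < N"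
    and s0: "s0 (Var 29) = 0" and g: "g1 = arr s0 20 x" "g2 = arr s0 21 x"
  shows "wp (CFor 4 (V 3) project_inner) (\<lambda>s t'.
      proj x g1 g2 (s (Var 29)) (g1 - s (Var 29) * s (Var 30)) (g2 - s (Var 29) * s (Var 31)) \<and>
      t' \<ge> t - (real n * 11 + 2)) s0 t"
proof -
  define viol where "viol = (\<lambda>i. p i * g1 + q i * g2 - sh i x)"
  define J where "J = (\<lambda>k (s::state). 0 \<le> s (Var 29) \<and> (\<forall>i<k. i \<in> act x \<longrightarrow> viol i \<le> s (Var 29)) \<and>
    (s (Var 29) = 0 \<or> (\<exists>i\<in>act x. 0 < s (Var 29) \<and> s (Var 29) = viol i \<and>
      s (Var 30) = sg (p i) \<and> s (Var 31) = sg (q i))))"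
  have "wp (CFor 4 (V 3) project_inner) (\<lambda>s' t'. J n s' \<and> s' (Var 4) = real n \<and>
      t' + 0 \<ge> t + 0 - (real n * (9 + 2) + 2)) s0 t"
  proof (rule wp_For[where \<phi> = "\<lambda>_. 0"])
    show "J 0 s0" using s0 by (simp add: J_def)
  next
    fix k s
    assume "\<And>l. l \<noteq> Var 4 \<Longrightarrow> \<not> touches project_inner l \<Longrightarrow> s l = s0 l"
    from this[of "Var 3"] show "safe s (V 3) \<and> aval s (V 3) = real n"
      using all_inputsD(3)[OF inp] by (simp add: project_inner_touches)
  next
    fix i s and t :: real assume k: "i < n" and J: "J i s" and v: "s (Var 4) = real i"
      and fr: "\<And>l. l \<noteq> Var 4 \<Longrightarrow> \<not> touches project_inner l \<Longrightarrow> s l = s0 l"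
    have inps: "all_inputs s" by (rule all_inputs_frame[OF inp]) (auto intro!: fr simp: project_inner_touches)
    note D = all_inputsD[OF inps]
    have v1: "s (Var 1) = real x" "arr s 20 x = g1" "arr s 21 x = g2"
      using fr x g by (auto simp: project_inner_touches arr_def)
    have lt: "i < cp" "x < cp" "2 < il" using x k cp il by auto
    have zz: "z i < N" using z k by auto
    have d: "aval s (dist_exp (V 1) (A 5 (V 4))) = \<rho> x (z i)" "safe s (dist_exp (V 1) (A 5 (V 4)))"
      by (rule dist_val'; use inps v v1 D(7) x k zz lt in \<open>simp add: Arr_arr\<close>)+
    have lam2: "safe s' (I (Num 2))" "aval s' (I (Num 2)) = s' (Inp 2)" for s' using lt by simp_all
    define Q where "Q = (\<lambda>s' t'. s' (Var 4) = real i \<and> J (Suc i) s' \<and> t' + 0 \<ge> t + 0 - 9)"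
    have vi: "viol i = p i * g1 + q i * g2 - (\<gamma> i + lam * \<rho> x (z i))" by (simp add: viol_def sh_def)
    have no: "Q (s(Var 14 := w)) (t - u)" "Q (s(Var 14 := w, Var 15 := w')) (t - u)"
      if "\<not> (0 \<le> \<rho> x (z i) \<and> s (Var 29) < viol i)" "u \<le> 9" for u w w'
      using J v that by (auto simp: Q_def J_def less_Suc_eq act_def)
    have yes: "Q (s(Var 14 := w, Var 15 := w', Var 29 := viol i, Var 30 := a, Var 31 := b)) (t - u)"
      if h: "0 \<le> \<rho> x (z i)" "s (Var 29) < viol i" "u \<le> 9" "a = sg (p i)" "b = sg (q i)" for u w w' a b
    proof -
      have "i \<in> act x" using h k by (simp add: act_def)
      moreover have "\<forall>j<i. j \<in> act x \<longrightarrow> viol j \<le> viol i" using J h unfolding J_def by fastforce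
      moreover have "0 < viol i" using J h unfolding J_def by linarith
      ultimately show ?thesis using v h unfolding Q_def J_def by (auto simp: less_Suc_eq)
    qed
    have "wp project_inner Q s t"
      unfolding project_inner_def
      by (intro wp_Seq wp_If wp_SetV wp_Skip)
        (use v v1 D k x lt d lam2 no yes vi in \<open>simp_all add: Arr_arr sg_def not_le not_less del: aval.simps(3) safe.simps(3)\<close>)
    then show "wp project_inner (\<lambda>s' t'. s' (Var 4) = real i \<and> J (Suc i) s' \<and> t' + 0 \<ge> t + 0 - 9) s t"
      by (simp add: Q_def)
  qed (simp_all add: J_def)
  then show ?thesis
    by (rule wp_conseq) (auto simp: J_def proj_def viol_def act_def)
qed

end

text \<open>Later stages may still set the flag; claims made under an earlier value of it must be
  weakened accordingly.\<close>

lemma (in direction) dir_ok_mono: "dir_ok ok e v \<Longrightarrow> (ok' \<Longrightarrow> ok) \<Longrightarrow> dir_ok ok' e v"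
  by (auto simp: dir_ok_def)

section \<open>Chaining the stages\<close>

context selection_problem
begin

lemma project_body_touches: "touches project_body l \<longleftrightarrow>
    l \<in> {Var 4, Var 14, Var 15, Var 29, Var 30, Var 31} \<or> (\<exists>j. l = Arr 22 j \<or> l = Arr 23 j)"
  by (auto simp: project_body_def project_inner_touches)

lemma project_spec:
  assumes inp: "all_inputs s0"
  shows "wp (CFor 1 (I (Num 1)) project_body) (\<lambda>s t'.
      (\<forall>x<N. \<exists>d. proj x (arr s0 20 x) (arr s0 21 x) d (arr s 22 x) (arr s 23 x)) \<and>
      t' \<ge> t - (real N * (11 * real n + 9) + 2)) s0 t"
proof -
  define J where "J = (\<lambda>k (s::state). \<forall>x<k. \<exists>d. proj x (arr s0 20 x) (arr s0 21 x) d (arr s 22 x) (arr s 23 x))"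
  have "wp (CFor 1 (I (Num 1)) project_body) (\<lambda>s' t'. J N s' \<and> s' (Var 1) = real N \<and>
      t' + 0 \<ge> t + 0 - (real N * (11 * real n + 7 + 2) + 2)) s0 t"
  proof (rule wp_For[where \<phi> = "\<lambda>_. 0"])
    show "J 0 s0" by (simp add: J_def)
  next
    fix k s
    assume "\<And>l. l \<noteq> Var 1 \<Longrightarrow> \<not> touches project_body l \<Longrightarrow> s l = s0 l"
    from this[of "Inp 1"] show "safe s (I (Num 1)) \<and> aval s (I (Num 1)) = real N"
      using all_inputsD(1)[OF inp] il by (simp add: project_body_touches)
  next
    fix x s and t :: real assume k: "x < N" and J: "J x s" and v: "s (Var 1) = real x"
      and fr: "\<And>l. l \<noteq> Var 1 \<Longrightarrow> \<not> touches project_body l \<Longrightarrow> s l = s0 l"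
    define s1 where "s1 = s(Var 29 := 0, Var 30 := 0, Var 31 := 0)"
    have inps: "all_inputs s" by (rule all_inputs_frame[OF inp]) (auto intro!: fr simp: project_body_touches)
    have a: "arr s 20 = arr s0 20" "arr s 21 = arr s0 21"
      using fr by (auto simp: project_body_touches arr_def)
    have lt: "x < cp" using k cp by auto
    define Q where "Q = (\<lambda>s' t'. s' (Var 1) = real x \<and> J (Suc x) s' \<and> t' + 0 \<ge> t + 0 - (11 * real n + 7))"
    define W where "W = CFor 4 (V 3) project_inner"
    define R where "R = (SetA 22 (V 1) (A 20 (V 1) \<ominus> V 29 \<otimes> V 30) ;; SetA 23 (V 1) (A 21 (V 1) \<ominus> V 29 \<otimes> V 31))"
    have "wp W (wp R Q) s1 (t - 3)" unfolding W_def
    proof (rule wp_conseq_frame[OF project_for])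
      show "all_inputs s1" using inps by (simp add: s1_def)
      show "s1 (Var 1) = real x" "s1 (Var 29) = 0" using v by (simp_all add: s1_def)
      show "x < N" by fact
      fix s2 t2
      assume *: "proj x (arr s1 20 x) (arr s1 21 x) (s2 (Var 29)) (arr s1 20 x - s2 (Var 29) * s2 (Var 30))
          (arr s1 21 x - s2 (Var 29) * s2 (Var 31)) \<and> t2 \<ge> t - 3 - (real n * 11 + 2)"
        and fr2: "\<And>l. \<not> touches (CFor 4 (V 3) project_inner) l \<Longrightarrow> s2 l = s1 l"
      have v2: "s2 (Var 1) = real x" "\<And>k. arr s2 k = arr s k"
        using fr2 v by (auto simp: project_inner_touches s1_def arr_def)
      define s3 where "s3 = s2(Arr 22 x := arr s0 20 x - s2 (Var 29) * s2 (Var 30),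
        Arr 23 x := arr s0 21 x - s2 (Var 29) * s2 (Var 31))"
      have "J (Suc x) s3" unfolding J_def
      proof (intro allI impI)
        fix y assume y: "y < Suc x"
        show "\<exists>d. proj y (arr s0 20 y) (arr s0 21 y) d (arr s3 22 y) (arr s3 23 y)"
        proof (cases "y = x")
          case True
          then show ?thesis using * a by (auto simp: s3_def s1_def)
        next
          case False
          then show ?thesis using J y v2 unfolding J_def s3_def by simp
        qed
      qed
      then have "Q s3 (t2 - 2)" using v2 * by (simp add: Q_def s3_def)
      then show "wp R Q s2 t2" unfolding R_def
        by (intro wp_Seq wp_SetA) (use v2 lt a in \<open>simp_all add: s3_def Arr_arr\<close>)
    qed (rule HOL.refl)+
    then have "wp (W ;; R) Q s1 (t - 3)" by (rule wp_Seq)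
    moreover define WR where "WR = (W ;; R)"
    ultimately have "wp WR Q s1 (t - 3)" by simp
    then have "wp project_body Q s t"
      unfolding project_body_def W_def[symmetric] R_def[symmetric] WR_def[symmetric]
      by (intro wp_Seq wp_SetV) (simp_all add: s1_def)
    then show "wp project_body (\<lambda>s' t'. s' (Var 1) = real x \<and> J (Suc x) s' \<and>
       t' + 0 \<ge> t + 0 - (11 * real n + 7)) s t" by (simp add: Q_def)
  qed (simp_all add: J_def)
  then show ?thesis by (rule wp_conseq) (simp add: J_def algebra_simps)
qed

definition good :: "state \<Rightarrow> bool" where
  "good s \<longleftrightarrow> all_inputs s \<and> (s (Var 6) = 0 \<and> Y.no_conflict \<or> s (Var 6) = 1 \<and> \<not> (\<exists>h1 h2. selection h1 h2))"

text \<open>One statement for all four directions. \<open>dir_cost\<close> depends on n and N only,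
  so \<open>Y.U.dir_cost\<close> is the cost of each of them.\<close>

lemma dir_stage:
  assumes dir: "direction il cp N n \<rho> lam al be z a b"
    and inf: "direction.infeasible N n \<rho> lam al be \<gamma> z \<Longrightarrow> \<not> (\<exists>h1 h2. selection h1 h2)"
    and inp: "\<And>s. all_inputs s \<Longrightarrow> direction.inputs N n \<rho> lam al be \<gamma> z a b s"
    and good: "good s" and e: "12 \<le> e" "e < 20"
  shows "wp (dir_prog a b e) (\<lambda>s' t'. good s' \<and>
    direction.dir_ok N n \<rho> lam al be \<gamma> z (s' (Var 6) = 0) (arr s' (Suc e)) (arr s' e) \<and>
    (s' (Var 6) = 0 \<longrightarrow> s (Var 6) = 0) \<and>
    (\<forall>k. 12 \<le> k \<longrightarrow> k \<noteq> e \<longrightarrow> k \<noteq> Suc e \<longrightarrow> arr s' k = arr s k) \<and> t' \<ge> t - Y.U.dir_cost) s t"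
proof -
  interpret R: direction il cp N n \<rho> lam al be \<gamma> z a b by (rule dir)
  have i: "all_inputs s" using good by (simp add: good_def)
  show ?thesis
  proof (rule wp_conseq_frame[OF R.dir_prog_spec[OF inp[OF i] HOL.refl e]])
    fix s' t'
    assume *: "R.dir_ok (s' (Var 6) = 0) (arr s' (Suc e)) (arr s' e) \<and>
      (s' (Var 6) = s (Var 6) \<or> s' (Var 6) = 1 \<and> R.infeasible) \<and> t' \<ge> t - R.dir_cost"
      and fr: "\<And>l. \<not> touches (dir_prog a b e) l \<Longrightarrow> s' l = s l"
    have fr': "s' l = s l" if "\<not> ((\<exists>v\<in>{1, 2} \<union> {4..27}. l = Var v) \<or> (\<exists>k\<in>{6..11} \<union> {e, Suc e}. \<exists>j. l = Arr k j))" for l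
      using fr R.dir_prog_touches that by blast
    have "all_inputs s'"
      by (rule all_inputs_frame[OF i]) (use e in \<open>auto intro!: fr'\<close>)
    then have "good s'" using good * inf unfolding good_def by auto
    moreover have "arr s' k = arr s k" if "12 \<le> k" "k \<noteq> e" "k \<noteq> Suc e" for k
      by (rule arr_frame, rule fr') (use that in auto)
    ultimately show "good s' \<and> R.dir_ok (s' (Var 6) = 0) (arr s' (Suc e)) (arr s' e) \<and>
      (s' (Var 6) = 0 \<longrightarrow> s (Var 6) = 0) \<and>
      (\<forall>k. 12 \<le> k \<longrightarrow> k \<noteq> e \<longrightarrow> k \<noteq> Suc e \<longrightarrow> arr s' k = arr s k) \<and> t' \<ge> t - Y.U.dir_cost"
      using * by auto
  qed
qed

lemma choose_stage:
  assumes good: "good s"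
    and cr: "crossing N (arr s (Suc u)) (arr s u) (arr s (Suc d)) (arr s d) \<Longrightarrow> \<not> (\<exists>h1 h2. selection h1 h2)"
    and ids: "u < 19" "d < 19" "20 \<le> g" "g < 22"
    and e: "\<forall>x<N. arr s (Suc u) x = 0 \<or> arr s (Suc u) x = 1" "\<forall>x<N. arr s (Suc d) x = 0 \<or> arr s (Suc d) x = 1"
  shows "wp (CFor 1 (I (Num 1)) (choose_body u d g)) (\<lambda>s' t'. good s' \<and>
    (\<forall>x<N. arr s' g x = choice (arr s (Suc u)) (arr s u) (arr s (Suc d)) (arr s d) x) \<and>
    (s' (Var 6) = 0 \<longrightarrow> s (Var 6) = 0 \<and> \<not> crossing N (arr s (Suc u)) (arr s u) (arr s (Suc d)) (arr s d)) \<and>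
    (\<forall>k. 12 \<le> k \<longrightarrow> k \<noteq> g \<longrightarrow> arr s' k = arr s k) \<and> t' \<ge> t - (real N * 8 + 2)) s t"
proof -
  have i: "all_inputs s" using good by (simp add: good_def)
  have il1: "1 < il" using il by simp
  show ?thesis
  proof (rule wp_conseq_frame[OF choose_spec[OF il1 all_inputsD(1)[OF i] cp(2) HOL.refl ids(1-3) _ e]])
    show "g < 32" using ids by simp
    fix s' t'
    assume *: "(\<forall>x<N. arr s' g x = choice (arr s (Suc u)) (arr s u) (arr s (Suc d)) (arr s d) x) \<and>
      (s' (Var 6) = s (Var 6) \<and> \<not> crossing N (arr s (Suc u)) (arr s u) (arr s (Suc d)) (arr s d) \<or>
       s' (Var 6) = 1 \<and> crossing N (arr s (Suc u)) (arr s u) (arr s (Suc d)) (arr s d)) \<and>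
      t' \<ge> t - (real N * 8 + 2)"
      and fr: "\<And>l. \<not> touches (CFor 1 (I (Num 1)) (choose_body u d g)) l \<Longrightarrow> s' l = s l"
    have "all_inputs s'"
      by (rule all_inputs_frame[OF i]) (use ids in \<open>auto intro!: fr simp: choose_body_touches\<close>)
    then have "good s'" using good * cr unfolding good_def by auto
    moreover have "arr s' k = arr s k" if "12 \<le> k" "k \<noteq> g" for k
      by (rule arr_frame, rule fr) (use that in \<open>auto simp: choose_body_touches\<close>)
    moreover have "s' (Var 6) = 0 \<longrightarrow> s (Var 6) = 0 \<and> \<not> crossing N (arr s (Suc u)) (arr s u) (arr s (Suc d)) (arr s d)"
      using * by auto
    ultimately show "good s' \<and>
      (\<forall>x<N. arr s' g x = choice (arr s (Suc u)) (arr s u) (arr s (Suc d)) (arr s d) x) \<and>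
      (s' (Var 6) = 0 \<longrightarrow> s (Var 6) = 0 \<and> \<not> crossing N (arr s (Suc u)) (arr s u) (arr s (Suc d)) (arr s d)) \<and>
      (\<forall>k. 12 \<le> k \<longrightarrow> k \<noteq> g \<longrightarrow> arr s' k = arr s k) \<and> t' \<ge> t - (real N * 8 + 2)"
      using * by auto
  qed
qed

definition solution :: "(nat \<Rightarrow> real) \<Rightarrow> (nat \<Rightarrow> real) \<Rightarrow> bool" where
  "solution f1 f2 \<longleftrightarrow> (\<forall>x<N. \<forall>i\<in>act x. p i * f1 x + q i * f2 x \<le> sh i x) \<and>
     (\<forall>x<N. \<forall>y<N. 0 \<le> \<rho> x y \<longrightarrow>
        \<bar>f1 x - f1 y\<bar> \<le> 3 * (lam * \<rho> x y) \<and> \<bar>f2 x - f2 y\<bar> \<le> 3 * (lam * \<rho> x y))"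

lemma choices_solution:
  assumes yu: "Y.U.dir_ok True yeu yu" and yd: "Y.D.dir_ok True yed yd"
    and xu: "X.U.dir_ok True xeu xu" and xd: "X.D.dir_ok True xed xd"
    and cr: "\<not> crossing N yeu yu yed yd" "\<not> crossing N xeu xu xed xd" and nc: "Y.no_conflict"
    and g: "\<forall>x<N. g1 x = choice xeu xu xed xd x" "\<forall>x<N. g2 x = choice yeu yu yed yd x"
    and P: "\<forall>x<N. \<exists>d. proj x (g1 x) (g2 x) d (f1 x) (f2 x)"
  shows "solution f1 f2"
proof -
  have b2: "box x (g2 x)" if "x < N" for x
    using Y.box_of_pairs[of x yeu yu yed yd] yu yd cr nc that g
    unfolding Y.U.dir_ok_def Y.D.dir_ok_def by auto
  have b1: "X.U.box x (g1 x)" if "x < N" for x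
    using X.box_of_pairs[of x xeu xu xed xd] xu xd cr nc that g no_conflict_swapped
    unfolding X.U.dir_ok_def X.D.dir_ok_def by auto
  have l: "\<bar>g1 x - g1 y\<bar> \<le> lam * \<rho> x y" "\<bar>g2 x - g2 y\<bar> \<le> lam * \<rho> x y"
    if "x < N" "y < N" "0 \<le> \<rho> x y" for x y
    using X.choice_lipschitz[OF xu xd that] Y.choice_lipschitz[OF yu yd that] g that by auto
  obtain d where d: "\<And>x. x < N \<Longrightarrow> proj x (g1 x) (g2 x) (d x) (f1 x) (f2 x)" using P by metis
  \<comment> \<open>\<open>proj\<close> is symmetric in the coordinates, with the same violation and
    the same attaining constraint; this carries the Lipschitz estimate over to the second
    coordinate.\<close>
  have d': "X.U.proj x (g2 x) (g1 x) (d x) (f2 x) (f1 x)" if "x < N" for x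
    using d[OF that] unfolding proj_def X.U.proj_def by (auto simp: add.commute)
  show ?thesis unfolding solution_def
  proof (intro conjI allI impI ballI)
    fix x i assume "x < N" "i \<in> act x"
    then show "p i * f1 x + q i * f2 x \<le> sh i x" using proj_feasible b2 b1 d by blast
  next
    fix x y assume xy: "x < N" "y < N" "0 \<le> \<rho> x y"
    show "\<bar>f1 x - f1 y\<bar> \<le> 3 * (lam * \<rho> x y)"
      by (rule proj_lipschitz[where ?g1.0 = g1 and ?g2.0 = g2, OF xy l[OF xy] b2 b2 d d]) (use xy in auto)
    show "\<bar>f2 x - f2 y\<bar> \<le> 3 * (lam * \<rho> x y)"
      by (rule X.U.proj_lipschitz[where ?g1.0 = g2 and ?g2.0 = g1, OF xy l(2,1)[OF xy] b1 b1 d' d']) (use xy in auto)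
  qed
qed

definition solve_cost :: real where
  "solve_cost = (real n * (7 * real n + 4) + 2) + 4 * Y.U.dir_cost + 2 * (real N * 8 + 2) +
     (real N * (11 * real n + 9) + 2)"

lemma crossing_Y:
  assumes "Y.U.dir_ok ok eu u" "Y.D.dir_ok ok ed d" "crossing N eu u ed d"
  shows "\<not> (\<exists>h1 h2. selection h1 h2)"
proof
  assume "\<exists>h1 h2. selection h1 h2"
  then obtain h1 h2 where s: "selection h1 h2" by blast
  have "\<forall>x<N. Y.U.feas x (h1 x) (h2 x)" using selection_feasible[OF s] by (auto simp: Y.U.feas_def)
  then show False using Y.crossing_no_selection[OF assms] s unfolding selection_def by blast
qed

lemma crossing_X:
  assumes "X.U.dir_ok ok eu u" "X.D.dir_ok ok ed d" "crossing N eu u ed d"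
  shows "\<not> (\<exists>h1 h2. selection h1 h2)"
proof
  assume "\<exists>h1 h2. selection h1 h2"
  then obtain h1 h2 where s: "selection h1 h2" by blast
  have "\<forall>x<N. X.U.feas x (h2 x) (h1 x)"
    using selection_feasible[OF s] by (auto simp: X.U.feas_def add.commute)
  then show False using X.crossing_no_selection[OF assms] s unfolding selection_def by blast
qed

lemma solve_spec:
  assumes inp: "all_inputs s0" and 6: "s0 (Var 6) = 0"
  shows "wp solve_prog (\<lambda>s t'. (s (Var 6) = 0 \<and> solution (arr s 22) (arr s 23) \<or>
      s (Var 6) = 1 \<and> \<not> (\<exists>h1 h2. selection h1 h2)) \<and> t' \<ge> t - solve_cost) s0 t"
    (is "wp _ ?Q _ _")
  unfolding solve_prog_def
proof (rule wp_SeqI)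
  show "wp conflict_prog (\<lambda>s' t'. good s' \<and> t' \<ge> t - (real n * (7 * real n + 4) + 2)) s0 t"
  proof (rule wp_conseq_frame[OF conflict_spec[OF inp 6]])
    fix s' t' assume *: "(s' (Var 6) = 0 \<and> Y.no_conflict \<or> s' (Var 6) = 1 \<and> \<not> Y.no_conflict) \<and>
      t' \<ge> t - (real n * (7 * real n + 4) + 2)"
      and fr: "\<And>l. \<not> touches conflict_prog l \<Longrightarrow> s' l = s0 l"
    have "all_inputs s'"
      by (rule all_inputs_frame[OF inp]) (auto intro!: fr simp: conflict_prog_def conflict_inner_touches)
    then show "good s' \<and> t' \<ge> t - (real n * (7 * real n + 4) + 2)"
      using * conflict_no_selection unfolding good_def by auto
  qed
next
  fix s1 t1 assume 1: "good s1 \<and> t1 \<ge> t - (real n * (7 * real n + 4) + 2)"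
  have dirs: "direction il cp N n \<rho> lam p q z 0 1" "direction il cp N n \<rho> lam p (\<lambda>i. - q i) z 0 2"
    "direction il cp N n \<rho> lam q p z 1 0" "direction il cp N n \<rho> lam q (\<lambda>i. - p i) z 1 3"
    by unfold_locales
  note inf = infeasible_no_selection
  show "wp (dir_prog 0 1 12 ;; dir_prog 0 2 14 ;; dir_prog 1 0 16 ;; dir_prog 1 3 18 ;;
     CFor 1 (I (Num 1)) (choose_body 12 14 21) ;; CFor 1 (I (Num 1)) (choose_body 16 18 20) ;;
     CFor 1 (I (Num 1)) project_body) ?Q s1 t1"
  proof (rule wp_SeqI[OF dir_stage[OF dirs(1), of s1 12]])
    show "Y.U.infeasible \<Longrightarrow> \<not> (\<exists>h1 h2. selection h1 h2)" using inf by blast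
    show "all_inputs s \<Longrightarrow> Y.U.inputs s" for s by (simp only: all_inputs_def)
    fix s2 t2
    assume 2: "good s2 \<and> Y.U.dir_ok (s2 (Var 6) = 0) (arr s2 (Suc 12)) (arr s2 12) \<and>
      (s2 (Var 6) = 0 \<longrightarrow> s1 (Var 6) = 0) \<and>
      (\<forall>k. 12 \<le> k \<longrightarrow> k \<noteq> 12 \<longrightarrow> k \<noteq> Suc 12 \<longrightarrow> arr s2 k = arr s1 k) \<and> t2 \<ge> t1 - Y.U.dir_cost"
    show "wp (dir_prog 0 2 14 ;; dir_prog 1 0 16 ;; dir_prog 1 3 18 ;;
       CFor 1 (I (Num 1)) (choose_body 12 14 21) ;; CFor 1 (I (Num 1)) (choose_body 16 18 20) ;;
       CFor 1 (I (Num 1)) project_body) ?Q s2 t2"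
    proof (rule wp_SeqI[OF dir_stage[OF dirs(2), of s2 14]])
      show "Y.D.infeasible \<Longrightarrow> \<not> (\<exists>h1 h2. selection h1 h2)" using inf by blast
      show "all_inputs s \<Longrightarrow> Y.D.inputs s" for s by (simp only: all_inputs_def)
      fix s3 t3
      assume 3: "good s3 \<and> Y.D.dir_ok (s3 (Var 6) = 0) (arr s3 (Suc 14)) (arr s3 14) \<and>
        (s3 (Var 6) = 0 \<longrightarrow> s2 (Var 6) = 0) \<and>
        (\<forall>k. 12 \<le> k \<longrightarrow> k \<noteq> 14 \<longrightarrow> k \<noteq> Suc 14 \<longrightarrow> arr s3 k = arr s2 k) \<and> t3 \<ge> t2 - Y.U.dir_cost"
      show "wp (dir_prog 1 0 16 ;; dir_prog 1 3 18 ;;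
         CFor 1 (I (Num 1)) (choose_body 12 14 21) ;; CFor 1 (I (Num 1)) (choose_body 16 18 20) ;;
         CFor 1 (I (Num 1)) project_body) ?Q s3 t3"
      proof (rule wp_SeqI[OF dir_stage[OF dirs(3), of s3 16]])
        show "X.U.infeasible \<Longrightarrow> \<not> (\<exists>h1 h2. selection h1 h2)" using inf by blast
        show "all_inputs s \<Longrightarrow> X.U.inputs s" for s by (simp only: all_inputs_def)
        fix s4 t4
        assume 4: "good s4 \<and> X.U.dir_ok (s4 (Var 6) = 0) (arr s4 (Suc 16)) (arr s4 16) \<and>
          (s4 (Var 6) = 0 \<longrightarrow> s3 (Var 6) = 0) \<and>
          (\<forall>k. 12 \<le> k \<longrightarrow> k \<noteq> 16 \<longrightarrow> k \<noteq> Suc 16 \<longrightarrow> arr s4 k = arr s3 k) \<and> t4 \<ge> t3 - Y.U.dir_cost"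
        show "wp (dir_prog 1 3 18 ;;
           CFor 1 (I (Num 1)) (choose_body 12 14 21) ;; CFor 1 (I (Num 1)) (choose_body 16 18 20) ;;
           CFor 1 (I (Num 1)) project_body) ?Q s4 t4"
        proof (rule wp_SeqI[OF dir_stage[OF dirs(4), of s4 18]])
          show "X.D.infeasible \<Longrightarrow> \<not> (\<exists>h1 h2. selection h1 h2)" using inf by blast
          show "all_inputs s \<Longrightarrow> X.D.inputs s" for s by (simp only: all_inputs_def)
          fix s5 t5
          assume 5: "good s5 \<and> X.D.dir_ok (s5 (Var 6) = 0) (arr s5 (Suc 18)) (arr s5 18) \<and>
            (s5 (Var 6) = 0 \<longrightarrow> s4 (Var 6) = 0) \<and>
            (\<forall>k. 12 \<le> k \<longrightarrow> k \<noteq> 18 \<longrightarrow> k \<noteq> Suc 18 \<longrightarrow> arr s5 k = arr s4 k) \<and> t5 \<ge> t4 - Y.U.dir_cost"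
          have a: "arr s5 12 = arr s2 12" "arr s5 13 = arr s2 13" "arr s5 14 = arr s3 14" "arr s5 15 = arr s3 15"
            "arr s5 16 = arr s4 16" "arr s5 17 = arr s4 17"
            using 3 4 5 by auto
          have yu: "Y.U.dir_ok (s5 (Var 6) = 0) (arr s5 13) (arr s5 12)"
            using 2 3 4 5 a by (auto intro: Y.U.dir_ok_mono[of "s2 (Var 6) = 0"])
          have yd: "Y.D.dir_ok (s5 (Var 6) = 0) (arr s5 15) (arr s5 14)"
            using 3 4 5 a by (auto intro: Y.D.dir_ok_mono[of "s3 (Var 6) = 0"])
          have xu: "X.U.dir_ok (s5 (Var 6) = 0) (arr s5 17) (arr s5 16)"
            using 4 5 a by (auto intro: X.U.dir_ok_mono[of "s4 (Var 6) = 0"])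
          have xd: "X.D.dir_ok (s5 (Var 6) = 0) (arr s5 19) (arr s5 18)" using 5 by simp
          show "wp (CFor 1 (I (Num 1)) (choose_body 12 14 21) ;; CFor 1 (I (Num 1)) (choose_body 16 18 20) ;;
             CFor 1 (I (Num 1)) project_body) ?Q s5 t5"
          proof (rule wp_SeqI[OF choose_stage])
            show "good s5" using 5 by blast
            show "\<not> (\<exists>h1 h2. selection h1 h2)" if "crossing N (arr s5 (Suc 12)) (arr s5 12) (arr s5 (Suc 14)) (arr s5 14)"
              using crossing_Y[OF yu yd] that by simp
            show "\<forall>x<N. arr s5 (Suc 12) x = 0 \<or> arr s5 (Suc 12) x = 1" using yu by (simp add: Y.U.dir_ok_def)
            show "\<forall>x<N. arr s5 (Suc 14) x = 0 \<or> arr s5 (Suc 14) x = 1" using yd by (simp add: Y.D.dir_ok_def)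
            fix s6 t6
            assume 6: "good s6 \<and>
              (\<forall>x<N. arr s6 21 x = choice (arr s5 (Suc 12)) (arr s5 12) (arr s5 (Suc 14)) (arr s5 14) x) \<and>
              (s6 (Var 6) = 0 \<longrightarrow> s5 (Var 6) = 0 \<and> \<not> crossing N (arr s5 (Suc 12)) (arr s5 12) (arr s5 (Suc 14)) (arr s5 14)) \<and>
              (\<forall>k. 12 \<le> k \<longrightarrow> k \<noteq> 21 \<longrightarrow> arr s6 k = arr s5 k) \<and> t6 \<ge> t5 - (real N * 8 + 2)"
            have a6: "arr s6 k = arr s5 k" if "12 \<le> k" "k \<noteq> 21" for k using 6 that by blast
            show "wp (CFor 1 (I (Num 1)) (choose_body 16 18 20) ;; CFor 1 (I (Num 1)) project_body) ?Q s6 t6"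
            proof (rule wp_SeqI[OF choose_stage])
              show "good s6" using 6 by blast
              show "\<not> (\<exists>h1 h2. selection h1 h2)" if "crossing N (arr s6 (Suc 16)) (arr s6 16) (arr s6 (Suc 18)) (arr s6 18)"
                using crossing_X[OF xu xd] that by (simp add: a6)
              show "\<forall>x<N. arr s6 (Suc 16) x = 0 \<or> arr s6 (Suc 16) x = 1" using xu by (simp add: X.U.dir_ok_def a6)
              show "\<forall>x<N. arr s6 (Suc 18) x = 0 \<or> arr s6 (Suc 18) x = 1" using xd by (simp add: X.D.dir_ok_def a6)
              fix s7 t7
              assume 7: "good s7 \<and>
                (\<forall>x<N. arr s7 20 x = choice (arr s6 (Suc 16)) (arr s6 16) (arr s6 (Suc 18)) (arr s6 18) x) \<and>
                (s7 (Var 6) = 0 \<longrightarrow> s6 (Var 6) = 0 \<and> \<not> crossing N (arr s6 (Suc 16)) (arr s6 16) (arr s6 (Suc 18)) (arr s6 18)) \<and>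
                (\<forall>k. 12 \<le> k \<longrightarrow> k \<noteq> 20 \<longrightarrow> arr s7 k = arr s6 k) \<and> t7 \<ge> t6 - (real N * 8 + 2)"
              have i7: "all_inputs s7" using 7 by (simp add: good_def)
              show "wp (CFor 1 (I (Num 1)) project_body) ?Q s7 t7"
              proof (rule wp_conseq_frame[OF project_spec[OF i7]])
                fix s t'
                assume 8: "(\<forall>x<N. \<exists>d. proj x (arr s7 20 x) (arr s7 21 x) d (arr s 22 x) (arr s 23 x)) \<and>
                  t' \<ge> t7 - (real N * (11 * real n + 9) + 2)"
                  and fr: "\<And>l. \<not> touches (CFor 1 (I (Num 1)) project_body) l \<Longrightarrow> s l = s7 l"
                have v6: "s (Var 6) = s7 (Var 6)" by (rule fr) (simp add: project_body_touches)
                have "solution (arr s 22) (arr s 23)" if z: "s7 (Var 6) = 0"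
                proof (rule choices_solution)
                  have z5: "s6 (Var 6) = 0" "s5 (Var 6) = 0" using 6 7 z by auto
                  show "Y.U.dir_ok True (arr s5 13) (arr s5 12)" "Y.D.dir_ok True (arr s5 15) (arr s5 14)"
                    "X.U.dir_ok True (arr s5 17) (arr s5 16)" "X.D.dir_ok True (arr s5 19) (arr s5 18)"
                    using yu yd xu xd z5 by simp_all
                  show "\<not> crossing N (arr s5 13) (arr s5 12) (arr s5 15) (arr s5 14)" using 6 z5 by simp
                  show "\<not> crossing N (arr s5 17) (arr s5 16) (arr s5 19) (arr s5 18)" using 7 z by (simp add: a6)
                  show "Y.no_conflict" using 7 z by (auto simp: good_def)
                  show "\<forall>x<N. arr s7 20 x = choice (arr s5 17) (arr s5 16) (arr s5 19) (arr s5 18) x"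
                    using 7 by (simp add: a6)
                  show "\<forall>x<N. arr s7 21 x = choice (arr s5 13) (arr s5 12) (arr s5 15) (arr s5 14) x"
                    using 6 7 by simp
                  show "\<forall>x<N. \<exists>d. proj x (arr s7 20 x) (arr s7 21 x) d (arr s 22 x) (arr s 23 x)" using 8 by blast
                qed
                moreover have "t' \<ge> t - solve_cost"
                proof -
                  have "t1 \<ge> t - (real n * (7 * real n + 4) + 2)" "t2 \<ge> t1 - Y.U.dir_cost"
                    "t3 \<ge> t2 - Y.U.dir_cost" "t4 \<ge> t3 - Y.U.dir_cost" "t5 \<ge> t4 - Y.U.dir_cost"
                    "t6 \<ge> t5 - (real N * 8 + 2)" "t7 \<ge> t6 - (real N * 8 + 2)"
                    "t' \<ge> t7 - (real N * (11 * real n + 9) + 2)"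
                    using 1 2 3 4 5 6 7 8 by blast+
                  \<comment> \<open>Stated for arbitrary costs, which hides the nonlinear terms from
                    linear arithmetic.\<close>
                  moreover have "t' \<ge> t - (A + 4 * B + 2 * C + D)"
                    if "t1 \<ge> t - A" "t2 \<ge> t1 - B" "t3 \<ge> t2 - B" "t4 \<ge> t3 - B" "t5 \<ge> t4 - B"
                      "t6 \<ge> t5 - C" "t7 \<ge> t6 - C" "t' \<ge> t7 - D" for A B C D :: real
                    using that by linarith
                  ultimately show ?thesis unfolding solve_cost_def by blast
                qed
                ultimately show "?Q s t'"
                  using 7 v6 unfolding good_def by auto
              qed
            qed simp_all
          qed simp_all
        qed (use 4 in simp_all)
      qed (use 3 in simp_all)
    qed (use 2 in simp_all)
  qed (use 1 in simp_all)
qed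

end

subsection \<open>Input and output of the program\<close>

definition set_abs :: "nat \<Rightarrow> nat \<Rightarrow> com" where
  "set_abs v w = SetV v (V w) ;; CIf Less (V w) (Num 0) (SetV v (Num 0 \<ominus> V w)) CSkip"

lemma (in machine) wp_set_abs:
  assumes "1 \<le> v" "v < 64" "1 \<le> w" "w < 64" "v \<noteq> w"
    and "\<And>t'. t - 3 \<le> t' \<Longrightarrow> Q (s(Var v := \<bar>s (Var w)\<bar>)) t'"
  shows "wp (set_abs v w) Q s t"
  unfolding set_abs_def
  by (intro wp_Seq wp_SetV wp_If wp_Skip)
    (use assms(1-5) assms(6)[of "t - 2"] assms(6)[of "t - 3"] in \<open>simp_all add: abs_if\<close>)

definition read_constraint :: com where
  "read_constraint =
     SetV 33 (I (V 32)) ;; SetV 34 (I (V 32 \<oplus> Num 1)) ;; SetV 35 (I (V 32 \<oplus> Num 2)) ;;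
     set_abs 36 33 ;; set_abs 37 34 ;; SetV 36 (V 36 \<oplus> V 37)"

definition write_constraint :: com where
  "write_constraint =
     SetA 0 (V 3) (V 33 \<oslash> V 36) ;; SetA 1 (V 3) (V 34 \<oslash> V 36) ;;
     SetA 2 (V 3) (Num 0 \<ominus> V 34 \<oslash> V 36) ;; SetA 3 (V 3) (Num 0 \<ominus> V 33 \<oslash> V 36) ;;
     SetA 4 (V 3) ((Num 0 \<ominus> V 35) \<oslash> V 36) ;; SetA 5 (V 3) (V 1) ;;
     SetV 3 (V 3 \<oplus> Num 1) ;; SetV 32 (V 32 \<oplus> Num 3)"

definition normalise_body :: com where
  "normalise_body = read_constraint ;; write_constraint"

lemma idx_plus: "idx (real m + 1) = Suc m" "idx (real m + numeral k) = m + numeral k"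
    "is_index j (real m + 1) \<longleftrightarrow> Suc m < j" "is_index j (real m + numeral k) \<longleftrightarrow> m + numeral k < j"
  using idx_of_nat[of "Suc m"] idx_of_nat[of "m + numeral k"] is_index_of_nat[of j "Suc m"]
    is_index_of_nat[of j "m + numeral k"]
  by (simp_all del: idx_of_nat is_index_of_nat add: add.commute)

lemma (in machine) read_constraint_spec:
  assumes "s (Var 32) = real m" "m + 2 < il"
  shows "wp read_constraint (\<lambda>s' t'. s' (Var 33) = s (Inp m) \<and> s' (Var 34) = s (Inp (m + 1)) \<and>
    s' (Var 35) = s (Inp (m + 2)) \<and> s' (Var 36) = \<bar>s (Inp m)\<bar> + \<bar>s (Inp (m + 1))\<bar> \<and> t' \<ge> t - 10) s t"
  unfolding read_constraint_def
  by (intro wp_Seq wp_SetV wp_set_abs) (use assms in \<open>simp_all add: idx_plus\<close>)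

lemma (in machine) write_constraint_spec:
  assumes "s (Var 3) = real n" "n < cp" "s (Var 36) = w" "w \<noteq> 0" "s (Var 1) = real x"
    and "s (Var 33) = h1" "s (Var 34) = h2" "s (Var 35) = c"
  shows "wp write_constraint (\<lambda>s' t'. s' (Var 32) = s (Var 32) + 3 \<and> s' (Var 3) = real (Suc n) \<and>
    arr s' 0 = (arr s 0)(n := h1 / w) \<and> arr s' 1 = (arr s 1)(n := h2 / w) \<and>
    arr s' 2 = (arr s 2)(n := - (h2 / w)) \<and> arr s' 3 = (arr s 3)(n := - (h1 / w)) \<and>
    arr s' 4 = (arr s 4)(n := - c / w) \<and> arr s' 5 = (arr s 5)(n := real x) \<and> t' \<ge> t - 8) s t"
  unfolding write_constraint_def
  by (intro wp_Seq wp_SetV wp_SetA) (use assms in simp_all)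

text \<open>The read pointer is recomputed for every point, which skips the padding behind a short
  list.\<close>

definition load_body :: com where
  "load_body =
     SetV 32 (Num 3 \<oplus> I (Num 1) \<otimes> I (Num 1) \<oplus> V 1 \<otimes> (Num 1 \<oplus> Num 3 \<otimes> I (Num 0))) ;;
     SetV 38 (I (V 32)) ;; SetV 32 (V 32 \<oplus> Num 1) ;; CFor 2 (V 38) normalise_body"

definition load_prog :: com where
  "load_prog = SetV 3 (Num 0) ;; CFor 1 (I (Num 1)) load_body"

text \<open>N is saved first, since the output overwrites the input from cell 1 on.\<close>

definition output_prog :: com where
  "output_prog = SetV 39 (I (Num 1)) ;;
     CIf Leq (V 6) (Num 0)
       (CFor 1 (V 39) (SetI (Num 1 \<oplus> Num 2 \<otimes> V 1) (A 22 (V 1)) ;;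
          SetI (Num 2 \<oplus> Num 2 \<otimes> V 1) (A 23 (V 1))) ;;
        SetI (Num 0) (Num 1))
       (SetI (Num 0) (Num 0))"

text \<open>All arrays share one capacity: it suffices for N L constraints and, when L is at least
  1, for N points; the additional cell keeps it positive.\<close>

locale loaded = machine il cp for il cp :: nat +
  fixes L N :: nat and H :: "nat \<Rightarrow> linear_constraint list"
  assumes il: "il = 3 + N * N + N * (1 + 3 * L)" and cp: "cp = N * L + 1"
    and len: "x < N \<Longrightarrow> length (H x) \<le> L"
    and nonzero: "x < N \<Longrightarrow> c \<in> set (H x) \<Longrightarrow> fst c \<noteq> 0"
begin

definition offset :: "nat \<Rightarrow> nat" where "offset x = 3 + N * N + x * (1 + 3 * L)"

definition constraints_in :: "state \<Rightarrow> bool" where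
  "constraints_in s \<longleftrightarrow> s (Inp 0) = real L \<and> s (Inp 1) = real N \<and>
     (\<forall>x<N. s (Inp (offset x)) = real (length (H x)) \<and>
       (\<forall>k<length (H x). s (Inp (offset x + 1 + 3 * k)) = fst (fst (H x ! k)) \<and>
          s (Inp (offset x + 2 + 3 * k)) = snd (fst (H x ! k)) \<and>
          s (Inp (offset x + 3 + 3 * k)) = snd (H x ! k)))"

lemma offset_bound: "x < N \<Longrightarrow> offset x + 1 + 3 * L \<le> il"
proof -
  assume "x < N"
  then have "Suc x * (1 + 3 * L) \<le> N * (1 + 3 * L)" by (intro mult_right_mono) auto
  then show ?thesis by (simp add: offset_def il)
qed

definition normalised :: "state \<Rightarrow> nat \<Rightarrow> nat \<Rightarrow> bool" where
  "normalised s n x \<longleftrightarrow> (\<forall>i<n. (\<exists>z<x. arr s 5 i = real z) \<and> \<bar>arr s 0 i\<bar> + \<bar>arr s 1 i\<bar> = 1 \<and>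
     arr s 2 i = - arr s 1 i \<and> arr s 3 i = - arr s 0 i)"

definition represents :: "state \<Rightarrow> nat \<Rightarrow> nat \<Rightarrow> linear_constraint list \<Rightarrow> bool" where
  "represents s n x cs \<longleftrightarrow> (\<forall>u. (\<forall>c\<in>set cs. u \<in> half_plane c) \<longleftrightarrow>
     (\<forall>i<n. arr s 5 i = real x \<longrightarrow> arr s 0 i * fst u + arr s 1 i * snd u \<le> arr s 4 i))"

lemma half_plane_normalised:
  assumes "fst c \<noteq> 0" "w = \<bar>fst (fst c)\<bar> + \<bar>snd (fst c)\<bar>"
  shows "0 < w" "u \<in> half_plane c \<longleftrightarrow> fst (fst c) / w * fst u + snd (fst c) / w * snd u \<le> - snd c / w"
    "\<bar>fst (fst c) / w\<bar> + \<bar>snd (fst c) / w\<bar> = 1"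
proof -
  show w: "0 < w" using assms by (cases "fst c") (auto simp: zero_prod_def)
  have e: "fst (fst c) / w * fst u + snd (fst c) / w * snd u = (fst (fst c) * fst u + snd (fst c) * snd u) / w"
    by (simp add: add_divide_distrib)
  have "u \<in> half_plane c \<longleftrightarrow> fst (fst c) * fst u + snd (fst c) * snd u \<le> - snd c"
    by (auto simp: half_plane_def inner_prod_def)
  also have "\<dots> \<longleftrightarrow> (fst (fst c) * fst u + snd (fst c) * snd u) / w \<le> - snd c / w"
    using divide_le_cancel[of _ w "- snd c"] w by simp
  finally show "u \<in> half_plane c \<longleftrightarrow> fst (fst c) / w * fst u + snd (fst c) / w * snd u \<le> - snd c / w"
    unfolding e .
  have "\<bar>fst (fst c) / w\<bar> + \<bar>snd (fst c) / w\<bar> = (\<bar>fst (fst c)\<bar> + \<bar>snd (fst c)\<bar>) / w"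
    using w by (simp add: add_divide_distrib)
  also have "\<dots> = 1" using w assms(2) by simp
  finally show "\<bar>fst (fst c) / w\<bar> + \<bar>snd (fst c) / w\<bar> = 1" .
qed

lemma normalise_body_touches: "touches normalise_body l \<longleftrightarrow>
    l \<in> {Var 3, Var 32, Var 33, Var 34, Var 35, Var 36, Var 37} \<or> (\<exists>k\<in>{..5}. \<exists>j. l = Arr k j)"
proof -
  have "{..5::nat} = {0, 1, 2, 3, 4, 5}" by auto
  then show ?thesis by (auto simp: normalise_body_def read_constraint_def write_constraint_def set_abs_def)
qed

lemma normalise_step:
  assumes s: "s (Var 1) = real x" "x < N" "s (Var 32) = real (offset x + 1 + 3 * k)" "s (Var 3) = real n"
    and k: "k < length (H x)" and n: "n < cp" and inp: "constraints_in s"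
    and wf: "normalised s n (Suc x)" and rep: "\<forall>x'<x. represents s n x' (H x')" "represents s n x (take k (H x))"
  shows "wp normalise_body (\<lambda>s' t'. s' (Var 32) = real (offset x + 1 + 3 * Suc k) \<and> s' (Var 3) = real (Suc n) \<and>
    normalised s' (Suc n) (Suc x) \<and> (\<forall>x'<x. represents s' (Suc n) x' (H x')) \<and>
    represents s' (Suc n) x (take (Suc k) (H x)) \<and> t' \<ge> t - 20) s t"
proof -
  define c where "c = H x ! k"
  define h1 where "h1 = fst (fst c)"
  define h2 where "h2 = snd (fst c)"
  define w where "w = \<bar>h1\<bar> + \<bar>h2\<bar>"
  have cs: "c \<in> set (H x)" using k by (simp add: c_def)
  note hp = half_plane_normalised[OF nonzero[OF s(2) cs] w_def[unfolded h1_def h2_def], folded h1_def h2_def]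
  have v: "s (Inp (offset x + 1 + 3 * k)) = h1" "s (Inp (offset x + 2 + 3 * k)) = h2" "s (Inp (offset x + 3 + 3 * k)) = snd c"
    using inp s(2) k unfolding constraints_in_def h1_def h2_def c_def by auto
  have o: "offset x + 3 + 3 * k < il" using offset_bound[OF s(2)] len[OF s(2)] k by linarith
  have off: "real (offset x + 1 + 3 * k) + 1 = real (offset x + 2 + 3 * k)"
    "real (offset x + 1 + 3 * k) + 2 = real (offset x + 3 + 3 * k)"
    "real (offset x + 1 + 3 * k) + 3 = real (offset x + 1 + 3 * Suc k)" by simp_all
  define post where "post = (\<lambda>s' t'. s' (Var 32) = real (offset x + 1 + 3 * Suc k) \<and> s' (Var 3) = real (Suc n) \<and>
    normalised s' (Suc n) (Suc x) \<and> (\<forall>x'<x. represents s' (Suc n) x' (H x')) \<and>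
    represents s' (Suc n) x (take (Suc k) (H x)) \<and> t' \<ge> t - 20)"
  have fin: "post s1 t'" if s1: "s1 (Var 32) = real (offset x + 1 + 3 * Suc k)" "s1 (Var 3) = real (Suc n)"
      "arr s1 0 = (arr s 0)(n := h1 / w)" "arr s1 1 = (arr s 1)(n := h2 / w)"
      "arr s1 2 = (arr s 2)(n := - (h2 / w))" "arr s1 3 = (arr s 3)(n := - (h1 / w))"
      "arr s1 4 = (arr s 4)(n := - snd c / w)" "arr s1 5 = (arr s 5)(n := real x)"
      and t': "t' \<ge> t - 20" for s1 t'
    unfolding post_def
  proof (intro conjI allI impI)
    show "normalised s1 (Suc n) (Suc x)"
      unfolding normalised_def
    proof (intro allI impI)
      fix i assume i: "i < Suc n"
      show "(\<exists>z<Suc x. arr s1 5 i = real z) \<and> \<bar>arr s1 0 i\<bar> + \<bar>arr s1 1 i\<bar> = 1 \<and>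
        arr s1 2 i = - arr s1 1 i \<and> arr s1 3 i = - arr s1 0 i"
      proof (cases "i = n")
        case True
        then show ?thesis using hp(3) by (auto simp: s1 simp del: One_nat_def)
      next
        case False
        then show ?thesis using wf i unfolding normalised_def by (auto simp: s1 simp del: One_nat_def)
      qed
    qed
    show "represents s1 (Suc n) x' (H x')" if "x' < x" for x'
    proof -
      have "(\<forall>i<Suc n. arr s1 5 i = real x' \<longrightarrow> arr s1 0 i * fst u + arr s1 1 i * snd u \<le> arr s1 4 i) \<longleftrightarrow>
        (\<forall>i<n. arr s 5 i = real x' \<longrightarrow> arr s 0 i * fst u + arr s 1 i * snd u \<le> arr s 4 i)" for u
        using that by (auto simp: s1 less_Suc_eq simp del: One_nat_def)
      then show ?thesis using rep(1) that unfolding represents_def by simp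
    qed
    show "represents s1 (Suc n) x (take (Suc k) (H x))"
      unfolding represents_def
    proof
      fix u
      have "(\<forall>c\<in>set (take (Suc k) (H x)). u \<in> half_plane c) \<longleftrightarrow>
        (\<forall>c\<in>set (take k (H x)). u \<in> half_plane c) \<and> u \<in> half_plane c"
        using k by (auto simp: take_Suc_conv_app_nth c_def)
      also have "\<dots> \<longleftrightarrow> (\<forall>i<n. arr s 5 i = real x \<longrightarrow> arr s 0 i * fst u + arr s 1 i * snd u \<le> arr s 4 i) \<and>
         h1 / w * fst u + h2 / w * snd u \<le> - snd c / w"
        using rep(2) hp(2) unfolding represents_def by blast
      also have "\<dots> \<longleftrightarrow> (\<forall>i<Suc n. arr s1 5 i = real x \<longrightarrow> arr s1 0 i * fst u + arr s1 1 i * snd u \<le> arr s1 4 i)"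
        by (auto simp: s1 less_Suc_eq simp del: One_nat_def)
      finally show "(\<forall>c\<in>set (take (Suc k) (H x)). u \<in> half_plane c) \<longleftrightarrow>
        (\<forall>i<Suc n. arr s1 5 i = real x \<longrightarrow> arr s1 0 i * fst u + arr s1 1 i * snd u \<le> arr s1 4 i)" .
    qed
  qed (use s1 t' in auto)
  have o2: "offset x + 1 + 3 * k + 2 < il" using o by simp
  have "wp normalise_body post s t" unfolding normalise_body_def
  proof (rule wp_Seq, rule wp_conseq_frame[OF read_constraint_spec[where s = s and m = "offset x + 1 + 3 * k", OF s(3) o2]])
    fix s2 t2
    assume *: "s2 (Var 33) = s (Inp (offset x + 1 + 3 * k)) \<and> s2 (Var 34) = s (Inp (offset x + 1 + 3 * k + 1)) \<and>
      s2 (Var 35) = s (Inp (offset x + 1 + 3 * k + 2)) \<and>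
      s2 (Var 36) = \<bar>s (Inp (offset x + 1 + 3 * k))\<bar> + \<bar>s (Inp (offset x + 1 + 3 * k + 1))\<bar> \<and> t2 \<ge> t - 10"
      and fr: "\<And>l. \<not> touches read_constraint l \<Longrightarrow> s2 l = s l"
    have v2: "s2 (Var 3) = real n" "s2 (Var 1) = real x" "s2 (Var 32) = real (offset x + 1 + 3 * k)" "\<And>k. arr s2 k = arr s k"
      using fr s by (auto simp: read_constraint_def set_abs_def arr_def)
    have i: "offset x + 1 + 3 * k + 1 = offset x + 2 + 3 * k" "offset x + 1 + 3 * k + 2 = offset x + 3 + 3 * k" by simp_all
    have r: "s2 (Var 33) = h1" "s2 (Var 34) = h2" "s2 (Var 35) = snd c" "s2 (Var 36) = w"
      using * unfolding i v w_def by auto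
    show "wp write_constraint post s2 t2"
    proof (rule wp_conseq[OF write_constraint_spec[OF v2(1) n r(4) _ v2(2) r(1-3)]])
      show "w \<noteq> 0" using hp(1) by simp
    qed (rule fin, use * v2 off(3) in auto)
  qed
  then show ?thesis unfolding post_def .
qed

lemma constraints_in_frame: "constraints_in s \<Longrightarrow> (\<And>i. s' (Inp i) = s (Inp i)) \<Longrightarrow> constraints_in s'"
  by (simp add: constraints_in_def)

text \<open>All owners recorded so far lie below x, so x owns no constraint yet.\<close>

lemma represents_Nil: "normalised s n x \<Longrightarrow> represents s n x []"
  by (auto simp: represents_def normalised_def)

lemma normalised_mono: "normalised s n x \<Longrightarrow> normalised s n (Suc x)"
  unfolding normalised_def by (meson less_SucI)

lemma normalise_for:
  assumes s0: "s0 (Var 1) = real x" "x < N" "s0 (Var 38) = real (length (H x))" "s0 (Var 32) = real (offset x + 1)"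
      "s0 (Var 3) = real n0" "n0 \<le> x * L"
    and inp: "constraints_in s0" and wf: "normalised s0 n0 x" and rep: "\<forall>x'<x. represents s0 n0 x' (H x')"
  shows "wp (CFor 2 (V 38) normalise_body) (\<lambda>s t'. \<exists>n\<le>Suc x * L. s (Var 3) = real n \<and>
      normalised s n (Suc x) \<and> (\<forall>x'<Suc x. represents s n x' (H x')) \<and> t' \<ge> t - (22 * real L + 2)) s0 t"
proof -
  define J where "J = (\<lambda>k (s::state). \<exists>n\<le>x * L + k. s (Var 32) = real (offset x + 1 + 3 * k) \<and> s (Var 3) = real n \<and>
    normalised s n (Suc x) \<and> (\<forall>x'<x. represents s n x' (H x')) \<and> represents s n x (take k (H x)))"
  have ins: "normalised (s(Var v := w)) n y = normalised s n y" "represents (s(Var v := w)) n y cs = represents s n y cs"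
    for s v w n y cs by (simp_all add: normalised_def represents_def)
  have "wp (CFor 2 (V 38) normalise_body) (\<lambda>s' t'. J (length (H x)) s' \<and> s' (Var 2) = real (length (H x)) \<and>
      t' + 0 \<ge> t + 0 - (real (length (H x)) * (20 + 2) + 2)) s0 t"
  proof (rule wp_For[where \<phi> = "\<lambda>_. 0"])
    show "J 0 s0" unfolding J_def
      using s0 rep represents_Nil[OF wf] normalised_mono[OF wf] by (intro exI[of _ n0]) auto
    show "J i (s(Var 2 := w)) = J i s" for i s w unfolding J_def ins by simp
  next
    fix k s
    assume "\<And>l. l \<noteq> Var 2 \<Longrightarrow> \<not> touches normalise_body l \<Longrightarrow> s l = s0 l"
    from this[of "Var 38"] show "safe s (V 38) \<and> aval s (V 38) = real (length (H x))"
      using s0 by (simp add: normalise_body_touches)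
  next
    fix k s and t :: real assume k: "k < length (H x)" and J: "J k s" and v: "s (Var 2) = real k"
      and fr: "\<And>l. l \<noteq> Var 2 \<Longrightarrow> \<not> touches normalise_body l \<Longrightarrow> s l = s0 l"
    obtain n where n: "n \<le> x * L + k" "s (Var 32) = real (offset x + 1 + 3 * k)" "s (Var 3) = real n"
      "normalised s n (Suc x)" "\<forall>x'<x. represents s n x' (H x')" "represents s n x (take k (H x))"
      using J unfolding J_def by blast
    have i: "constraints_in s" by (rule constraints_in_frame[OF inp]) (auto intro!: fr simp: normalise_body_touches)
    have v1: "s (Var 1) = real x" using fr s0 by (simp add: normalise_body_touches)
    have "Suc x * L \<le> N * L" using s0(2) by (intro mult_right_mono) auto
    then have ncp: "n < cp" using n(1) k len[OF s0(2)] by (simp add: cp)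
    show "wp normalise_body (\<lambda>s' t'. s' (Var 2) = real k \<and> J (Suc k) s' \<and> t' + 0 \<ge> t + 0 - 20) s t"
    proof (rule wp_conseq_frame[OF normalise_step[OF v1 s0(2) n(2,3) k ncp i n(4-6)]])
      fix s' t' assume *: "s' (Var 32) = real (offset x + 1 + 3 * Suc k) \<and> s' (Var 3) = real (Suc n) \<and>
        normalised s' (Suc n) (Suc x) \<and> (\<forall>x'<x. represents s' (Suc n) x' (H x')) \<and>
        represents s' (Suc n) x (take (Suc k) (H x)) \<and> t' \<ge> t - 20"
        and fr': "\<And>l. \<not> touches normalise_body l \<Longrightarrow> s' l = s l"
      have "s' (Var 2) = real k" using fr' v by (simp add: normalise_body_touches)
      moreover have "J (Suc k) s'" unfolding J_def using * n(1) by (intro exI[of _ "Suc n"]) simp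
      ultimately show "s' (Var 2) = real k \<and> J (Suc k) s' \<and> t' + 0 \<ge> t + 0 - 20" using * by simp
    qed
  qed simp_all
  then show ?thesis
  proof (rule wp_conseq)
    fix s t' assume *: "J (length (H x)) s \<and> s (Var 2) = real (length (H x)) \<and>
      t' + 0 \<ge> t + 0 - (real (length (H x)) * (20 + 2) + 2)"
    then obtain n where n: "n \<le> x * L + length (H x)" "s (Var 3) = real n"
      "normalised s n (Suc x)" "\<forall>x'<x. represents s n x' (H x')" "represents s n x (H x)"
      unfolding J_def by auto
    have "real (length (H x)) \<le> real L" using len[OF s0(2)] by simp
    moreover have "t' \<ge> t - (real (length (H x)) * 22 + 2)" using * by simp
    ultimately have "t' \<ge> t - (22 * real L + 2)" by linarith
    then show "\<exists>n\<le>Suc x * L. s (Var 3) = real n \<and>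
      normalised s n (Suc x) \<and> (\<forall>x'<Suc x. represents s n x' (H x')) \<and> t' \<ge> t - (22 * real L + 2)"
      using n len[OF s0(2)] by (intro exI[of _ n]) (auto simp: less_Suc_eq)
  qed
qed

lemma load_body_touches: "touches load_body l \<longleftrightarrow>
    l \<in> {Var 2, Var 32, Var 38} \<or> touches normalise_body l"
  by (auto simp: load_body_def)

lemma load_spec:
  assumes inp: "constraints_in s0"
  shows "wp load_prog (\<lambda>s t'. \<exists>n\<le>N * L. s (Var 3) = real n \<and>
      normalised s n N \<and> (\<forall>x<N. represents s n x (H x)) \<and> t' \<ge> t - (real N * (22 * real L + 7) + 3)) s0 t"
proof -
  define J where "J = (\<lambda>x (s::state). \<exists>n\<le>x * L. s (Var 3) = real n \<and>
    normalised s n x \<and> (\<forall>x'<x. represents s n x' (H x')))"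
  have ins: "normalised (s(Var v := w)) n y = normalised s n y" "represents (s(Var v := w)) n y cs = represents s n y cs"
    for s v w n y cs by (simp_all add: normalised_def represents_def)
  have il1: "Suc 0 < il" by (simp add: il)
  define s1 where "s1 = s0(Var 3 := 0)"
  have "wp (CFor 1 (I (Num 1)) load_body) (\<lambda>s' t'. J N s' \<and> s' (Var 1) = real N \<and>
      t' + 0 \<ge> (t - 1) + 0 - (real N * (22 * real L + 5 + 2) + 2)) s1 (t - 1)"
  proof (rule wp_For[where \<phi> = "\<lambda>_. 0"])
    show "J 0 s1" by (simp add: J_def s1_def normalised_def)
    show "J i (s(Var 1 := w)) = J i s" for i s w unfolding J_def ins by simp
  next
    fix k s
    assume "\<And>l. l \<noteq> Var 1 \<Longrightarrow> \<not> touches load_body l \<Longrightarrow> s l = s1 l"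
    from this[of "Inp 1"] show "safe s (I (Num 1)) \<and> aval s (I (Num 1)) = real N"
      using inp by (simp add: load_body_touches normalise_body_touches s1_def constraints_in_def il1)
  next
    fix x s and t :: real assume x: "x < N" and J: "J x s" and v: "s (Var 1) = real x"
      and fr: "\<And>l. l \<noteq> Var 1 \<Longrightarrow> \<not> touches load_body l \<Longrightarrow> s l = s1 l"
    have i: "constraints_in s"
      by (rule constraints_in_frame[OF inp]) (use fr in \<open>auto simp: load_body_touches normalise_body_touches s1_def\<close>)
    obtain n where n: "n \<le> x * L" "s (Var 3) = real n" "normalised s n x" "\<forall>x'<x. represents s n x' (H x')"
      using J unfolding J_def by blast
    have iv: "s (Inp 0) = real L" "s (Inp 1) = real N" "s (Inp (offset x)) = real (length (H x))"
      using i x by (auto simp: constraints_in_def)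
    have o: "offset x < il" "1 < il" using offset_bound[OF x] by (simp_all add: il)
    have oe: "3 + real N * real N + real x * (1 + 3 * real L) = real (offset x)"
      by (simp add: offset_def algebra_simps)
    define s2 where "s2 = s(Var 32 := real (offset x), Var 38 := real (length (H x)), Var 32 := real (offset x + 1))"
    define W where "W = CFor 2 (V 38) normalise_body"
    define Q where "Q = (\<lambda>s' t'. s' (Var 1) = real x \<and> J (Suc x) s' \<and> t' + 0 \<ge> t + 0 - (22 * real L + 5))"
    have "wp W Q s2 (t - 3)" unfolding W_def
    proof (rule wp_conseq_frame[OF normalise_for])
      show "normalised s2 n x" "\<forall>x'<x. represents s2 n x' (H x')" using n unfolding s2_def ins by auto
      show "constraints_in s2" by (rule constraints_in_frame[OF i]) (simp add: s2_def)
      fix s' t' assume *: "\<exists>n\<le>Suc x * L. s' (Var 3) = real n \<and>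
        normalised s' n (Suc x) \<and> (\<forall>x'<Suc x. represents s' n x' (H x')) \<and> t' \<ge> t - 3 - (22 * real L + 2)"
        and fr': "\<And>l. \<not> touches (CFor 2 (V 38) normalise_body) l \<Longrightarrow> s' l = s2 l"
      have "s' (Var 1) = real x" using fr' v by (simp add: normalise_body_touches s2_def)
      moreover have "J (Suc x) s'" using * unfolding J_def by blast
      ultimately show "Q s' t'" using * by (auto simp: Q_def)
    qed (use v x n in \<open>simp_all add: s2_def\<close>)
    then have "wp load_body Q s t"
      unfolding load_body_def W_def[symmetric]
      by (intro wp_Seq wp_SetV) (use v iv o oe in \<open>simp_all add: s2_def add.commute\<close>)
    then show "wp load_body (\<lambda>s' t'. s' (Var 1) = real x \<and> J (Suc x) s' \<and> t' + 0 \<ge> t + 0 - (22 * real L + 5)) s t"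
      by (simp add: Q_def)
  qed simp_all
  then have "wp (CFor 1 (I (Num 1)) load_body) (\<lambda>s t'. \<exists>n\<le>N * L. s (Var 3) = real n \<and>
      normalised s n N \<and> (\<forall>x<N. represents s n x (H x)) \<and> t' \<ge> t - (real N * (22 * real L + 7) + 3)) s1 (t - 1)"
    by (rule wp_conseq) (auto simp: J_def algebra_simps)
  then show ?thesis unfolding load_prog_def
    by (intro wp_Seq wp_SetV) (simp_all add: s1_def)
qed

lemma output_spec:
  assumes inp: "s0 (Inp 1) = real N" and L: "1 \<le> L" and v6: "s0 (Var 6) = 0 \<or> s0 (Var 6) = 1"
  shows "wp output_prog (\<lambda>s t'. (s0 (Var 6) = 0 \<longrightarrow> s (Inp 0) = 1 \<and>
        (\<forall>x<N. s (Inp (1 + 2 * x)) = arr s0 22 x \<and> s (Inp (2 + 2 * x)) = arr s0 23 x)) \<and>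
      (s0 (Var 6) = 1 \<longrightarrow> s (Inp 0) = 0) \<and> t' \<ge> t - (real N * 4 + 6)) s0 t"
    (is "wp _ ?Q _ _")
proof -
  have il1: "1 < il" by (simp add: il)
  define s1 where "s1 = s0(Var 39 := real N)"
  define body where "body = (SetI (Num 1 \<oplus> Num 2 \<otimes> V 1) (A 22 (V 1)) ;; SetI (Num 2 \<oplus> Num 2 \<otimes> V 1) (A 23 (V 1)))"
  define fin where "fin = SetI (Num 0) (Num 1)"
  have t_body: "touches body l \<longleftrightarrow> (\<exists>i. l = Inp i)" for l by (auto simp: body_def)
  show ?thesis
  proof (cases "s0 (Var 6) = 0")
    case True
    define J where "J = (\<lambda>k (s::state). \<forall>x<k. s (Inp (1 + 2 * x)) = arr s0 22 x \<and> s (Inp (2 + 2 * x)) = arr s0 23 x)"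
    have "wp (CFor 1 (V 39) body) (\<lambda>s' t'. J N s' \<and> s' (Var 1) = real N \<and>
        t' + 0 \<ge> (t - 2) + 0 - (real N * (2 + 2) + 2)) s1 (t - 2)"
    proof (rule wp_For[where \<phi> = "\<lambda>_. 0"])
      show "J 0 s1" by (simp add: J_def)
    next
      fix k s
      assume "\<And>l. l \<noteq> Var 1 \<Longrightarrow> \<not> touches body l \<Longrightarrow> s l = s1 l"
      from this[of "Var 39"] show "safe s (V 39) \<and> aval s (V 39) = real N" by (simp add: t_body s1_def)
    next
      fix x s and t :: real assume x: "x < N" and J: "J x s" and v: "s (Var 1) = real x"
        and fr: "\<And>l. l \<noteq> Var 1 \<Longrightarrow> \<not> touches body l \<Longrightarrow> s l = s1 l"
      have a: "arr s 22 = arr s0 22" "arr s 23 = arr s0 23" using fr by (auto simp: t_body arr_def s1_def)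
      have "x < cp" using x mult_le_mono2[OF L, of N] cp by linarith
      \<comment> \<open>For \<open>1 \<le> L\<close> the constraint block has at least 4 cells per
        point, which is room enough for the verdict and two coordinates per point.\<close>
      have "N * 4 \<le> N * (1 + 3 * L)" using L by (intro mult_left_mono) auto
      then have o: "2 + 2 * x < il" "1 + 2 * x < il" using x il by linarith+
      have e: "1 + 2 * real x = real (1 + 2 * x)" "2 + 2 * real x = real (2 + 2 * x)" by simp_all
      have ii: "idx (1 + 2 * real x) = 1 + 2 * x" "idx (2 + 2 * real x) = 2 + 2 * x"
        "is_index il (1 + 2 * real x)" "is_index il (2 + 2 * real x)"
        using o unfolding e by (simp_all only: idx_of_nat is_index_of_nat)
      define s2 where "s2 = s(Inp (1 + 2 * x) := arr s0 22 x, Inp (2 + 2 * x) := arr s0 23 x)"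
      have "J (Suc x) s2" using J unfolding J_def s2_def by (auto simp: less_Suc_eq)
      then show "wp body (\<lambda>s' t'. s' (Var 1) = real x \<and> J (Suc x) s' \<and> t' + 0 \<ge> t + 0 - 2) s t"
        unfolding body_def
        by (intro wp_Seq wp_SetI)
          (use v o a \<open>x < cp\<close> ii in \<open>simp_all add: s2_def Arr_arr\<close>)
    qed (simp_all add: J_def)
    then have "wp (CFor 1 (V 39) body) (wp fin ?Q) s1 (t - 2)"
    proof (rule wp_conseq)
      fix s t' assume *: "J N s \<and> s (Var 1) = real N \<and> t' + 0 \<ge> (t - 2) + 0 - (real N * (2 + 2) + 2)"
      show "wp fin ?Q s t'" unfolding fin_def
        by (rule wp_SetI) (use * il1 True in \<open>simp_all add: J_def\<close>)
    qed
    then have "wp (CFor 1 (V 39) body ;; fin) ?Q s1 (t - 2)" by (rule wp_Seq)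
    moreover define D where "D = (CFor 1 (V 39) body ;; fin)"
    ultimately have "wp D ?Q s1 (t - 2)" by simp
    then show ?thesis unfolding output_prog_def body_def[symmetric] fin_def[symmetric] D_def[symmetric]
      by (intro wp_Seq wp_SetV wp_If) (use True inp il1 in \<open>simp_all add: s1_def\<close>)
  next
    case False
    then have 1: "s0 (Var 6) = 1" using v6 by simp
    define D where "D = (CFor 1 (V 39) body ;; fin)"
    show ?thesis unfolding output_prog_def body_def[symmetric] fin_def[symmetric] D_def[symmetric]
      by (intro wp_Seq wp_SetV wp_If wp_SetI) (use 1 inp il1 in simp_all)
  qed
qed

end

section \<open>Layout of the input and meaning of encoded distances\<close>

lemma length_concat_uniform:
  "(\<And>x. x \<in> set xs \<Longrightarrow> length (g x) = m) \<Longrightarrow> length (concat (map g xs)) = length xs * m"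
  by (induction xs) auto

lemma nth_concat_uniform:
  assumes "\<And>x. x \<in> set xs \<Longrightarrow> length (g x) = m" "k < length xs" "j < m"
  shows "concat (map g xs) ! (k * m + j) = g (xs ! k) ! j"
  using assms
proof (induction xs arbitrary: k)
  case (Cons x xs)
  show ?case
  proof (cases k)
    case 0
    then show ?thesis using Cons by (simp add: nth_append)
  next
    case (Suc k')
    then have "concat (map g (x # xs)) ! (k * m + j) = concat (map g xs) ! (k' * m + j)"
      using Cons.prems(1)[of x] by (simp add: nth_append)
    then show ?thesis using Cons Suc by simp
  qed
qed simp

lemma length_encode_constraints: "length cs \<le> L \<Longrightarrow> length (encode_constraints L cs) = 1 + 3 * L"
  using length_concat_uniform[of cs "\<lambda>((h1, h2), \<alpha>). [h1, h2, \<alpha>]" 3]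
  by (auto simp: encode_constraints_def split: prod.splits)

lemma nth_encode_constraints:
  assumes "k < length cs"
  shows "encode_constraints L cs ! (1 + 3 * k) = fst (fst (cs ! k))"
    "encode_constraints L cs ! (2 + 3 * k) = snd (fst (cs ! k))"
    "encode_constraints L cs ! (3 + 3 * k) = snd (cs ! k)"
proof -
  have *: "encode_constraints L cs ! (Suc (3 * k + j)) =
      (case cs ! k of ((h1, h2), \<alpha>) \<Rightarrow> [h1, h2, \<alpha>]) ! j" if "j < 3" for j
  proof -
    have l: "length (concat (map (\<lambda>((h1, h2), \<alpha>). [h1, h2, \<alpha>]) cs)) = length cs * 3"
      by (rule length_concat_uniform) auto
    have "concat (map (\<lambda>((h1, h2), \<alpha>). [h1, h2, \<alpha>]) cs) ! (k * 3 + j) =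
        (case cs ! k of ((h1, h2), \<alpha>) \<Rightarrow> [h1, h2, \<alpha>]) ! j"
      using nth_concat_uniform[of cs "\<lambda>((h1, h2), \<alpha>). [h1, h2, \<alpha>]" 3 k j] assms that
      by (auto split: prod.splits)
    moreover have "3 * k + j < length cs * 3" using assms that by linarith
    ultimately show ?thesis using l by (simp add: encode_constraints_def nth_append mult.commute)
  qed
  obtain h1 h2 \<alpha> where c: "cs ! k = ((h1, h2), \<alpha>)" by (metis prod.exhaust)
  show "encode_constraints L cs ! (1 + 3 * k) = fst (fst (cs ! k))" using *[of 0] c by simp
  show "encode_constraints L cs ! (2 + 3 * k) = snd (fst (cs ! k))" using *[of 1] c by simp
  show "encode_constraints L cs ! (3 + 3 * k) = snd (cs ! k)"
    using *[of 2] c by (simp add: numeral_3_eq_3 numeral_2_eq_2)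
qed

lemma
  assumes "\<And>x. x < N \<Longrightarrow> length (H x) \<le> L"
  shows length_encode_input: "length (encode_input L N \<rho> H lam) = 3 + N * N + N * (1 + 3 * L)"
    and nth_encode_input_dist: "x < N \<Longrightarrow> y < N \<Longrightarrow>
      encode_input L N \<rho> H lam ! (3 + x * N + y) = encode_dist (\<rho> x y)"
    and nth_encode_input_constraints: "x < N \<Longrightarrow> j < 1 + 3 * L \<Longrightarrow>
      encode_input L N \<rho> H lam ! (3 + N * N + x * (1 + 3 * L) + j) = encode_constraints L (H x) ! j"
proof -
  define D where "D = concat (map (\<lambda>x. map (\<lambda>y. encode_dist (\<rho> x y)) [0..<N]) [0..<N])"
  define R where "R = concat (map (\<lambda>x. encode_constraints L (H x)) [0..<N])"
  have e: "encode_input L N \<rho> H lam = [real L, real N, lam] @ D @ R"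
    by (simp add: encode_input_def D_def R_def)
  have lD: "length D = N * N" unfolding D_def by (subst length_concat_uniform[where m = N]) auto
  have lR: "length R = N * (1 + 3 * L)" unfolding R_def
    by (subst length_concat_uniform[where m = "1 + 3 * L"]) (use assms length_encode_constraints in auto)
  show "length (encode_input L N \<rho> H lam) = 3 + N * N + N * (1 + 3 * L)" using lD lR by (simp add: e)
  have nD: "([real L, real N, lam] @ D @ R) ! (3 + i) = D ! i" if "i < N * N" for i
    using that lD by (simp add: nth_append numeral_3_eq_3)
  have nR: "([real L, real N, lam] @ D @ R) ! (3 + (N * N + i)) = R ! i" for i
    using lD by (simp add: nth_append numeral_3_eq_3)
  show "encode_input L N \<rho> H lam ! (3 + x * N + y) = encode_dist (\<rho> x y)" if "x < N" "y < N"
  proof -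
    have "Suc x * N \<le> N * N" using that by (intro mult_right_mono) auto
    then have i: "x * N + y < N * N" using that by simp
    have "D ! (x * N + y) = map (\<lambda>y. encode_dist (\<rho> ([0..<N] ! x) y)) [0..<N] ! y"
      unfolding D_def by (rule nth_concat_uniform) (use that in auto)
    then show ?thesis using nD[OF i] that unfolding e by (simp add: add.assoc)
  qed
  show "encode_input L N \<rho> H lam ! (3 + N * N + x * (1 + 3 * L) + j) = encode_constraints L (H x) ! j"
    if "x < N" "j < 1 + 3 * L"
  proof -
    have "R ! (x * (1 + 3 * L) + j) = encode_constraints L (H ([0..<N] ! x)) ! j"
      unfolding R_def by (rule nth_concat_uniform) (use that assms length_encode_constraints in auto)
    then show ?thesis using nR[of "x * (1 + 3 * L) + j"] that unfolding e by (simp only: add.assoc) simp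
  qed
qed

lemma encode_dist_nonneg: "0 \<le> encode_dist d \<longleftrightarrow> d \<noteq> \<infinity>"
  by (simp add: encode_dist_def)

lemma ennreal_encode_dist: "0 \<le> encode_dist d \<Longrightarrow> d = ennreal (encode_dist d)"
  by (cases d) (auto simp: encode_dist_def split: if_splits)

lemma encode_dist_triangle:
  assumes "d \<le> d1 + d2" "0 \<le> encode_dist d1" "0 \<le> encode_dist d2"
  shows "0 \<le> encode_dist d \<and> encode_dist d \<le> encode_dist d1 + encode_dist d2"
proof -
  have "d1 + d2 = ennreal (encode_dist d1 + encode_dist d2)"
    using ennreal_encode_dist[OF assms(2)] ennreal_encode_dist[OF assms(3)] assms(2,3)
    by (metis ennreal_plus)
  then have le: "d \<le> ennreal (encode_dist d1 + encode_dist d2)" using assms(1) by simp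
  then have f: "0 \<le> encode_dist d" by (auto simp: encode_dist_nonneg top_unique)
  then show ?thesis using le ennreal_encode_dist[OF f] assms(2,3)
    by (metis add_nonneg_nonneg ennreal_le_iff)
qed

text \<open>Positivity of \<open>K\<close> matters at infinite distance: K * \<infinity> is then
  \<infinity> and imposes nothing, whereas 0 * \<infinity> = 0 would force equal values.\<close>

lemma lipschitz_le_iff:
  assumes "0 < K"
  shows "lipschitz_le {..<N} \<rho> K f \<longleftrightarrow> (\<forall>x<N. \<forall>y<N. 0 \<le> encode_dist (\<rho> x y) \<longrightarrow>
    \<bar>fst (f x) - fst (f y)\<bar> \<le> K * encode_dist (\<rho> x y) \<and> \<bar>snd (f x) - snd (f y)\<bar> \<le> K * encode_dist (\<rho> x y))"
proof -
  have "ennreal (max_norm (f x - f y)) \<le> ennreal K * \<rho> x y \<longleftrightarrow> (0 \<le> encode_dist (\<rho> x y) \<longrightarrow>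
    \<bar>fst (f x) - fst (f y)\<bar> \<le> K * encode_dist (\<rho> x y) \<and> \<bar>snd (f x) - snd (f y)\<bar> \<le> K * encode_dist (\<rho> x y))" for x y
  proof (cases "0 \<le> encode_dist (\<rho> x y)")
    case True
    have "ennreal K * \<rho> x y = ennreal (K * encode_dist (\<rho> x y))"
      using ennreal_encode_dist[OF True] assms True by (metis ennreal_mult less_imp_le)
    moreover have "0 \<le> K * encode_dist (\<rho> x y)" using assms True by simp
    ultimately show ?thesis using True by (simp add: ennreal_le_iff max_norm_def)
  next
    case False
    then have "\<rho> x y = \<infinity>" by (simp add: encode_dist_nonneg)
    then have "ennreal K * \<rho> x y = \<infinity>" using assms by (simp add: ennreal_mult_top)
    then show ?thesis using False by simp
  qed
  then show ?thesis unfolding lipschitz_le_def by auto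
qed

subsection \<open>The complete program\<close>

text \<open>The address of the arrays, computed from \<open>L\<close> and \<open>N\<close> in the first two cells of the input.\<close>

definition base_exp :: expr where
  "base_exp = Arith Plus (Lit 67) (Arith Plus (Arith Times (Fetch (Lit 65)) (Fetch (Lit 65)))
     (Arith Times (Fetch (Lit 65)) (Arith Plus (Lit 1) (Arith Times (Lit 3) (Fetch (Lit 64))))))"

definition main_prog :: com where
  "main_prog = load_prog ;; solve_prog ;; output_prog"

text \<open>Compiled array accesses rely on cell 0, which no command of the language can write since
  variables start at 1; hence the bare store in front.\<close>

definition selection_prog :: prog where
  "selection_prog = Seq (Store (Lit 0) base_exp) (compile main_prog)"

definition initial_state :: "real list \<Rightarrow> state" where
  "initial_state inp l = (case l of Inp i \<Rightarrow> if i < length inp then inp ! i else 0 | _ \<Rightarrow> 0)"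

lemma (in machine) mem_initial_state:
  assumes "length inp = il"
  shows "(initial_memory 64 (64 + il + 32 * cp) inp)[0 := real (64 + il)] = mem (initial_state inp)"
  by (intro nth_equalityI)
    (use assms in \<open>auto simp: initial_memory_def nth_mem cell_def initial_state_def nth_append nth_list_update\<close>)

lemma (in machine) exec_base:
  assumes inp: "length inp = il" "2 < il" "inp ! 0 = real L" "inp ! 1 = real N"
    and il: "il = 3 + N * N + N * (1 + 3 * L)"
  shows "exec (Store (Lit 0) base_exp) (initial_memory 64 (64 + il + 32 * cp) inp) (ops base_exp + 2)
    (mem (initial_state inp))"
proof -
  define m where "m = initial_memory 64 (64 + il + 32 * cp) inp"
  have m: "length m = 64 + il + 32 * cp" "m ! 64 = real L" "m ! 65 = real N"
    using inp by (auto simp: m_def initial_memory_def nth_append)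
  have v: "valid_address m 64" "valid_address m 65" "valid_address m 0"
    using valid_address_of_nat[of m 64] valid_address_of_nat[of m 65] m inp(2) by auto
  have "eval m base_exp = Some (67 + (real N * real N + real N * (1 + 3 * real L)))"
    using m v by (simp add: base_exp_def)
  also have "67 + (real N * real N + real N * (1 + 3 * real L)) = real (64 + il)"
    by (simp add: il algebra_simps)
  finally have "exec (Store (Lit 0) base_exp) m (ops (Lit 0) + ops base_exp + 1) (m[nat \<lfloor>0::real\<rfloor> := real (64 + il)])"
    using v by (intro exec.Store) auto
  then show ?thesis using mem_initial_state[OF inp(1)] by (simp add: m_def)
qed

text \<open>Each monomial is at most \<open>L\<^sup>2 * N\<^sup>2\<close>, and the coefficients add
  up to 641.\<close>

lemma cost_bound:
  fixes L N n :: real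
  assumes "1 \<le> L" "1 \<le> N" "0 \<le> n" "n \<le> N * L"
  shows "N * (22 * L + 7) + 3 + ((n * (7 * n + 4) + 2) +
     4 * (n * (6 * n + 9) + N * (65 * n + 32) + N * (9 * N + 8) + 7) + 2 * (N * 8 + 2) +
     (N * (11 * n + 9) + 2)) + (N * 4 + 6) \<le> 1000 * L\<^sup>2 * N\<^sup>2"
proof -
  define X where "X = L\<^sup>2 * N\<^sup>2"
  have L2: "L \<le> L\<^sup>2" "1 \<le> L\<^sup>2" using assms(1) self_le_power[of L 2] one_le_power[of L 2] by simp_all
  have N2: "N \<le> N\<^sup>2" "1 \<le> N\<^sup>2" using assms(2) self_le_power[of N 2] one_le_power[of N 2] by simp_all
  have 1: "1 \<le> X" using mult_mono[of 1 "L\<^sup>2" 1 "N\<^sup>2"] L2 N2 by (simp add: X_def)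
  have 2: "N \<le> X" using mult_mono[of 1 "L\<^sup>2" N "N\<^sup>2"] L2 N2 assms by (simp add: X_def)
  have 3: "N * N \<le> X" using mult_mono[of 1 "L\<^sup>2" "N * N" "N\<^sup>2"] L2 assms by (simp add: X_def power2_eq_square)
  have 4: "N * L \<le> X" using mult_mono[of L "L\<^sup>2" N "N\<^sup>2"] L2 N2 assms by (simp add: X_def mult.commute)
  have 5: "n \<le> X" using 4 assms by simp
  have 6: "n * n \<le> X" using mult_mono[of n "N * L" n "N * L"] assms
    by (simp add: X_def power2_eq_square mult.commute mult.left_commute)
  have "N * n \<le> N * (N * L)" using assms by (intro mult_left_mono) auto
  also have "\<dots> = L * N\<^sup>2" by (simp add: power2_eq_square)
  also have "\<dots> \<le> X" unfolding X_def using L2 by (intro mult_right_mono) auto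
  finally have 7: "N * n \<le> X" .
  have "N * (22 * L + 7) + 3 + ((n * (7 * n + 4) + 2) +
     4 * (n * (6 * n + 9) + N * (65 * n + 32) + N * (9 * N + 8) + 7) + 2 * (N * 8 + 2) +
     (N * (11 * n + 9) + 2)) + (N * 4 + 6) =
     22 * (N * L) + 31 * (n * n) + 40 * n + 271 * (N * n) + 36 * (N * N) + 196 * N + 45"
    by (simp add: algebra_simps)
  also have "\<dots> \<le> 1000 * X" using 1 2 3 4 5 6 7 by linarith
  finally show ?thesis by (simp add: X_def mult.assoc)
qed

section \<open>Correctness and cost of the complete computation\<close>

context loaded
begin

definition lipschitz_by :: "(nat \<Rightarrow> nat \<Rightarrow> real) \<Rightarrow> real \<Rightarrow> (nat \<Rightarrow> real) \<Rightarrow> bool" where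
  "lipschitz_by \<rho> K h \<longleftrightarrow> (\<forall>x<N. \<forall>y<N. 0 \<le> \<rho> x y \<longrightarrow> \<bar>h x - h y\<bar> \<le> K * \<rho> x y)"

definition selects :: "(nat \<Rightarrow> real) \<Rightarrow> (nat \<Rightarrow> real) \<Rightarrow> bool" where
  "selects h1 h2 \<longleftrightarrow> (\<forall>x<N. \<forall>c\<in>set (H x). (h1 x, h2 x) \<in> half_plane c)"

definition outcome :: "(nat \<Rightarrow> nat \<Rightarrow> real) \<Rightarrow> real \<Rightarrow> state \<Rightarrow> bool" where
  "outcome \<rho> lam s \<longleftrightarrow> s (Inp 0) = 1 \<and> selects (\<lambda>x. s (Inp (1 + 2 * x))) (\<lambda>x. s (Inp (2 + 2 * x))) \<and>
       lipschitz_by \<rho> (3 * lam) (\<lambda>x. s (Inp (1 + 2 * x))) \<and> lipschitz_by \<rho> (3 * lam) (\<lambda>x. s (Inp (2 + 2 * x))) \<or>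
     s (Inp 0) = 0 \<and> \<not> (\<exists>h1 h2. selects h1 h2 \<and> lipschitz_by \<rho> lam h1 \<and> lipschitz_by \<rho> lam h2)"

lemma main_spec:
  assumes inp: "constraints_in s0" "s0 (Inp 2) = lam" "\<forall>x<N. \<forall>y<N. s0 (Inp (3 + x * N + y)) = \<rho> x y"
    and 6: "s0 (Var 6) = 0" and pos: "1 \<le> L" "1 \<le> N" "0 < lam"
    and \<rho>: "\<And>x. x < N \<Longrightarrow> \<rho> x x = 0" "\<And>x y. x < N \<Longrightarrow> y < N \<Longrightarrow> \<rho> x y = \<rho> y x"
      "\<And>x y w. x < N \<Longrightarrow> y < N \<Longrightarrow> w < N \<Longrightarrow> 0 \<le> \<rho> x y \<Longrightarrow> 0 \<le> \<rho> y w \<Longrightarrow>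
        0 \<le> \<rho> x w \<and> \<rho> x w \<le> \<rho> x y + \<rho> y w"
  shows "wp main_prog (\<lambda>s t'. outcome \<rho> lam s \<and> t' \<ge> t - 1000 * (real L)\<^sup>2 * (real N)\<^sup>2) s0 t"
  unfolding main_prog_def
proof (rule wp_Seq, rule wp_conseq_frame[OF load_spec[OF inp(1)]])
  fix s1 t1
  assume "\<exists>n\<le>N * L. s1 (Var 3) = real n \<and> normalised s1 n N \<and> (\<forall>x<N. represents s1 n x (H x)) \<and>
      t1 \<ge> t - (real N * (22 * real L + 7) + 3)"
    and fr: "\<And>l. \<not> touches load_prog l \<Longrightarrow> s1 l = s0 l"
  then obtain n where n: "n \<le> N * L" "s1 (Var 3) = real n" "normalised s1 n N"
    "\<forall>x<N. represents s1 n x (H x)" and t1: "t1 \<ge> t - (real N * (22 * real L + 7) + 3)" by blast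
  have same: "s1 (Inp i) = s0 (Inp i)" "s1 (Var 6) = 0" for i
    using fr 6 by (auto simp: load_prog_def load_body_touches normalise_body_touches)
  define p where "p = arr s1 0"
  define q where "q = arr s1 1"
  define \<gamma> where "\<gamma> = arr s1 4"
  define z where "z = (\<lambda>i. idx (arr s1 5 i))"
  have zz: "arr s1 5 i = real (z i)" "z i < N" if "i < n" for i
    using n(3) that unfolding normalised_def z_def by auto
  interpret selection_problem il cp N n \<rho> lam p q \<gamma> z
  proof
    show "\<bar>p i\<bar> + \<bar>q i\<bar> = 1" if "i < n" for i using n(3) that unfolding normalised_def p_def q_def by blast
    show "z i < N" if "i < n" for i using zz that by blast
    have "N * 1 \<le> N * L" using pos by (intro mult_left_mono) auto
    then show "n \<le> cp" "N \<le> cp" "0 < cp" using n(1) cp by linarith+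
    show "3 + N * N \<le> il" by (simp add: il)
  qed (use \<rho> pos in blast)+
  have sel: "(u1, u2) \<in> (\<Inter>c\<in>set (H x). half_plane c) \<longleftrightarrow> (\<forall>i<n. z i = x \<longrightarrow> p i * u1 + q i * u2 \<le> \<gamma> i)"
    if "x < N" for x u1 u2
  proof -
    have "represents s1 n x (H x)" using n(4) that by blast
    then have "(\<forall>c\<in>set (H x). (u1, u2) \<in> half_plane c) \<longleftrightarrow>
        (\<forall>i<n. arr s1 5 i = real x \<longrightarrow> p i * u1 + q i * u2 \<le> \<gamma> i)"
      unfolding represents_def p_def q_def \<gamma>_def by (metis fst_conv snd_conv)
    also have "\<dots> \<longleftrightarrow> (\<forall>i<n. z i = x \<longrightarrow> p i * u1 + q i * u2 \<le> \<gamma> i)"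
      using zz(1) by (metis of_nat_eq_iff)
    finally show ?thesis by blast
  qed
  have neg: "arr s1 2 i = - q i" "arr s1 3 i = - p i" if "i < n" for i
    using n(3) that unfolding normalised_def p_def q_def by blast+
  have ai: "all_inputs s1"
    unfolding all_inputs_def Y.U.inputs_def Y.D.inputs_def X.U.inputs_def X.D.inputs_def
    using inp n(2) same zz neg by (auto simp: p_def q_def \<gamma>_def constraints_in_def)
  show "wp (solve_prog ;; output_prog)
     (\<lambda>s t'. outcome \<rho> lam s \<and> t' \<ge> t - 1000 * (real L)\<^sup>2 * (real N)\<^sup>2) s1 t1"
  proof (rule wp_Seq, rule wp_conseq_frame[OF solve_spec[OF ai same(2)]])
    fix s2 t2
    assume *: "(s2 (Var 6) = 0 \<and> solution (arr s2 22) (arr s2 23) \<or>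
      s2 (Var 6) = 1 \<and> \<not> (\<exists>h1 h2. selection h1 h2)) \<and> t2 \<ge> t1 - solve_cost"
      and fr2: "\<And>l. \<not> touches solve_prog l \<Longrightarrow> s2 l = s1 l"
    have "\<not> touches solve_prog (Inp 1)"
      using Y.U.dir_prog_touches[of 12] Y.D.dir_prog_touches[of 14] X.U.dir_prog_touches[of 16] X.D.dir_prog_touches[of 18]
      by (auto simp: solve_prog_def conflict_prog_def conflict_inner_touches choose_body_touches project_body_touches)
    then have i1: "s2 (Inp 1) = real N" using fr2 same inp by (simp add: constraints_in_def)
    have v6: "s2 (Var 6) = 0 \<or> s2 (Var 6) = 1" using * by blast
    show "wp output_prog (\<lambda>s t'. outcome \<rho> lam s \<and> t' \<ge> t - 1000 * (real L)\<^sup>2 * (real N)\<^sup>2) s2 t2"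
    proof (rule wp_conseq[OF output_spec[OF i1 pos(1) v6]])
      fix s t'
      assume **: "(s2 (Var 6) = 0 \<longrightarrow> s (Inp 0) = 1 \<and>
          (\<forall>x<N. s (Inp (1 + 2 * x)) = arr s2 22 x \<and> s (Inp (2 + 2 * x)) = arr s2 23 x)) \<and>
        (s2 (Var 6) = 1 \<longrightarrow> s (Inp 0) = 0) \<and> t' \<ge> t2 - (real N * 4 + 6)"
      have "real n \<le> real N * real L" using n(1) by (metis of_nat_le_iff of_nat_mult)
      then have "real N * (22 * real L + 7) + 3 + solve_cost + (real N * 4 + 6) \<le> 1000 * (real L)\<^sup>2 * (real N)\<^sup>2"
        unfolding solve_cost_def Y.U.dir_cost_def using pos by (intro cost_bound) auto
      then have "t' \<ge> t - 1000 * (real L)\<^sup>2 * (real N)\<^sup>2" using t1 * ** by linarith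
      moreover have "outcome \<rho> lam s"
      proof (cases "s2 (Var 6) = 0")
        case True
        then have sol: "solution (arr s2 22) (arr s2 23)" using * by auto
        have o: "s (Inp 0) = 1" "s (Inp (1 + 2 * x)) = arr s2 22 x" "s (Inp (2 + 2 * x)) = arr s2 23 x"
          if "x < N" for x using ** True that by auto
        have "selects (\<lambda>x. s (Inp (1 + 2 * x))) (\<lambda>x. s (Inp (2 + 2 * x)))"
          unfolding selects_def
        proof (intro allI impI)
          fix x assume x: "x < N"
          have "p i * arr s2 22 x + q i * arr s2 23 x \<le> \<gamma> i" if "i < n" "z i = x" for i
          proof -
            \<comment> \<open>At the owner itself the relaxation is 0, so obeying all relaxed
              constraints includes membership in the given polygon.\<close>
            have "i \<in> act x" "sh i x = \<gamma> i" using that \<rho>(1)[OF x] by (simp_all add: act_def sh_def)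
            then show ?thesis using sol x unfolding solution_def by force
          qed
          then have "(arr s2 22 x, arr s2 23 x) \<in> (\<Inter>c\<in>set (H x). half_plane c)" using sel[OF x] by blast
          then show "\<forall>c\<in>set (H x). (s (Inp (1 + 2 * x)), s (Inp (2 + 2 * x))) \<in> half_plane c"
            using o[OF x] by simp
        qed
        moreover have "lipschitz_by \<rho> (3 * lam) (\<lambda>x. s (Inp (1 + 2 * x)))"
          "lipschitz_by \<rho> (3 * lam) (\<lambda>x. s (Inp (2 + 2 * x)))"
          using sol o unfolding lipschitz_by_def solution_def by (simp_all add: mult.assoc)
        moreover have "s (Inp 0) = 1" using o(1)[of 0] pos by simp
        ultimately show ?thesis unfolding outcome_def by blast
      next
        case False
        then have 1: "s2 (Var 6) = 1" using v6 by blast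
        then have ns: "\<not> (\<exists>h1 h2. selection h1 h2)" using * by auto
        have "selection h1 h2" if h: "selects h1 h2" "lipschitz_by \<rho> lam h1" "lipschitz_by \<rho> lam h2" for h1 h2
          unfolding selection_def
        proof (intro conjI allI impI)
          fix i assume i: "i < n"
          have "(h1 (z i), h2 (z i)) \<in> (\<Inter>c\<in>set (H (z i)). half_plane c)"
            using h(1) zz(2)[OF i] unfolding selects_def by blast
          then show "p i * h1 (z i) + q i * h2 (z i) \<le> \<gamma> i" using sel[OF zz(2)[OF i]] i by blast
        qed (use h in \<open>auto simp: lipschitz_by_def\<close>)
        then show ?thesis using ns 1 ** unfolding outcome_def by auto
      qed
      ultimately show "outcome \<rho> lam s \<and> t' \<ge> t - 1000 * (real L)\<^sup>2 * (real N)\<^sup>2" by blast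
    qed
  qed
qed

end

theorem theorem6p10:
  "\<exists>(C::real) (p::prog) (b::nat). C > 0 \<and>
    (\<forall>(L::nat) (N::nat) (\<rho> :: nat \<Rightarrow> nat \<Rightarrow> ennreal)
       (F :: nat \<Rightarrow> (real \<times> real) set) (H :: nat \<Rightarrow> linear_constraint list) (lam::real).
       L \<ge> 1 \<longrightarrow> N \<ge> 1 \<longrightarrow> pseudometric_on {..<N} \<rho> \<longrightarrow>
       (\<forall>x\<in>{..<N}. F x \<in> PG L \<and> presents L (H x) (F x)) \<longrightarrow> lam > 0 \<longrightarrow>
       (\<exists>(S::nat) (t::nat) (m::memory).
          real t \<le> C * (real L)^2 * (real N)^2 \<and>
          real S \<le> C * (real L)^2 * (real N)^2 \<and>
          b + length (encode_input L N \<rho> H lam) \<le> S \<and>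
          exec p (initial_memory b S (encode_input L N \<rho> H lam)) t m \<and>
          (no_go b m \<and>
             \<not> (\<exists>f. lipschitz_le {..<N} \<rho> lam f \<and> (\<forall>x\<in>{..<N}. f x \<in> F x))
           \<or>
           success b m \<and>
             lipschitz_le {..<N} \<rho> (3 * lam) (output_map b m) \<and>
             (\<forall>x\<in>{..<N}. output_map b m x \<in> F x))))"
proof -
  define W where "W = real (width main_prog)"
  \<comment> \<open>\<open>ops base_exp + 2\<close> is the cost of storing the array address, 1000 *
    W that of the main program, with \<open>W\<close> operations for each of its steps; the last
    1000 covers the memory.\<close>
  define C where "C = real (ops base_exp) + 2 + 1000 * W + 1000"
  have W0: "0 \<le> W" by (simp add: W_def)
  have C0: "0 < C" using W0 by (simp add: C_def)
  have main: "\<exists>(S::nat) (t::nat) (m::memory).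
          real t \<le> C * (real L)^2 * (real N)^2 \<and>
          real S \<le> C * (real L)^2 * (real N)^2 \<and>
          64 + length (encode_input L N \<rho> H lam) \<le> S \<and>
          exec selection_prog (initial_memory 64 S (encode_input L N \<rho> H lam)) t m \<and>
          (no_go 64 m \<and>
             \<not> (\<exists>f. lipschitz_le {..<N} \<rho> lam f \<and> (\<forall>x\<in>{..<N}. f x \<in> F x))
           \<or>
           success 64 m \<and>
             lipschitz_le {..<N} \<rho> (3 * lam) (output_map 64 m) \<and>
             (\<forall>x\<in>{..<N}. output_map 64 m x \<in> F x))"
    if pos: "1 \<le> L" "1 \<le> N" "0 < lam" and met: "pseudometric_on {..<N} \<rho>"
      and F: "\<forall>x\<in>{..<N}. F x \<in> PG L \<and> presents L (H x) (F x)"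
    for L N :: nat and \<rho> :: "nat \<Rightarrow> nat \<Rightarrow> ennreal" and F H lam
  proof -
    define il where "il = 3 + N * N + N * (1 + 3 * L)"
    define cp where "cp = N * L + 1"
    define inp where "inp = encode_input L N \<rho> H lam"
    define d where "d = (\<lambda>x y. encode_dist (\<rho> x y))"
    have pres: "length (H x) \<le> L" "\<And>c. c \<in> set (H x) \<Longrightarrow> fst c \<noteq> 0" "F x = (\<Inter>c\<in>set (H x). half_plane c)"
      if "x < N" for x using F that by (auto simp: presents_def)
    interpret loaded il cp L N H
      by unfold_locales (use pres in \<open>auto simp: il_def cp_def\<close>)
    have len_inp: "length inp = il" unfolding inp_def il_def by (rule length_encode_input) (use pres in auto)
    have heads: "inp ! 0 = real L" "inp ! 1 = real N" "inp ! 2 = lam"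
      by (simp_all add: inp_def encode_input_def)
    define s0 where "s0 = initial_state inp"
    have s0: "s0 (Inp i) = inp ! i" if "i < il" for i using that len_inp by (simp add: s0_def initial_state_def)
    have il3: "2 < il" by (simp add: il_def)
    have cin: "constraints_in s0"
      unfolding constraints_in_def
    proof (intro conjI allI impI)
      show "s0 (Inp 0) = real L" "s0 (Inp 1) = real N" using s0[of 0] s0[of 1] heads il3 by auto
      fix x assume x: "x < N"
      have o: "offset x + j < il" if "j < 1 + 3 * L" for j using offset_bound[OF x] that by simp
      have c: "s0 (Inp (offset x + j)) = encode_constraints L (H x) ! j" if "j < 1 + 3 * L" for j
        using s0[OF o[OF that]] nth_encode_input_constraints[of N H L x j \<rho> lam] pres x that
        by (simp add: inp_def offset_def)
      show "s0 (Inp (offset x)) = real (length (H x))" using c[of 0] by (simp add: encode_constraints_def)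
      fix k assume k: "k < length (H x)"
      then have kL: "k < L" using pres(1)[OF x] by simp
      show "s0 (Inp (offset x + 1 + 3 * k)) = fst (fst (H x ! k))"
        using c[of "1 + 3 * k"] nth_encode_constraints(1)[OF k, of L] kL by (simp add: add.assoc)
      show "s0 (Inp (offset x + 2 + 3 * k)) = snd (fst (H x ! k))"
        using c[of "2 + 3 * k"] nth_encode_constraints(2)[OF k, of L] kL by (simp add: add.assoc)
      show "s0 (Inp (offset x + 3 + 3 * k)) = snd (H x ! k)"
        using c[of "3 + 3 * k"] nth_encode_constraints(3)[OF k, of L] kL by (simp add: add.assoc)
    qed
    have table: "\<forall>x<N. \<forall>y<N. s0 (Inp (3 + x * N + y)) = d x y"
    proof (intro allI impI)
      fix x y assume xy: "x < N" "y < N"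
      have "Suc x * N \<le> N * N" using xy by (intro mult_right_mono) auto
      then have "3 + x * N + y < il" using xy by (simp add: il_def)
      then show "s0 (Inp (3 + x * N + y)) = d x y"
        using s0 nth_encode_input_dist[of N H L x y \<rho> lam] pres xy by (simp add: inp_def d_def)
    qed
    \<comment> \<open>Started without credits, a run ends at minus its number of steps, so the lower
      bound on the credits bounds the running time.\<close>
    have run: "wp main_prog (\<lambda>s t'. outcome d lam s \<and> t' \<ge> 0 - 1000 * (real L)\<^sup>2 * (real N)\<^sup>2) s0 0"
    proof (rule main_spec[OF cin _ table _ pos])
      show "s0 (Inp 2) = lam" using s0 heads il3 by simp
      show "s0 (Var 6) = 0" by (simp add: s0_def initial_state_def)
      show "d x x = 0" if "x < N" for x using met that by (auto simp: pseudometric_on_def d_def encode_dist_def)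
      show "d x y = d y x" if "x < N" "y < N" for x y
        using met that unfolding pseudometric_on_def d_def by (metis lessThan_iff)
      show "0 \<le> d x w \<and> d x w \<le> d x y + d y w" if "x < N" "y < N" "w < N" "0 \<le> d x y" "0 \<le> d y w" for x y w
      proof -
        have "\<rho> x w \<le> \<rho> x y + \<rho> y w" using met that(1-3) unfolding pseudometric_on_def by blast
        then show ?thesis using encode_dist_triangle that(4,5) unfolding d_def by blast
      qed
    qed
    then obtain k s where k: "runs main_prog s0 k s" "outcome d lam s" "real k \<le> 1000 * (real L)\<^sup>2 * (real N)\<^sup>2"
      unfolding wp_def by auto
    obtain t where t: "exec (compile main_prog) (mem s0) t (mem s)" "t \<le> width main_prog * k"
      using runs_exec[OF k(1)] by blast
    define S where "S = 64 + il + 32 * cp"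
    define X where "X = (real L)\<^sup>2 * (real N)\<^sup>2"
    have X1: "1 \<le> X" using pos mult_mono[of 1 "(real L)\<^sup>2" 1 "(real N)\<^sup>2"] by (simp add: X_def)
    have ex: "exec selection_prog (initial_memory 64 S inp) (ops base_exp + 2 + t) (mem s)"
      unfolding selection_prog_def S_def
      by (rule exec.Seq[OF exec_base[OF len_inp il3 heads(1,2) il_def] t(1)[unfolded s0_def]])
    have "real t \<le> W * real k" using t(2) unfolding W_def by (metis of_nat_le_iff of_nat_mult)
    also have "\<dots> \<le> W * (1000 * X)" using k(3) W0 by (intro mult_left_mono) (auto simp: X_def)
    finally have "real (ops base_exp + 2 + t) \<le> (real (ops base_exp) + 2) * 1 + 1000 * W * X" by simp
    also have "\<dots> \<le> (real (ops base_exp) + 2) * X + 1000 * W * X"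
      using X1 by (intro add_right_mono mult_left_mono) auto
    also have "\<dots> \<le> C * X" using X1 by (simp add: C_def algebra_simps)
    finally have time: "real (ops base_exp + 2 + t) \<le> C * (real L)\<^sup>2 * (real N)\<^sup>2" by (simp add: X_def mult.assoc)
    have "real S \<le> 1000 * X"
    proof -
      have "N * N \<le> L\<^sup>2 * N\<^sup>2" using pos by (simp add: power2_eq_square)
      moreover have "N \<le> L\<^sup>2 * N\<^sup>2" using pos by (simp add: power2_eq_square)
      moreover have "N * L \<le> L\<^sup>2 * N\<^sup>2" using pos by (simp add: power2_eq_square)
      moreover have "1 \<le> L\<^sup>2 * N\<^sup>2" using pos by (simp add: power2_eq_square)
      \<comment> \<open>99 = 64 + 3 + 32 and 35 = 3 + 32: variables, header of the input and the 32
        arrays of N L + 1 cells, next to 3 N L cells for constraints.\<close>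
      moreover have "S = 99 + N * N + N + 35 * (N * L)" by (simp add: S_def il_def cp_def algebra_simps)
      ultimately have "S \<le> 1000 * (L\<^sup>2 * N\<^sup>2)" by linarith
      then have "real S \<le> real (1000 * (L\<^sup>2 * N\<^sup>2))" by (simp only: of_nat_le_iff)
      then show ?thesis by (simp add: X_def)
    qed
    also have "\<dots> \<le> C * X" using X1 W0 by (intro mult_right_mono) (auto simp: C_def)
    finally have space: "real S \<le> C * (real L)\<^sup>2 * (real N)\<^sup>2" by (simp add: X_def mult.assoc)
    have out: "mem s ! 64 = s (Inp 0)" "\<And>x. x < N \<Longrightarrow> output_map 64 (mem s) x = (s (Inp (1 + 2 * x)), s (Inp (2 + 2 * x)))"
    proof -
      have m: "mem s ! (64 + i) = s (Inp i)" if "i < il" for i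
        using that by (simp add: nth_mem cell_Inp)
      show "mem s ! 64 = s (Inp 0)" using m[of 0] il3 by simp
      show "output_map 64 (mem s) x = (s (Inp (1 + 2 * x)), s (Inp (2 + 2 * x)))" if "x < N" for x
      proof -
        have "N * 4 \<le> N * (1 + 3 * L)" using pos by (intro mult_left_mono) auto
        then have "2 + 2 * x < il" using that unfolding il_def by linarith
        then show ?thesis using m[of "1 + 2 * x"] m[of "2 + 2 * x"] by (simp add: output_map_def)
      qed
    qed
    have result: "no_go 64 (mem s) \<and> \<not> (\<exists>f. lipschitz_le {..<N} \<rho> lam f \<and> (\<forall>x\<in>{..<N}. f x \<in> F x)) \<or>
      success 64 (mem s) \<and> lipschitz_le {..<N} \<rho> (3 * lam) (output_map 64 (mem s)) \<and>
      (\<forall>x\<in>{..<N}. output_map 64 (mem s) x \<in> F x)"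
      using k(2) unfolding outcome_def
    proof (elim disjE conjE)
      assume "s (Inp 0) = 1" and sel: "selects (\<lambda>x. s (Inp (1 + 2 * x))) (\<lambda>x. s (Inp (2 + 2 * x)))"
        and lip: "lipschitz_by d (3 * lam) (\<lambda>x. s (Inp (1 + 2 * x)))" "lipschitz_by d (3 * lam) (\<lambda>x. s (Inp (2 + 2 * x)))"
      then have "success 64 (mem s)" by (simp add: success_def out)
      moreover have "lipschitz_le {..<N} \<rho> (3 * lam) (output_map 64 (mem s))"
        using lip pos out(2) unfolding lipschitz_by_def d_def by (subst lipschitz_le_iff) auto
      moreover have "\<forall>x\<in>{..<N}. output_map 64 (mem s) x \<in> F x"
        using sel out(2) pres(3) unfolding selects_def by auto
      ultimately show ?thesis by blast
    next
      assume 0: "s (Inp 0) = 0"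
        and no: "\<not> (\<exists>h1 h2. selects h1 h2 \<and> lipschitz_by d lam h1 \<and> lipschitz_by d lam h2)"
      have "\<not> (\<exists>f. lipschitz_le {..<N} \<rho> lam f \<and> (\<forall>x\<in>{..<N}. f x \<in> F x))"
      proof
        assume "\<exists>f. lipschitz_le {..<N} \<rho> lam f \<and> (\<forall>x\<in>{..<N}. f x \<in> F x)"
        then obtain f where f: "lipschitz_le {..<N} \<rho> lam f" "\<forall>x\<in>{..<N}. f x \<in> F x" by blast
        have "selects (\<lambda>x. fst (f x)) (\<lambda>x. snd (f x))" using f(2) pres(3) unfolding selects_def by auto
        moreover have "lipschitz_by d lam (\<lambda>x. fst (f x))" "lipschitz_by d lam (\<lambda>x. snd (f x))"
          using f(1) unfolding lipschitz_le_iff[OF pos(3)] lipschitz_by_def d_def by auto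
        ultimately show False using no by blast
      qed
      then show ?thesis using 0 by (simp add: no_go_def out)
    qed
    have fits: "64 + length inp \<le> S" by (simp add: S_def len_inp)
    show ?thesis using time space fits ex result unfolding inp_def by blast
  qed
  show ?thesis
    by (intro exI[of _ C] exI[of _ selection_prog] exI[of _ "64::nat"] conjI allI impI C0 main)
qed

end
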